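(* Let $\alpha$ be a signature, let $\mathcal{R}\subseteq\mathrm{Fin}_\alpha$ be an at most countable set of $\alpha$-structures, each having its (finite) domain contained in $\mathbb{Z}_+=\{1,2,\ldots\}$, and fix an ordering $\mathcal{R}=(\mathcal{R}_n)_{n\ge1}$ of its elements. Let $\mathbf{X}_{\cong}$ be a relationally exchangeable random structure in $\mathcal{R}_{\mathbb{N}}^{\cong}$. Then there exists a probability measure $\phi$ on the $\mathcal{R}$-simplex $\mathcal{F}_{\mathcal{R}}$ such that $\mathbf{X}_{\cong}$ has distribution $\varepsilon_\phi$, where $$\varepsilon_\phi(\cdot)=\int_{\mathcal{F}_{\mathcal{R}}}\varepsilon_f(\cdot)\,\phi(df).$$
   Context: **Structures.** $\mathbb{N}=\{1,2,\ldots\}$, $[n]=\{1,\ldots,n\}$. A signature is a function $\alpha:\mathbb{N}\to\mathbb{N}\cup\{0\}$ such that $\alpha(j)=0$ implies $\alpha(k)=0$ for all $k\ge j$. An $\alpha$-structure with domain $A$ is a collection $\mathcal{A}=(R_1^{\mathcal{A}},R_2^{\mathcal{A}},\ldots)$, where $\operatorname{dom}\mathcal{A}:=A$ is a set and $R_j^{\mathcal{A}}\subseteq A^{\alpha(j)}$ for each $j$, with the convention $A^0:=\emptyset$ (so $R_j^{\mathcal{A}}=\emptyset$ if $\alpha(j)=0$). The domain is part of the data of the structure. $\mathrm{Fin}_\alpha$ is the set of all $\alpha$-structures $\mathcal{A}$ whose domain is a finite subset of $\mathbb{Z}$ and for which $\sum_{j\ge1}|R_j^{\mathcal{A}}|<\infty$.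 For a function $t$ defined on a set containing $\operatorname{dom}\mathcal{A}$ (injective or not), $t(\mathcal{A})$ is the $\alpha$-structure with domain $\{t(a):a\in\operatorname{dom}\mathcal{A}\}$ and relations $R_j^{t(\mathcal{A})}=\{(t(a_1),\ldots,t(a_{\alpha(j)})):(a_1,\ldots,a_{\alpha(j)})\in R_j^{\mathcal{A}}\}$. **Relationally labeled structures.** Let $I=[n]$ or $I=\mathbb{N}$. Two sequences $\mathbf{x},\mathbf{x}':I\to\mathrm{Fin}_\alpha$ are equivalent if there is a bijection $\rho:\bigcup_{i\in I}\operatorname{dom}\mathbf{x}'(i)\to\bigcup_{i\in I}\operatorname{dom}\mathbf{x}(i)$ with $\rho(\mathbf{x}'(i))=\mathbf{x}(i)$ for all $i\in I$; $\mathbf{x}_{\cong}$ denotes the equivalence class of $\mathbf{x}$. $\mathcal{R}_{\mathbb{N}}^{\cong}$ is the set of all classes $\mathbf{x}_{\cong}$ with $\mathbf{x}:\mathbb{N}\to\mathcal{R}$. (For $\mathcal{R}$-valued sequences, whose domains lie in $\mathbb{Z}_+$, this equivalence is the same as the existence of a bijection $\rho:\mathbb{Z}\to\mathbb{Z}$ with $\rho(\mathbf{x}'(i))=\mathbf{x}(i)$ for all $i$.) The restriction $\mathbf{R}_n\mathbf{x}_{\cong}$ is the class of $(\mathbf{x}(1),\ldots,\mathbf{x}(n))$; it does not depend on the representative. Spaces of classes of infinite sequences carry the $\sigma$-field generated by the maps $\mathbf{R}_n$, $n\ge1$, each with values in a countable discrete set (this is the Borel $\sigma$-field of the metric $d(\mathbf{x}_{\cong},\mathbf{x}'_{\cong})=1/(1+\sup\{n\ge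 1:\mathbf{R}_n\mathbf{x}_{\cong}=\mathbf{R}_n\mathbf{x}'_{\cong}\})$, with $1/\infty=0$). Laws of random elements of $\mathcal{R}_{\mathbb{N}}^{\cong}$ are regarded as laws on the space of equivalence classes of sequences $\mathbb{N}\to\mathrm{Fin}_\alpha$. **Relational exchangeability.** For a permutation (bijection) $\sigma:\mathbb{N}\to\mathbb{N}$, $\mathbf{x}_{\cong}^\sigma:=(\mathbf{x}\circ\sigma)_{\cong}$, which does not depend on the representative. A random structure $\mathbf{X}_{\cong}\in\mathcal{R}_{\mathbb{N}}^{\cong}$ is relationally exchangeable if $\mathbf{X}_{\cong}^\sigma$ and $\mathbf{X}_{\cong}$ are equal in distribution for all permutations $\sigma:\mathbb{N}\to\mathbb{N}$. **The set $\mathcal{R}^\star$.** Let $\mathcal{R}_{[0,1]}$ be the set of all $\alpha$-structures $T\mathcal{A}$ with $\mathcal{A}\in\mathcal{R}$ and $T=(T_i)_{i\in\mathbb{Z}}\in[0,1]^{\mathbb{Z}}$, where $T\mathcal{A}$ is $t(\mathcal{A})$ for $t(i)=T_i$. Given an at most countable ordered set $\mathcal{U}=(u_j)_{j\ge1}$ of distinct elements of $[0,1]$ and $\mathcal{A}\in\mathcal{R}_{[0,1]}$, let $\mathcal{A}^\star$ be obtained from $\mathcal{A}$ by replacing each $u_j\in\mathcal{U}$ by $j$, and, if $v_1<\cdots<v_k$ are the elements of $\operatorname{dom}\mathcal{A}$ not in $\mathcal{U}$, replacing $v_k,v_{k-1},\ldots,v_1$ by $0,-1,\ldots,-(k-1)$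 respectively. $\mathcal{R}^\star$ is the set of all structures $\mathcal{A}^\star$ obtainable in this way (over all $\mathcal{U}$ and all $\mathcal{A}\in\mathcal{R}_{[0,1]}$). Equivalently, $\mathcal{R}^\star$ is the set of all $t(\mathcal{A})$ with $\mathcal{A}\in\mathcal{R}$ and $t:\operatorname{dom}\mathcal{A}\to\mathbb{Z}$ any function such that the set of non-positive elements of its image is either empty or of the form $\{0,-1,\ldots,-k\}$ for some $k\ge0$. It is at most countable. **The $\mathcal{R}$-simplex.** $\mathcal{F}_{\mathcal{R}}:=\{(f_{\mathcal{B}})_{\mathcal{B}\in\mathcal{R}^\star}: f_{\mathcal{B}}\ge0,\ \sum_{\mathcal{B}\in\mathcal{R}^\star}f_{\mathcal{B}}=1\}$, with metric $\sum_{\mathcal{B}\in\mathcal{R}^\star}|f_{\mathcal{B}}-f'_{\mathcal{B}}|$ and its Borel $\sigma$-field. **The measures $\varepsilon_f$.** For $f\in\mathcal{F}_{\mathcal{R}}$, let $X_1,X_2,\ldots$ be i.i.d. with $\mathbb{P}(X_i=\mathcal{B})=f_{\mathcal{B}}$ for $\mathcal{B}\in\mathcal{R}^\star$. Define $\mathbf{X}^\dagger=(X_1^\dagger,X_2^\dagger,\ldots)$ recursively: put $m_0=0$; for $n\ge1$, given $m_{n-1}$: (i) if $\operatorname{dom}X_n$ has no non-positive elements, put $m_n=m_{n-1}$ and $X_n^\dagger=X_n$; (ii) if the non-positive elements of $\operatorname{dom}X_n$ are $0,-1,\ldots,-k$ with $k\ge0$, obtain $X_n^\dagger$ from $X_n$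 by replacing each occurrence of $-i$, $0\le i\le k$, by $m_{n-1}-i$, keeping positive elements unchanged, and put $m_n=m_{n-1}-k-1$. Then $\varepsilon_f$ is the distribution of the class $\mathbf{X}^\dagger_{\cong}$. *)

theory Defs
  imports "HOL-Probability.Probability"
begin

section \<open>Structures\<close>

text \<open>
  Index sets that start at 1 in the mathematical text start at 0 here: the relations of a
  structure are numbered 0, 1, 2, \<dots>, a sequence has the entries 0, 1, 2, \<dots>, and the
  index set of its first \<open>n\<close> entries is \<open>{..<n}\<close>. The positive integers that serve as domain
  elements of structures are not shifted.
\<close>

definition signature :: "(nat \<Rightarrow> nat) \<Rightarrow> bool" where
  "signature \<alpha> \<longleftrightarrow> (\<forall>j k. \<alpha> j = 0 \<longrightarrow> j \<le> k \<longrightarrow> \<alpha> k = 0)"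

datatype 'a rstruct = RStruct (domain: "'a set") (rel: "nat \<Rightarrow> 'a list set")

text \<open>The convention is that the power with exponent 0 is empty; it does not contain the empty tuple.\<close>

definition tuples :: "'a set \<Rightarrow> nat \<Rightarrow> 'a list set" where
  "tuples A n = (if n = 0 then {} else {xs. length xs = n \<and> set xs \<subseteq> A})"

definition is_structure :: "(nat \<Rightarrow> nat) \<Rightarrow> 'a rstruct \<Rightarrow> bool" where
  "is_structure \<alpha> A \<longleftrightarrow> (\<forall>j. rel A j \<subseteq> tuples (domain A) (\<alpha> j))"

text \<open>The last condition says that the cardinalities of the relations have a finite sum.\<close>

definition Fin :: "(nat \<Rightarrow> nat) \<Rightarrow> int rstruct set" where
  "Fin \<alpha> = {A. is_structure \<alpha> A \<and> finite (domain A) \<and> finite (SIGMA j:UNIV. rel A j)}"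

definition map_struct :: "('a \<Rightarrow> 'b) \<Rightarrow> 'a rstruct \<Rightarrow> 'b rstruct" where
  "map_struct t A = RStruct (t ` domain A) (\<lambda>j. map t ` rel A j)"


section \<open>Relationally labeled structures\<close>

definition seq_equiv ::
  "(nat \<Rightarrow> nat) \<Rightarrow> nat set \<Rightarrow> ((nat \<Rightarrow> int rstruct) \<times> (nat \<Rightarrow> int rstruct)) set" where
  "seq_equiv \<alpha> I = {(x, x'). x \<in> I \<rightarrow>\<^sub>E Fin \<alpha> \<and> x' \<in> I \<rightarrow>\<^sub>E Fin \<alpha> \<and>
     (\<exists>\<rho>. bij_betw \<rho> (\<Union>i\<in>I. domain (x' i)) (\<Union>i\<in>I. domain (x i)) \<and>
          (\<forall>i\<in>I. map_struct \<rho> (x' i) = x i))}"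

definition seq_class :: "(nat \<Rightarrow> nat) \<Rightarrow> nat set \<Rightarrow> (nat \<Rightarrow> int rstruct) \<Rightarrow> (nat \<Rightarrow> int rstruct) set" where
  "seq_class \<alpha> I x = seq_equiv \<alpha> I `` {x}"

definition seq_classes :: "(nat \<Rightarrow> nat) \<Rightarrow> nat set \<Rightarrow> (nat \<Rightarrow> int rstruct) set set" where
  "seq_classes \<alpha> I = (I \<rightarrow>\<^sub>E Fin \<alpha>) // seq_equiv \<alpha> I"

definition labeled_structures ::
  "(nat \<Rightarrow> nat) \<Rightarrow> int rstruct set \<Rightarrow> (nat \<Rightarrow> int rstruct) set set" where
  "labeled_structures \<alpha> R = seq_class \<alpha> UNIV ` {x. range x \<subseteq> R}"

text \<open>
  The next two operations on classes take the union over all representatives; the lemmas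
  \<open>restr_seq_class\<close> and \<open>permute_seq_class\<close> below show that any single one gives the same class.
\<close>

definition restr :: "(nat \<Rightarrow> nat) \<Rightarrow> nat \<Rightarrow> (nat \<Rightarrow> int rstruct) set \<Rightarrow> (nat \<Rightarrow> int rstruct) set" where
  "restr \<alpha> n c = (\<Union>x\<in>c. seq_class \<alpha> {..<n} (restrict x {..<n}))"

definition permute ::
  "(nat \<Rightarrow> nat) \<Rightarrow> (nat \<Rightarrow> nat) \<Rightarrow> (nat \<Rightarrow> int rstruct) set \<Rightarrow> (nat \<Rightarrow> int rstruct) set" where
  "permute \<alpha> \<sigma> c = (\<Union>x\<in>c. seq_class \<alpha> UNIV (x \<circ> \<sigma>))"

definition class_space :: "(nat \<Rightarrow> nat) \<Rightarrow> (nat \<Rightarrow> int rstruct) set measure" where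
  "class_space \<alpha> = sigma (seq_classes \<alpha> UNIV)
     {restr \<alpha> n -` B \<inter> seq_classes \<alpha> UNIV | n B. 1 \<le> n \<and> B \<subseteq> seq_classes \<alpha> {..<n}}"

definition relationally_exchangeable ::
  "(nat \<Rightarrow> nat) \<Rightarrow> 'w measure \<Rightarrow> ('w \<Rightarrow> (nat \<Rightarrow> int rstruct) set) \<Rightarrow> bool" where
  "relationally_exchangeable \<alpha> M X \<longleftrightarrow>
     (\<forall>\<sigma>. bij \<sigma> \<longrightarrow>
        distr M (class_space \<alpha>) (\<lambda>\<omega>. permute \<alpha> \<sigma> (X \<omega>)) = distr M (class_space \<alpha>) X)"


section \<open>The set \<open>R_star\<close>\<close>

definition R_unit :: "int rstruct set \<Rightarrow> real rstruct set" where
  "R_unit R = {map_struct T A | A T. A \<in> R \<and> range T \<subseteq> {0..1}}"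

text \<open>
  At most countable ordered sets of distinct elements of the unit interval, with the elements
  numbered from 1 since these numbers become domain elements of structures. The empty set is
  the case \<open>N = 0\<close>.
\<close>

definition ordered_points :: "nat set \<Rightarrow> (nat \<Rightarrow> real) \<Rightarrow> bool" where
  "ordered_points J u \<longleftrightarrow>
     (J = {1..} \<or> (\<exists>N. J = {1..N})) \<and> inj_on u J \<and> u ` J \<subseteq> {0..1}"

text \<open>
  Among the \<open>k\<close> elements of \<open>D\<close> outside the ordered set, the largest goes to \<open>0\<close>, the second
  largest to \<open>-1\<close>, and so on: each goes to minus the number of those greater than it.
\<close>

definition star_label :: "nat set \<Rightarrow> (nat \<Rightarrow> real) \<Rightarrow> real set \<Rightarrow> real \<Rightarrow> int" where
  "star_label J u D v =
     (if v \<in> u ` J then int (inv_into J u v) else - int (card {w \<in> D - u ` J. v < w}))"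

definition star :: "nat set \<Rightarrow> (nat \<Rightarrow> real) \<Rightarrow> real rstruct \<Rightarrow> int rstruct" where
  "star J u A = map_struct (star_label J u (domain A)) A"

definition R_star :: "int rstruct set \<Rightarrow> int rstruct set" where
  "R_star R = {star J u A | J u A. ordered_points J u \<and> A \<in> R_unit R}"


section \<open>The simplex and the measures \<open>eps\<close>\<close>

definition R_simplex :: "int rstruct set \<Rightarrow> (int rstruct \<Rightarrow> real) set" where
  "R_simplex R = {f \<in> extensional (R_star R). (\<forall>B\<in>R_star R. 0 \<le> f B) \<and> (f has_sum 1) (R_star R)}"

definition simplex_dist ::
  "int rstruct set \<Rightarrow> (int rstruct \<Rightarrow> real) \<Rightarrow> (int rstruct \<Rightarrow> real) \<Rightarrow> real" where
  "simplex_dist R f g = (\<Sum>\<^sub>\<infinity>B\<in>R_star R. \<bar>f B - g B\<bar>)"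

definition simplex_space :: "int rstruct set \<Rightarrow> (int rstruct \<Rightarrow> real) measure" where
  "simplex_space R =
     sigma (R_simplex R) {U. openin (Metric_space.mtopology (R_simplex R) (simplex_dist R)) U}"

text \<open>
  The set of non-positive domain elements is either empty or \<open>{-k..0}\<close>, so its cardinality,
  \<open>0\<close> or \<open>k + 1\<close>, is what has to be subtracted. With entries numbered from 0,
  entry \<open>n\<close> is relabeled using \<open>m n\<close>.
\<close>

fun dagger_offset :: "(nat \<Rightarrow> int rstruct) \<Rightarrow> nat \<Rightarrow> int" where
  "dagger_offset x 0 = 0"
| "dagger_offset x (Suc n) = dagger_offset x n - int (card {a \<in> domain (x n). a \<le> 0})"

definition dagger :: "(nat \<Rightarrow> int rstruct) \<Rightarrow> nat \<Rightarrow> int rstruct" where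
  "dagger x n = map_struct (\<lambda>a. if 0 < a then a else dagger_offset x n + a) (x n)"

definition eps ::
  "(nat \<Rightarrow> nat) \<Rightarrow> int rstruct set \<Rightarrow> (int rstruct \<Rightarrow> real) \<Rightarrow> (nat \<Rightarrow> int rstruct) set measure" where
  "eps \<alpha> R f =
     distr (\<Pi>\<^sub>M i\<in>(UNIV :: nat set). point_measure (R_star R) (\<lambda>B. ennreal (f B)))
       (class_space \<alpha>) (\<lambda>x. seq_class \<alpha> UNIV (dagger x))"


section \<open>Well-definedness\<close>

lemma map_struct_comp: "map_struct g (map_struct f A) = map_struct (g \<circ> f) A"
  by (simp add: map_struct_def image_comp comp_def)

lemma domain_map_struct [simp]: "domain (map_struct f A) = f ` domain A"
  by (simp add: map_struct_def)

lemma map_struct_cong: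
  assumes "is_structure \<alpha> A" "\<And>a. a \<in> domain A \<Longrightarrow> f a = g a"
  shows "map_struct f A = map_struct g A"
proof -
  have "map f xs = map g xs" if "xs \<in> rel A j" for xs j
    using assms that unfolding is_structure_def tuples_def
    by (fastforce split: if_splits)
  then have "map f ` rel A j = map g ` rel A j" for j
    by (meson image_cong)
  then show ?thesis
    using assms(2) by (auto simp: map_struct_def)
qed

lemma map_struct_id: "map_struct (\<lambda>x. x) A = A"
  by (cases A) (simp add: map_struct_def)

lemma map_struct_Fin:
  assumes "A \<in> Fin \<alpha>" shows "map_struct (t :: int \<Rightarrow> int) A \<in> Fin \<alpha>"
proof -
  have "(SIGMA j:UNIV. rel (map_struct t A) j) = (\<lambda>(j, xs). (j, map t xs)) ` (SIGMA j:UNIV. rel A j)"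
    by (auto simp: map_struct_def image_iff)
  moreover have "is_structure \<alpha> (map_struct t A)"
    using assms unfolding Fin_def is_structure_def tuples_def map_struct_def
    by (fastforce split: if_splits)
  ultimately show ?thesis
    using assms by (simp add: Fin_def)
qed

lemma equiv_seq_equiv: "equiv (I \<rightarrow>\<^sub>E Fin \<alpha>) (seq_equiv \<alpha> I)"
proof (rule equivI)
  show "seq_equiv \<alpha> I \<subseteq> (I \<rightarrow>\<^sub>E Fin \<alpha>) \<times> (I \<rightarrow>\<^sub>E Fin \<alpha>)"
    by (auto simp: seq_equiv_def)
  show "refl_on (I \<rightarrow>\<^sub>E Fin \<alpha>) (seq_equiv \<alpha> I)"
  proof (rule refl_onI)
    fix x assume "x \<in> I \<rightarrow>\<^sub>E Fin \<alpha>"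
    then show "(x, x) \<in> seq_equiv \<alpha> I"
      unfolding seq_equiv_def
      by (auto intro!: exI[of _ "\<lambda>x. x"] simp: map_struct_id bij_betw_def)
  qed
  show "sym (seq_equiv \<alpha> I)"
  proof (rule symI)
    fix x y assume xy: "(x, y) \<in> seq_equiv \<alpha> I"
    then obtain \<rho> where bij: "bij_betw \<rho> (\<Union>i\<in>I. domain (y i)) (\<Union>i\<in>I. domain (x i))"
      and \<rho>: "\<And>i. i \<in> I \<Longrightarrow> map_struct \<rho> (y i) = x i"
      by (auto simp: seq_equiv_def)
    let ?\<tau> = "inv_into (\<Union>i\<in>I. domain (y i)) \<rho>"
    have "map_struct ?\<tau> (x i) = y i" if "i \<in> I" for i
    proof -
      have "map_struct ?\<tau> (x i) = map_struct (?\<tau> \<circ> \<rho>) (y i)"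
        using \<rho>[OF that] by (metis map_struct_comp)
      also have "\<dots> = map_struct (\<lambda>a. a) (y i)"
      proof (rule map_struct_cong)
        show "is_structure \<alpha> (y i)"
          using xy that by (auto simp: seq_equiv_def Fin_def PiE_iff)
        show "(?\<tau> \<circ> \<rho>) a = a" if "a \<in> domain (y i)" for a
        proof -
          have "a \<in> (\<Union>i\<in>I. domain (y i))" using that \<open>i \<in> I\<close> by blast
          then show ?thesis using bij by (simp add: bij_betw_inv_into_left)
        qed
      qed
      finally show ?thesis by (simp add: map_struct_id)
    qed
    then show "(y, x) \<in> seq_equiv \<alpha> I"
      using xy bij_betw_inv_into[OF bij] unfolding seq_equiv_def by blast
  qed
  show "trans (seq_equiv \<alpha> I)"
  proof (rule transI)
    fix x y z assume xy: "(x, y) \<in> seq_equiv \<alpha> I" and yz: "(y, z) \<in> seq_equiv \<alpha> I"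
    obtain \<rho> where \<rho>: "bij_betw \<rho> (\<Union>i\<in>I. domain (y i)) (\<Union>i\<in>I. domain (x i))"
      "\<And>i. i \<in> I \<Longrightarrow> map_struct \<rho> (y i) = x i"
      using xy by (auto simp: seq_equiv_def)
    obtain \<tau> where \<tau>: "bij_betw \<tau> (\<Union>i\<in>I. domain (z i)) (\<Union>i\<in>I. domain (y i))"
      "\<And>i. i \<in> I \<Longrightarrow> map_struct \<tau> (z i) = y i"
      using yz by (auto simp: seq_equiv_def)
    have "bij_betw (\<rho> \<circ> \<tau>) (\<Union>i\<in>I. domain (z i)) (\<Union>i\<in>I. domain (x i))"
      using bij_betw_trans[OF \<tau>(1) \<rho>(1)] .
    moreover have "map_struct (\<rho> \<circ> \<tau>) (z i) = x i" if "i \<in> I" for i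
      using \<rho>(2)[OF that] \<tau>(2)[OF that] by (metis map_struct_comp)
    ultimately show "(x, z) \<in> seq_equiv \<alpha> I"
      using xy yz unfolding seq_equiv_def by blast
  qed
qed

lemma seq_class_eqI: "(x, y) \<in> seq_equiv \<alpha> I \<Longrightarrow> seq_class \<alpha> I x = seq_class \<alpha> I y"
  unfolding seq_class_def by (rule equiv_class_eq[OF equiv_seq_equiv])

lemma restr_seq_class:
  assumes "x \<in> UNIV \<rightarrow>\<^sub>E Fin \<alpha>"
  shows "restr \<alpha> n (seq_class \<alpha> UNIV x) = seq_class \<alpha> {..<n} (restrict x {..<n})"
proof -
  have "seq_class \<alpha> {..<n} (restrict y {..<n}) = seq_class \<alpha> {..<n} (restrict x {..<n})"
    if "y \<in> seq_class \<alpha> UNIV x" for y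
  proof -
    have xy: "(x, y) \<in> seq_equiv \<alpha> UNIV"
      using that by (simp add: seq_class_def)
    then obtain \<rho> where \<rho>: "bij_betw \<rho> (\<Union>i. domain (y i)) (\<Union>i. domain (x i))"
      "\<And>i. map_struct \<rho> (y i) = x i"
      by (auto simp: seq_equiv_def)
    have dom: "domain (x i) = \<rho> ` domain (y i)" for i
      using \<rho>(2)[of i] by (metis domain_map_struct)
    have "inj_on \<rho> (\<Union>i<n. domain (y i))"
      using \<rho>(1) by (auto simp: bij_betw_def intro: inj_on_subset)
    then have "bij_betw \<rho> (\<Union>i<n. domain (y i)) (\<Union>i<n. domain (x i))"
      by (auto simp: bij_betw_def dom)
    moreover have "x i \<in> Fin \<alpha>" "y i \<in> Fin \<alpha>" for i
      using xy by (auto simp: seq_equiv_def PiE_iff)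
    ultimately have "(restrict x {..<n}, restrict y {..<n}) \<in> seq_equiv \<alpha> {..<n}"
      using \<rho>(2) by (auto simp: seq_equiv_def)
    then show ?thesis by (simp add: seq_class_eqI)
  qed
  moreover have "x \<in> seq_class \<alpha> UNIV x"
    using assms equiv_class_self[OF equiv_seq_equiv] by (simp add: seq_class_def)
  ultimately show ?thesis
    unfolding restr_def by blast
qed

lemma permute_seq_class:
  assumes "x \<in> UNIV \<rightarrow>\<^sub>E Fin \<alpha>" "bij \<sigma>"
  shows "permute \<alpha> \<sigma> (seq_class \<alpha> UNIV x) = seq_class \<alpha> UNIV (x \<circ> \<sigma>)"
proof -
  have "seq_class \<alpha> UNIV (y \<circ> \<sigma>) = seq_class \<alpha> UNIV (x \<circ> \<sigma>)"
    if "y \<in> seq_class \<alpha> UNIV x" for y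
  proof -
    have xy: "(x, y) \<in> seq_equiv \<alpha> UNIV"
      using that by (simp add: seq_class_def)
    then obtain \<rho> where \<rho>: "bij_betw \<rho> (\<Union>i. domain (y i)) (\<Union>i. domain (x i))"
      "\<And>i. map_struct \<rho> (y i) = x i"
      by (auto simp: seq_equiv_def)
    have un: "(\<Union>i. domain (z (\<sigma> i))) = (\<Union>i. domain (z i))" for z :: "nat \<Rightarrow> int rstruct"
    proof -
      have "(\<Union>i. domain (z (\<sigma> i))) = (\<Union>i\<in>range \<sigma>. domain (z i))" by blast
      then show ?thesis using bij_is_surj[OF assms(2)] by simp
    qed
    have "(x \<circ> \<sigma>, y \<circ> \<sigma>) \<in> seq_equiv \<alpha> UNIV"
      using xy \<rho> by (auto simp: seq_equiv_def PiE_iff un)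
    then show ?thesis by (simp add: seq_class_eqI)
  qed
  moreover have "x \<in> seq_class \<alpha> UNIV x"
    using assms equiv_class_self[OF equiv_seq_equiv] by (simp add: seq_class_def)
  ultimately show ?thesis
    unfolding permute_def by blast
qed

lemma image_count_greater:
  fixes V :: "real set"
  assumes "finite V"
  shows "(\<lambda>v. card {w \<in> V. v < w}) ` V = {..<card V}"
proof (rule card_subset_eq)
  let ?c = "\<lambda>v. card {w \<in> V. v < w}"
  have less: "?c w < ?c v" if "v \<in> V" "w \<in> V" "v < w" for v w
    using that assms by (intro psubset_card_mono) auto
  have "inj_on ?c V"
  proof (rule inj_onI)
    fix v w assume vw: "v \<in> V" "w \<in> V" and eq: "?c v = ?c w"
    show "v = w"
      using less[of v w] less[of w v] vw eq by (cases v w rule: linorder_cases) simp_all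
  qed
  then show "card (?c ` V) = card {..<card V}"
    by (simp add: card_image)
  have "?c v < card V" if "v \<in> V" for v
    using that assms by (intro psubset_card_mono) auto
  then show "?c ` V \<subseteq> {..<card V}"
    by auto
qed simp

text \<open>The description of \<open>R_star\<close> without a detour through the unit interval.\<close>

lemma R_star_eq:
  assumes R: "R \<subseteq> Fin \<alpha>"
  shows "R_star R = {map_struct t A | t A. A \<in> R \<and>
     ({b \<in> t ` domain A. b \<le> 0} = {} \<or> (\<exists>k::nat. {b \<in> t ` domain A. b \<le> 0} = {- int k..0}))}"
    (is "_ = ?S")
proof (intro equalityI subsetI)
  fix B assume "B \<in> R_star R"
  then obtain J u A T where J: "ordered_points J u" and A: "A \<in> R" "range T \<subseteq> {0..1}"
    and B: "B = star J u (map_struct T A)"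
    by (auto simp: R_star_def R_unit_def)
  define D where "D = T ` domain A"
  define V where "V = D - u ` J"
  define t where "t = star_label J u D \<circ> T"
  have B': "B = map_struct t A"
    by (simp add: B star_def t_def D_def map_struct_comp)
  have "finite (domain A)" using A R by (auto simp: Fin_def)
  then have V: "finite V" by (simp add: V_def D_def)
  have pos: "star_label J u D v > 0" if "v \<in> u ` J" for v
  proof -
    have "inv_into J u v \<in> J" using that by (rule inv_into_into)
    then have "inv_into J u v \<ge> 1" using J by (auto simp: ordered_points_def)
    then show ?thesis using that by (simp add: star_label_def)
  qed
  have neg: "star_label J u D v = - int (card {w \<in> V. v < w})" if "v \<notin> u ` J" for v
    using that by (simp add: star_label_def V_def)
  have "{b \<in> t ` domain A. b \<le> 0} = star_label J u D ` V"
  proof -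
    have "star_label J u D v \<le> 0 \<longleftrightarrow> v \<notin> u ` J" for v
      using pos[of v] neg[of v] by (cases "v \<in> u ` J") auto
    then have "{b \<in> star_label J u D ` D. b \<le> 0} = star_label J u D ` V"
      unfolding V_def by blast
    then show ?thesis
      by (simp add: t_def D_def image_comp)
  qed
  also have "\<dots> = (\<lambda>n. - int n) ` (\<lambda>v. card {w \<in> V. v < w}) ` V"
    unfolding image_image by (rule image_cong) (auto simp: neg V_def)
  also have "\<dots> = (\<lambda>n. - int n) ` {..<card V}"
    by (simp add: image_count_greater[OF V])
  finally have N: "{b \<in> t ` domain A. b \<le> 0} = (\<lambda>n. - int n) ` {..<card V}" .
  have "(\<lambda>n. - int n) ` {..<Suc k} = {- int k..0}" for k
  proof (intro equalityI subsetI)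
    fix z assume "z \<in> {- int k..0}"
    then have "z = - int (nat (- z))" "nat (- z) \<in> {..<Suc k}" by auto
    then show "z \<in> (\<lambda>n. - int n) ` {..<Suc k}" by (rule image_eqI)
  qed auto
  then have "{b \<in> t ` domain A. b \<le> 0} = {} \<or> (\<exists>k::nat. {b \<in> t ` domain A. b \<le> 0} = {- int k..0})"
    unfolding N by (cases "card V") auto
  then show "B \<in> ?S" using A B' by blast
next
  fix B assume "B \<in> ?S"
  then obtain t A where B: "B = map_struct t A" and A: "A \<in> R"
    and N: "{b \<in> t ` domain A. b \<le> 0} = {} \<or> (\<exists>k::nat. {b \<in> t ` domain A. b \<le> 0} = {- int k..0})"
    by blast
  define u :: "nat \<Rightarrow> real" where "u j = 1 / (2 + real j)" for j
  define g :: "int \<Rightarrow> real" where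
    "g z = (if z > 0 then u (nat z) else 1 / 2 + 1 / (2 + real_of_int (- z)))" for z
  define T where "T = g \<circ> t"
  define D where "D = T ` domain A"
  let ?J = "{1::nat..}"
  have u_range: "0 < u j" "u j \<le> 1 / 2" for j
    by (auto simp: u_def field_simps)
  have inj: "inj_on u ?J"
    by (auto simp: inj_on_def u_def)
  have J: "ordered_points ?J u"
  proof -
    have "u j \<in> {0..1}" for j using u_range[of j] by simp
    then show ?thesis using inj by (auto simp: ordered_points_def simp del: atLeastAtMost_iff)
  qed
  have g_nonpos: "1 / 2 < g z" "g z \<le> 1" if "z \<le> 0" for z
    using that by (auto simp: g_def field_simps)
  have g_notin: "g z \<notin> u ` ?J" if "z \<le> 0" for z
    using g_nonpos(1)[OF that] u_range(2) by (auto simp: not_le[symmetric])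
  have g_in: "g z \<in> u ` ?J" if "0 < z" for z
    using that by (auto simp: g_def)
  have g_mono: "g z < g z'" if "z < z'" "z' \<le> 0" for z z'
    using that by (auto simp: g_def field_simps)
  have g01: "g z \<in> {0..1}" for z
    using u_range[of "nat z"] g_nonpos[of z] by (cases "z > 0") (auto simp: g_def)
  have label: "star_label ?J u D (T i) = t i" if i: "i \<in> domain A" for i
  proof (cases "t i > 0")
    case True
    then have "T i = u (nat (t i))" by (simp add: T_def g_def)
    moreover have "nat (t i) \<in> ?J" using True by simp
    ultimately show ?thesis
      using True inj by (simp add: star_label_def inv_into_f_f)
  next
    case False
    then have nonpos: "t i \<le> 0" by simp
    have "{w \<in> D - u ` ?J. T i < w} = g ` {t i<..0}"
    proof (intro equalityI subsetI)
      fix w assume "w \<in> {w \<in> D - u ` ?J. T i < w}"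
      then obtain a where a: "a \<in> domain A" "w = g (t a)" "g (t i) < g (t a)" "g (t a) \<notin> u ` ?J"
        by (auto simp: D_def T_def)
      have "t a \<le> 0" using a(4) g_in[of "t a"] not_le by blast
      moreover have "t i < t a"
        using a(3) g_mono[of "t a" "t i"] nonpos by (cases "t a" "t i" rule: linorder_cases) auto
      ultimately show "w \<in> g ` {t i<..0}" using a by auto
    next
      fix w assume "w \<in> g ` {t i<..0}"
      then obtain z where z: "t i < z" "z \<le> 0" "w = g z" by auto
      have "t i \<in> {b \<in> t ` domain A. b \<le> 0}" using i nonpos by auto
      then obtain k :: nat where k: "{b \<in> t ` domain A. b \<le> 0} = {- int k..0}"
        using N by blast
      have "z \<in> {- int k..0}"
        using z k \<open>t i \<in> {b \<in> t ` domain A. b \<le> 0}\<close> by auto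
      then have "z \<in> t ` domain A" using k by blast
      then show "w \<in> {w \<in> D - u ` ?J. T i < w}"
        using z g_notin g_mono by (auto simp: D_def T_def)
    qed
    moreover have "inj_on g {t i<..0}"
      by (rule inj_onI) (metis g_mono greaterThanAtMost_iff less_irrefl linorder_less_linear)
    moreover have "T i \<notin> u ` ?J" using g_notin[OF nonpos] by (simp add: T_def)
    ultimately show ?thesis
      using nonpos by (simp add: star_label_def card_image)
  qed
  have "is_structure \<alpha> A" using A R by (auto simp: Fin_def)
  then have "star ?J u (map_struct T A) = B"
    unfolding star_def map_struct_comp B
    by (rule map_struct_cong) (use label in \<open>simp add: D_def\<close>)
  moreover have "map_struct T A \<in> R_unit R"
  proof -
    have "range T \<subseteq> {0..1}" unfolding T_def using g01 by (metis comp_apply image_subsetI)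
    then show ?thesis using A unfolding R_unit_def by blast
  qed
  ultimately show "B \<in> R_star R"
    using J unfolding R_star_def by blast
qed

lemma simplex_summable:
  assumes "f \<in> R_simplex R" "g \<in> R_simplex R"
  shows "(\<lambda>B. \<bar>f B - g B\<bar>) summable_on R_star R"
proof (rule summable_on_comparison_test)
  show "(\<lambda>B. f B + g B) summable_on R_star R"
    using assms by (intro summable_on_add) (auto simp: R_simplex_def intro: has_sum_imp_summable)
  fix B assume "B \<in> R_star R"
  then have "0 \<le> f B" "0 \<le> g B"
    using assms by (auto simp: R_simplex_def)
  then show "\<bar>f B - g B\<bar> \<le> f B + g B"
    by linarith
qed simp

lemma Metric_space_simplex: "Metric_space (R_simplex R) (simplex_dist R)"
proof
  fix f g h
  show "0 \<le> simplex_dist R f g"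
    unfolding simplex_dist_def by (rule infsum_nonneg) simp
  show "simplex_dist R f g = simplex_dist R g f"
    by (simp add: simplex_dist_def abs_minus_commute)
  assume f: "f \<in> R_simplex R" and g: "g \<in> R_simplex R"
  show "simplex_dist R f g = 0 \<longleftrightarrow> f = g"
  proof
    assume 0: "simplex_dist R f g = 0"
    have "\<bar>f B - g B\<bar> = 0" if "B \<in> R_star R" for B
    proof (rule nonneg_infsum_le_0D[where A = "R_star R"])
      show "(\<Sum>\<^sub>\<infinity>B\<in>R_star R. \<bar>f B - g B\<bar>) \<le> 0"
        using 0 by (simp add: simplex_dist_def)
    qed (use that f g in \<open>auto intro!: simplex_summable\<close>)
    then show "f = g"
      using f g by (auto simp: R_simplex_def intro: extensionalityI)
  qed (simp add: simplex_dist_def)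
  assume h: "h \<in> R_simplex R"
  have "simplex_dist R f h \<le> (\<Sum>\<^sub>\<infinity>B\<in>R_star R. \<bar>f B - g B\<bar> + \<bar>g B - h B\<bar>)"
    unfolding simplex_dist_def
    by (rule infsum_mono) (use f g h in \<open>auto intro!: simplex_summable summable_on_add\<close>)
  also have "\<dots> = simplex_dist R f g + simplex_dist R g h"
    unfolding simplex_dist_def by (rule infsum_add) (use f g h in \<open>auto intro!: simplex_summable\<close>)
  finally show "simplex_dist R f h \<le> simplex_dist R f g + simplex_dist R g h" .
qed

end

theory Submission
  imports Defs
begin

text \<open>
  The entries of the random sequence share labels, and only the pattern of sharing matters. The
  even-numbered entries serve as a reference that gives permanent names to labels; the
  odd-numbered entries, written in terms of these names, form an exchangeable sequence over the
  countable set \<open>R_star R\<close>, to which de Finetti's theorem applies.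

  In detail, let \<open>x\<close> represent the random class. A label that occurs in some even entry receives as
  name a positive integer determined by the first even entry that contains it and by its rank
  there. The labels of an odd entry that occur in no even entry become \<open>0, -1, -2, \<dots>\<close>. Ranks
  cannot be taken from the labels themselves, since the representative \<open>x\<close> is arbitrary, and a
  sequence may have automorphisms, so that no rule distinguishes all labels. They are therefore
  taken from independent uniform real numbers \<open>T a\<close> attached to the labels \<open>a\<close>. The law of the
  resulting sequence \<open>y\<close> over \<open>R_star R\<close>, given the class, does not depend on the representative
  (\<open>class_invariant_coding_law\<close>), and it is a measurable function of the class, because names built
  from the first \<open>m\<close> even entries only are eventually correct (\<open>measurable_coding_law\<close>). A
  permutation of the odd entries fixes the even ones, hence the names, so relational
  exchangeability makes the law of \<open>y\<close> exchangeable (\<open>exchangeable_coding_mixture\<close>).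

  By exchangeability, almost surely a label shared by two odd entries also occurs in an even entry:
  the event that some label of entry \<open>0\<close> occurs next in entry \<open>m + 1\<close> happens for finitely many \<open>m\<close>
  only, so its probability tends to \<open>0\<close>, and this probability equals that of two given odd entries
  sharing a label that the first \<open>m\<close> even entries lack (\<open>AE_odd_labels_private\<close>). Consequently
  the map \<open>dagger\<close>, which makes the non-positive elements of different entries distinct, turns \<open>y\<close>
  into a relabeling of the sequence of odd entries (\<open>dagger_rel_entry_relabels\<close>). The class of that
  sequence has the law of the original class, because the law is invariant under every injective
  reindexing (\<open>distr_reindex\<close>).

  De Finetti's theorem for a countable state space is obtained from relative frequencies. Along the
  powers of \<open>4\<close> they converge almost surely, as their increments are summable in the mean
  (\<open>AE_convergent_freq\<close>), and in the probability of a cylinder the indicators of the entries can be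
  replaced one at a time by the limiting frequencies (\<open>integral_mixed_product\<close>). The random vector
  of limiting frequencies takes its values in the simplex almost surely, and its law is the mixing
  measure. It is a measure on the Borel sets of the simplex because there the topology of the
  summable distance is that of coordinatewise convergence (\<open>measurable_to_simplex_space\<close>).
\<close>


section \<open>Sequences over a countable set\<close>

text \<open>Sequences in \<open>S\<close> with the product of the discrete \<open>\<sigma>\<close>-fields.\<close>

definition seq_space :: "'a set \<Rightarrow> (nat \<Rightarrow> 'a) measure" where
  "seq_space S = (\<Pi>\<^sub>M i\<in>(UNIV :: nat set). count_space S)"

text \<open>The cylinder of the sequences in \<open>S\<close> that begin with the list \<open>bs\<close>.\<close>

definition cyl :: "'a set \<Rightarrow> 'a list \<Rightarrow> (nat \<Rightarrow> 'a) set" where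
  "cyl S bs = {y. range y \<subseteq> S \<and> (\<forall>i<length bs. y i = bs ! i)}"

lemma space_seq_space: "space (seq_space S) = {y. range y \<subseteq> S}"
  by (auto simp: seq_space_def space_PiM PiE_iff)

lemma cyl_in_sets: "cyl S bs \<in> sets (seq_space S)"
proof -
  have "cyl S bs = {y \<in> space (seq_space S). \<forall>i\<in>{..<length bs}. y i \<in> {bs ! i} \<inter> S}"
    by (auto simp: cyl_def space_seq_space)
  also have "\<dots> \<in> sets (seq_space S)"
  proof (rule sets.sets_Collect_finite_All)
    fix i
    have "(\<lambda>y. y i) \<in> seq_space S \<rightarrow>\<^sub>M count_space S"
      unfolding seq_space_def by measurable
    then have "(\<lambda>y. y i) -` ({bs ! i} \<inter> S) \<inter> space (seq_space S) \<in> sets (seq_space S)"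
      by (rule measurable_sets) auto
    also have "(\<lambda>y. y i) -` ({bs ! i} \<inter> S) \<inter> space (seq_space S)
      = {y \<in> space (seq_space S). y i \<in> {bs ! i} \<inter> S}" by auto
    finally show "{y \<in> space (seq_space S). y i \<in> {bs ! i} \<inter> S} \<in> sets (seq_space S)" .
  qed auto
  finally show ?thesis .
qed

lemma prefix_event_eq_Union_cyl:
  "{y. range y \<subseteq> S \<and> P (map y [0..<n])} = (\<Union>bs\<in>{bs\<in>lists S. length bs = n \<and> P bs}. cyl S bs)"
proof (intro equalityI subsetI)
  fix y assume "y \<in> {y. range y \<subseteq> S \<and> P (map y [0..<n])}"
  then show "y \<in> (\<Union>bs\<in>{bs\<in>lists S. length bs = n \<and> P bs}. cyl S bs)"
    by (intro UN_I[of "map y [0..<n]"]) (auto simp: cyl_def image_subset_iff)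
next
  fix y assume "y \<in> (\<Union>bs\<in>{bs\<in>lists S. length bs = n \<and> P bs}. cyl S bs)"
  then obtain bs where bs: "P bs" "length bs = n" "y \<in> cyl S bs" by auto
  then have "map y [0..<n] = bs" by (intro nth_equalityI) (auto simp: cyl_def)
  then show "y \<in> {y. range y \<subseteq> S \<and> P (map y [0..<n])}" using bs by (auto simp: cyl_def)
qed

text \<open>
  For countable \<open>S\<close> the cylinders generate the \<open>\<sigma>\<close>-field. Any two of them are nested or disjoint, so
  together with the empty set they are closed under intersection.
\<close>

lemma sets_seq_space:
  assumes "countable S"
  shows "sets (seq_space S) = sigma_sets {y. range y \<subseteq> S} (insert {} (cyl S ` lists S))"
proof
  let ?\<Sigma> = "sigma_sets {y. range y \<subseteq> S} (insert {} (cyl S ` lists S))"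
  interpret sigma_algebra "{y. range y \<subseteq> S}" ?\<Sigma>
    by (rule sigma_algebra_sigma_sets) (auto simp: cyl_def)
  have "{f \<in> UNIV \<rightarrow>\<^sub>E S. f i \<in> A} \<in> ?\<Sigma>" if "A \<subseteq> S" for i A
  proof -
    have "{f \<in> UNIV \<rightarrow>\<^sub>E S. f i \<in> A} = {y. range y \<subseteq> S \<and> (\<lambda>bs. bs ! i \<in> A) (map y [0..<Suc i])}"
      by (auto simp: nth_append)
    also have "\<dots> \<in> ?\<Sigma>"
      unfolding prefix_event_eq_Union_cyl[where P = "\<lambda>bs. bs ! i \<in> A"]
      using assms by (intro countable_UN'') (auto intro!: sigma_sets.Basic intro: countable_subset[OF _ countable_lists])
    finally show ?thesis .
  qed
  then have "sigma_sets (UNIV \<rightarrow>\<^sub>E S) {{f \<in> UNIV \<rightarrow>\<^sub>E S. f i \<in> A} | i A. i \<in> UNIV \<and> A \<in> Pow S} \<subseteq> ?\<Sigma>"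
    using sigma_sets_subset[of "{{f \<in> UNIV \<rightarrow>\<^sub>E S. f i \<in> A} | i A. i \<in> UNIV \<and> A \<in> Pow S}"]
    by (auto simp: PiE_UNIV_domain Pi_def image_subset_iff)
  then show "sets (seq_space S) \<subseteq> ?\<Sigma>"
    unfolding seq_space_def sets_PiM_single space_count_space sets_count_space .
  have "insert {} (cyl S ` lists S) \<subseteq> sets (seq_space S)"
    using cyl_in_sets by auto
  then show "?\<Sigma> \<subseteq> sets (seq_space S)"
    using sets.sigma_sets_subset[of "insert {} (cyl S ` lists S)" "seq_space S"]
    by (simp add: space_seq_space)
qed

text \<open>Every condition on the first \<open>n\<close> entries is an event.\<close>

lemma prefix_event_in_sets:
  assumes "countable S"
  shows "{y. range y \<subseteq> S \<and> P (map y [0..<n])} \<in> sets (seq_space S)"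
  unfolding prefix_event_eq_Union_cyl
  using assms by (intro sets.countable_UN'') (auto intro: cyl_in_sets countable_subset[OF _ countable_lists])

lemma Int_stable_cyl: "Int_stable (insert {} (cyl S ` lists S))"
proof (rule Int_stableI)
  fix A B assume A: "A \<in> insert {} (cyl S ` lists S)" and B: "B \<in> insert {} (cyl S ` lists S)"
  have "cyl S as \<inter> cyl S bs \<in> {{}, cyl S as, cyl S bs}" for as bs
  proof (cases "\<forall>i<min (length as) (length bs). as ! i = bs ! i")
    case True
    then show ?thesis
    proof (cases "length as \<le> length bs")
      case True
      with \<open>\<forall>i<min _ _. _\<close> have "cyl S as \<inter> cyl S bs = cyl S bs" by (auto simp: cyl_def)
      then show ?thesis by blast
    next
      case False
      with \<open>\<forall>i<min _ _. _\<close> have "cyl S as \<inter> cyl S bs = cyl S as" by (auto simp: cyl_def)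
      then show ?thesis by blast
    qed
  next
    case False
    then have "cyl S as \<inter> cyl S bs = {}" by (force simp: cyl_def)
    then show ?thesis by blast
  qed
  then show "A \<inter> B \<in> insert {} (cyl S ` lists S)"
    using A B by blast
qed

lemma seq_space_measure_eqI:
  assumes "countable S" "finite_measure \<mu>"
    and "sets \<mu> = sets (seq_space S)" "sets \<nu> = sets (seq_space S)"
    and "\<And>bs. bs \<in> lists S \<Longrightarrow> emeasure \<mu> (cyl S bs) = emeasure \<nu> (cyl S bs)"
  shows "\<mu> = \<nu>"
proof (rule measure_eqI_generator_eq[OF Int_stable_cyl])
  interpret finite_measure \<mu> by fact
  show "insert {} (cyl S ` lists S) \<subseteq> Pow {y. range y \<subseteq> S}" by (auto simp: cyl_def)
  show "range (\<lambda>i::nat. cyl S []) \<subseteq> insert {} (cyl S ` lists S)" by auto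
  show "(\<Union>i::nat. cyl S []) = {y. range y \<subseteq> S}" by (auto simp: cyl_def)
  show "emeasure \<mu> (cyl S []) \<noteq> \<infinity>" for i :: nat by simp
  show "emeasure \<mu> A = emeasure \<nu> A" if "A \<in> insert {} (cyl S ` lists S)" for A
    using that assms(5) by auto
qed (use assms sets_seq_space[OF assms(1)] in simp_all)

lemma seq_space_kernelI:
  assumes "countable S"
    and "\<And>a. a \<in> space M \<Longrightarrow> prob_space (K a)"
    and "\<And>a. a \<in> space M \<Longrightarrow> sets (K a) = sets (seq_space S)"
    and "\<And>bs. bs \<in> lists S \<Longrightarrow> (\<lambda>a. emeasure (K a) (cyl S bs)) \<in> borel_measurable M"
  shows "K \<in> M \<rightarrow>\<^sub>M prob_algebra (seq_space S)"
  using assms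
  by (intro measurable_prob_algebra_generated[OF sets_seq_space Int_stable_cyl]) (auto simp: cyl_def)

lemma measurable_comp_seq_space: "(\<lambda>y. y \<circ> \<sigma>) \<in> seq_space S \<rightarrow>\<^sub>M seq_space S"
  unfolding seq_space_def o_def by (rule measurable_PiM_single') (auto simp: space_PiM PiE_iff)

section \<open>Exchangeable laws on sequences over a countable set\<close>

lemma has_sum_iff_nn_integral_count_space:
  fixes f :: "'a \<Rightarrow> real"
  assumes nonneg: "\<And>b. b \<in> S \<Longrightarrow> 0 \<le> f b" and "0 \<le> r"
  shows "(f has_sum r) S \<longleftrightarrow> (\<integral>\<^sup>+b. ennreal (f b) \<partial>count_space S) = ennreal r"
proof -
  have norm: "f summable_on S \<longleftrightarrow> Infinite_Set_Sum.abs_summable_on f S"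
    by (metis abs_summable_equivalent assms(1) summable_on_iff_abs_summable_on_real)
  have eq: "(\<integral>\<^sup>+b. ennreal (f b) \<partial>count_space S) = ennreal (infsum f S)" if "f summable_on S"
  proof -
    have "integrable (count_space S) f"
      using that norm by (simp add: abs_summable_on_def)
    then have "(\<integral>\<^sup>+b. ennreal (f b) \<partial>count_space S) = ennreal (infsetsum f S)"
      unfolding infsetsum_def by (rule nn_integral_eq_integral) (simp add: AE_count_space nonneg)
    then show ?thesis using that norm by (simp add: infsetsum_infsum)
  qed
  show ?thesis
  proof
    assume "(f has_sum r) S"
    then show "(\<integral>\<^sup>+b. ennreal (f b) \<partial>count_space S) = ennreal r"
      using eq by (metis has_sum_imp_summable infsumI)
  next
    assume r: "(\<integral>\<^sup>+b. ennreal (f b) \<partial>count_space S) = ennreal r"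
    then have "integrable (count_space S) f"
      by (intro integrableI_nonneg) (auto simp: AE_count_space nonneg)
    then have s: "f summable_on S" using norm by (simp add: abs_summable_on_def)
    then have "ennreal (infsum f S) = ennreal r" using eq r by simp
    then have "infsum f S = r" using \<open>0 \<le> r\<close> nonneg by (simp add: infsum_nonneg)
    then show "(f has_sum r) S" using has_sum_infsum[OF s] by simp
  qed
qed

text \<open>Laws of sequences in a countable set that are invariant under all permutations of the index set.\<close>

locale exchangeable_law = prob_space \<mu> for \<mu> :: "(nat \<Rightarrow> 'a) measure" +
  fixes S :: "'a set"
  assumes countable_S: "countable S"
    and sets_eq: "sets \<mu> = sets (seq_space S)"
    and exch: "\<And>\<sigma>. bij \<sigma> \<Longrightarrow> distr \<mu> \<mu> (\<lambda>y. y \<circ> \<sigma>) = \<mu>"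
begin

lemma space_eq: "space \<mu> = {y. range y \<subseteq> S}"
  using sets_eq_imp_space_eq[OF sets_eq] by (simp add: space_seq_space)

lemma measurable_entry [measurable]: "(\<lambda>y. y i) \<in> \<mu> \<rightarrow>\<^sub>M count_space S"
proof -
  have "(\<lambda>y. y i) \<in> seq_space S \<rightarrow>\<^sub>M count_space S"
    unfolding seq_space_def by measurable
  then show ?thesis by (simp add: measurable_cong_sets[OF sets_eq refl])
qed

lemma measurable_reindex [measurable]: "(\<lambda>y. y \<circ> \<sigma>) \<in> \<mu> \<rightarrow>\<^sub>M \<mu>"
proof -
  show ?thesis
    using measurable_comp_seq_space[of \<sigma> S] by (simp only: measurable_cong_sets[OF sets_eq sets_eq])
qed

lemma integral_reindex:
  fixes h :: "(nat \<Rightarrow> 'a) \<Rightarrow> real"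
  assumes "bij \<sigma>" and [measurable]: "h \<in> borel_measurable \<mu>"
  shows "(\<integral>y. h (y \<circ> \<sigma>) \<partial>\<mu>) = (\<integral>y. h y \<partial>\<mu>)"
proof -
  have "(\<integral>y. h y \<partial>\<mu>) = (\<integral>y. h y \<partial>distr \<mu> \<mu> (\<lambda>y. y \<circ> \<sigma>))"
    using exch[OF assms(1)] by simp
  also have "\<dots> = (\<integral>y. h (y \<circ> \<sigma>) \<partial>\<mu>)"
    by (rule integral_distr) measurable
  finally show ?thesis ..
qed

text \<open>The indicator of the event that entry \<open>i\<close> is \<open>b\<close>.\<close>

definition hit :: "'a \<Rightarrow> nat \<Rightarrow> (nat \<Rightarrow> 'a) \<Rightarrow> real" where
  "hit b i y = of_bool (y i = b)"

text \<open>The relative frequency of \<open>b\<close> among the first \<open>N\<close> entries.\<close>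

definition freq :: "nat \<Rightarrow> 'a \<Rightarrow> (nat \<Rightarrow> 'a) \<Rightarrow> real" where
  "freq N b y = (\<Sum>i<N. hit b i y) / N"

text \<open>
  The limit of the relative frequencies along the powers of \<open>4\<close>, a subsequence sparse enough for
  almost sure convergence. Truncation to the unit interval makes the value bounded also where the
  limit does not exist.
\<close>

definition limit_freq :: "(nat \<Rightarrow> 'a) \<Rightarrow> 'a \<Rightarrow> real" where
  "limit_freq y b = max 0 (min 1 (lim (\<lambda>k. freq (4 ^ k) b y)))"

lemma hit_bounds: "0 \<le> hit b i y" "hit b i y \<le> 1"
  by (auto simp: hit_def)

lemma hit_swap: "hit b i (y \<circ> \<sigma>) = hit b (\<sigma> i) y"
  by (simp add: hit_def)

lemma freq_bounds: "0 \<le> freq N b y" "freq N b y \<le> 1"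
proof -
  have "(\<Sum>i<N. hit b i y) \<le> (\<Sum>i<N. 1)" by (rule sum_mono) (rule hit_bounds)
  then show "0 \<le> freq N b y" "freq N b y \<le> 1"
    by (auto simp: freq_def divide_le_eq_1 intro!: divide_nonneg_nonneg sum_nonneg hit_bounds)
qed

lemma limit_freq_bounds: "0 \<le> limit_freq y b" "limit_freq y b \<le> 1"
  by (auto simp: limit_freq_def)

lemma measurable_hit [measurable]: "hit b i \<in> borel_measurable \<mu>"
proof -
  have "(\<lambda>y. of_bool (y i = b) :: real) = (\<lambda>x. of_bool (x = b)) \<circ> (\<lambda>y. y i)" by auto
  also have "\<dots> \<in> borel_measurable \<mu>"
    by (rule measurable_comp[OF measurable_entry]) simp
  finally show ?thesis by (simp add: hit_def[abs_def])
qed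

lemma measurable_freq [measurable]: "freq N b \<in> borel_measurable \<mu>"
  unfolding freq_def[abs_def] by measurable

lemma measurable_limit_freq [measurable]: "(\<lambda>y. limit_freq y b) \<in> borel_measurable \<mu>"
  unfolding limit_freq_def by measurable

lemma integrable_bounded:
  fixes h :: "(nat \<Rightarrow> 'a) \<Rightarrow> real"
  assumes "h \<in> borel_measurable \<mu>" "\<And>y. \<bar>h y\<bar> \<le> B"
  shows "integrable \<mu> h"
  using assms by (intro integrable_const_bound[of _ B]) auto

text \<open>Transposing two entries changes no relative frequency of an initial segment containing both.\<close>

lemma limit_freq_swap: "limit_freq (y \<circ> Transposition.transpose i j) b = limit_freq y b"
proof -
  let ?\<tau> = "Transposition.transpose i j"
  have "freq N b (y \<circ> ?\<tau>) = freq N b y" if "max i j < N" for N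
  proof -
    have "bij_betw ?\<tau> {..<N} {..<N}"
      using that by (intro bij_betw_byWitness[where f' = ?\<tau>])
        (auto simp: Transposition.transpose_def)
    then have "(\<Sum>k<N. hit b (?\<tau> k) y) = (\<Sum>k<N. hit b k y)"
      by (rule sum.reindex_bij_betw)
    then show ?thesis by (simp add: freq_def hit_swap)
  qed
  moreover have "\<forall>\<^sub>F k in sequentially. max i j < (4::nat) ^ k"
  proof (rule eventually_sequentiallyI)
    fix k assume "max i j \<le> k"
    also have "k < 4 ^ k" by (rule power_gt_expt) simp
    finally show "max i j < 4 ^ k" .
  qed
  ultimately have "\<forall>\<^sub>F k in sequentially. freq (4 ^ k) b (y \<circ> ?\<tau>) = freq (4 ^ k) b y"
    by (auto elim: eventually_mono)
  then have "(\<lambda>k. freq (4 ^ k) b (y \<circ> ?\<tau>)) \<longlonglongrightarrow> l \<longleftrightarrow> (\<lambda>k. freq (4 ^ k) b y) \<longlonglongrightarrow> l" for l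
    by (rule filterlim_cong[OF refl refl])
  then show ?thesis by (simp add: limit_freq_def lim_def)
qed

lemma integral_hit_hit:
  "(\<integral>y. hit b i y * hit b j y \<partial>\<mu>)
     = (if i = j then \<integral>y. hit b 0 y \<partial>\<mu> else \<integral>y. hit b 0 y * hit b 1 y \<partial>\<mu>)"
proof (cases "i = j")
  case True
  have "(\<integral>y. hit b i y \<partial>\<mu>) = (\<integral>y. hit b 0 (y \<circ> Transposition.transpose 0 i) \<partial>\<mu>)"
    by (simp add: hit_swap)
  also have "\<dots> = (\<integral>y. hit b 0 y \<partial>\<mu>)"
    by (rule integral_reindex) auto
  finally have "(\<integral>y. hit b i y \<partial>\<mu>) = (\<integral>y. hit b 0 y \<partial>\<mu>)" .
  moreover have "(\<lambda>y. hit b i y * hit b i y) = hit b i" by (simp add: hit_def fun_eq_iff)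
  ultimately show ?thesis using True by simp
next
  case False
  obtain \<sigma> :: "nat \<Rightarrow> nat" where \<sigma>: "bij \<sigma>" "\<sigma> 0 = i" "\<sigma> 1 = j"
  proof
    let ?a = "Transposition.transpose 0 i"
    let ?\<sigma> = "?a \<circ> Transposition.transpose 1 (?a j)"
    show "bij ?\<sigma>" by (intro bij_comp) auto
    show "?\<sigma> 0 = i" "?\<sigma> 1 = j" using False by (auto simp: Transposition.transpose_def)
  qed
  have "(\<integral>y. hit b i y * hit b j y \<partial>\<mu>) = (\<integral>y. (\<lambda>y. hit b 0 y * hit b 1 y) (y \<circ> \<sigma>) \<partial>\<mu>)"
    using \<sigma> by (simp add: hit_swap)
  also have "\<dots> = (\<integral>y. hit b 0 y * hit b 1 y \<partial>\<mu>)"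
    by (rule integral_reindex) (use \<sigma> in auto)
  finally show ?thesis using False by simp
qed

lemma integral_freq_freq:
  assumes "0 < N" "N \<le> M" and p_def: "p = (\<integral>y. hit b 0 y \<partial>\<mu>)"
    and q_def: "q = (\<integral>y. hit b 0 y * hit b 1 y \<partial>\<mu>)"
  shows "(\<integral>y. freq N b y * freq M b y \<partial>\<mu>) = q + (p - q) / M"
proof -
  have int: "integrable \<mu> (\<lambda>y. hit b i y * hit b j y)" for i j
    by (rule integrable_bounded[of _ 1]) (auto simp: hit_def)
  have "(\<integral>y. freq N b y * freq M b y \<partial>\<mu>) = (\<integral>y. (\<Sum>i<N. \<Sum>j<M. hit b i y * hit b j y) / (N * M) \<partial>\<mu>)"
    by (simp add: freq_def sum_product)
  also have "\<dots> = (\<integral>y. (\<Sum>i<N. \<Sum>j<M. hit b i y * hit b j y) \<partial>\<mu>) / (N * M)"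
    by (rule integral_divide_zero)
  also have "(\<integral>y. (\<Sum>i<N. \<Sum>j<M. hit b i y * hit b j y) \<partial>\<mu>)
      = (\<Sum>i<N. \<integral>y. (\<Sum>j<M. hit b i y * hit b j y) \<partial>\<mu>)"
    by (rule Bochner_Integration.integral_sum) (intro Bochner_Integration.integrable_sum int)
  also have "\<dots> = (\<Sum>i<N. \<Sum>j<M. \<integral>y. hit b i y * hit b j y \<partial>\<mu>)"
    by (rule sum.cong[OF refl], rule Bochner_Integration.integral_sum, rule int)
  also have "(\<Sum>i<N. \<Sum>j<M. \<integral>y. hit b i y * hit b j y \<partial>\<mu>) = (\<Sum>i<N. \<Sum>j<M. q + (if i = j then p - q else 0))"
  proof -
    have "(\<integral>y. hit b i y * hit b j y \<partial>\<mu>) = q + (if i = j then p - q else 0)" for i j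
      using integral_hit_hit[of b i j] p_def q_def by simp
    then show ?thesis by (simp only:)
  qed
  also have "\<dots> = (\<Sum>i<N. M * q + (p - q))"
    using assms(2) by (intro sum.cong) (auto simp: sum.distrib)
  also have "\<dots> = N * (M * q + (p - q))" by simp
  also have "\<dots> / (N * M) = q + (p - q) / M"
    using assms by (simp add: field_simps)
  finally show ?thesis .
qed

text \<open>
  The exact value is \<open>(p - q) * (1 / N - 1 / M)\<close>, where \<open>p\<close> and \<open>q\<close> are the probabilities that one
  given entry, or two given entries, equal \<open>b\<close>.
\<close>

lemma integral_freq_diff_sq:
  assumes "0 < N" "N \<le> M"
  shows "(\<integral>y. (freq N b y - freq M b y)\<^sup>2 \<partial>\<mu>) \<le> 1 / N"
proof -
  define p q where "p = (\<integral>y. hit b 0 y \<partial>\<mu>)" and "q = (\<integral>y. hit b 0 y * hit b 1 y \<partial>\<mu>)"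
  have int: "integrable \<mu> (\<lambda>y. freq i b y * freq j b y)" for i j
    by (rule integrable_bounded[of _ 1]) (auto simp: abs_mult freq_bounds intro!: mult_le_one)
  have "(\<integral>y. (freq N b y - freq M b y)\<^sup>2 \<partial>\<mu>)
      = (\<integral>y. freq N b y * freq N b y - 2 * (freq N b y * freq M b y) + freq M b y * freq M b y \<partial>\<mu>)"
    by (simp add: power2_eq_square algebra_simps)
  also have "\<dots> = (\<integral>y. freq N b y * freq N b y \<partial>\<mu>) - 2 * (\<integral>y. freq N b y * freq M b y \<partial>\<mu>)
      + (\<integral>y. freq M b y * freq M b y \<partial>\<mu>)"
    using int by simp
  also have "\<dots> = (q + (p - q) / N) - 2 * (q + (p - q) / M) + (q + (p - q) / M)"
    using assms by (simp add: integral_freq_freq[OF _ _ p_def q_def])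
  also have "\<dots> = (p - q) * (1 / N - 1 / M)" by (simp add: algebra_simps diff_divide_distrib)
  also have "\<dots> \<le> 1 * (1 / N)"
  proof (rule mult_mono)
    have "p \<le> 1" unfolding p_def
      by (rule integral_le_const) (auto intro!: integrable_bounded[of _ 1] simp: hit_def)
    moreover have "0 \<le> q" unfolding q_def
      by (rule Bochner_Integration.integral_nonneg) (simp add: hit_bounds)
    ultimately show "p - q \<le> 1" by simp
  qed (use assms in \<open>simp_all add: frac_le\<close>)
  finally show ?thesis by simp
qed

lemma AE_convergent_freq: "AE y in \<mu>. convergent (\<lambda>k. freq (4 ^ k) b y)"
proof -
  let ?D = "\<lambda>k y. freq (4 ^ k) b y - freq (4 ^ Suc k) b y"
  have D: "(\<integral>\<^sup>+y. ennreal \<bar>?D k y\<bar> \<partial>\<mu>) \<le> ennreal ((1/2) ^ k)" for k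
  proof -
    have bound: "\<bar>?D k y\<bar> \<le> 1" for y
      using freq_bounds[of "4 ^ k" b y] freq_bounds[of "4 ^ Suc k" b y] by linarith
    have int: "integrable \<mu> (\<lambda>y. (?D k y)\<^sup>2)" "integrable \<mu> (\<lambda>y. \<bar>?D k y\<bar>)"
      using bound by (auto intro!: integrable_bounded[of _ 1] simp: power_le_one abs_square_le_1)
    have "(\<integral>y. \<bar>?D k y\<bar> \<partial>\<mu>) \<le> (\<integral>y. ((1/2) ^ k + 2 ^ k * (?D k y)\<^sup>2) / 2 \<partial>\<mu>)"
    proof (rule integral_mono)
      fix y
      \<comment> \<open>The mean of the increment is bounded through its mean square, weighted by \<open>2 ^ k\<close>.\<close>
      have "0 \<le> (1 - 2 ^ k * \<bar>?D k y\<bar>)\<^sup>2 / 2 ^ k" by simp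
      also have "\<dots> = (1/2) ^ k + 2 ^ k * (?D k y)\<^sup>2 - 2 * \<bar>?D k y\<bar>"
        by (simp add: power2_eq_square field_simps)
      finally show "\<bar>?D k y\<bar> \<le> ((1/2) ^ k + 2 ^ k * (?D k y)\<^sup>2) / 2" by simp
    qed (use int in auto)
    also have "\<dots> = ((1/2) ^ k + 2 ^ k * (\<integral>y. (?D k y)\<^sup>2 \<partial>\<mu>)) / 2"
      using int by (simp add: prob_space)
    also have "\<dots> \<le> ((1/2) ^ k + 2 ^ k * (1 / (4 ^ k :: nat))) / 2"
      by (intro divide_right_mono add_left_mono mult_left_mono integral_freq_diff_sq) auto
    also have "\<dots> = (1/2) ^ k"
    proof -
      have "(4::real) ^ k = 2 ^ k * 2 ^ k" by (simp flip: power_mult_distrib)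
      then show ?thesis by (simp add: field_simps)
    qed
    finally show ?thesis
      using int by (subst nn_integral_eq_integral) (auto intro: ennreal_leI)
  qed
  have "(\<integral>\<^sup>+y. (\<Sum>k. ennreal \<bar>?D k y\<bar>) \<partial>\<mu>) = (\<Sum>k. \<integral>\<^sup>+y. ennreal \<bar>?D k y\<bar> \<partial>\<mu>)"
    by (rule nn_integral_suminf) measurable
  also have "\<dots> \<le> (\<Sum>k. ennreal ((1/2) ^ k))"
    by (rule suminf_le) (use D in auto)
  also have "\<dots> < \<infinity>"
  proof -
    have "(\<Sum>k. ennreal ((1/2) ^ k)) = ennreal (\<Sum>k. (1/2) ^ k)"
      by (rule suminf_ennreal2) auto
    then show ?thesis by simp
  qed
  finally have "AE y in \<mu>. (\<Sum>k. ennreal \<bar>?D k y\<bar>) \<noteq> \<infinity>"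
    by (intro nn_integral_PInf_AE) auto
  then show ?thesis
  proof eventually_elim
    case (elim y)
    then have "summable (\<lambda>k. \<bar>?D k y\<bar>)"
      by (intro summable_suminf_not_top) auto
    then have "summable (\<lambda>k. ?D k y)"
      by (rule summable_rabs_cancel)
    then have "convergent (\<lambda>n. freq (4 ^ 0) b y - freq (4 ^ n) b y)"
      unfolding summable_iff_convergent sum_lessThan_telescope'[of "\<lambda>k. freq (4 ^ k) b y"] .
    then have "convergent (\<lambda>n. freq (4 ^ 0) b y - (freq (4 ^ 0) b y - freq (4 ^ n) b y))"
      by (rule convergent_diff[OF convergent_const])
    then show ?case by simp
  qed
qed

lemma AE_freq_tendsto: "AE y in \<mu>. (\<lambda>k. freq (4 ^ k) b y) \<longlonglongrightarrow> limit_freq y b"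
  using AE_convergent_freq[of b]
proof eventually_elim
  case (elim y)
  then have l: "(\<lambda>k. freq (4 ^ k) b y) \<longlonglongrightarrow> lim (\<lambda>k. freq (4 ^ k) b y)"
    by (simp add: convergent_LIMSEQ_iff)
  have "lim (\<lambda>k. freq (4 ^ k) b y) \<le> 1" "0 \<le> lim (\<lambda>k. freq (4 ^ k) b y)"
    using l by (auto intro: LIMSEQ_le_const2 LIMSEQ_le_const freq_bounds)
  then show ?case using l by (simp add: limit_freq_def)
qed

text \<open>
  The expectation of \<open>h\<close> times the indicator of \<open>b\<close> at position \<open>m\<close> is the same for all \<open>m \<ge> k\<close>,
  because \<open>h\<close> is invariant under the transposition of \<open>k\<close> and \<open>m\<close>. Averaging over \<open>m < N\<close> changes it
  by a term of order \<open>1 / N\<close> only, and the average of the indicators tends to the limiting frequency.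
\<close>

lemma replace_hit_by_limit_freq:
  fixes h :: "(nat \<Rightarrow> 'a) \<Rightarrow> real"
  assumes [measurable]: "h \<in> borel_measurable \<mu>" and h: "\<And>y. \<bar>h y\<bar> \<le> 1"
    and sym: "\<And>y m. k \<le> m \<Longrightarrow> h (y \<circ> Transposition.transpose k m) = h y"
  shows "(\<integral>y. h y * hit b k y \<partial>\<mu>) = (\<integral>y. h y * limit_freq y b \<partial>\<mu>)"
proof -
  define c where "c = (\<integral>y. h y * hit b k y \<partial>\<mu>)"
  define d where "d m = (\<integral>y. h y * hit b m y \<partial>\<mu>) - c" for m
  have int: "integrable \<mu> (\<lambda>y. h y * hit b m y)" for m
    using h by (intro integrable_bounded[of _ 1]) (auto simp: hit_def)
  have d0: "d m = 0" if "k \<le> m" for m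
  proof -
    have "(\<integral>y. h y * hit b m y \<partial>\<mu>)
        = (\<integral>y. (\<lambda>y. h y * hit b k y) (y \<circ> Transposition.transpose k m) \<partial>\<mu>)"
      using sym[OF that] by (simp add: hit_swap)
    also have "\<dots> = c" unfolding c_def by (rule integral_reindex) auto
    finally show ?thesis by (simp add: d_def)
  qed
  have avg: "(\<integral>y. h y * freq N b y \<partial>\<mu>) = c + (\<Sum>m<k. d m) / N" if N: "k < N" for N
  proof -
    have "(\<integral>y. h y * freq N b y \<partial>\<mu>) = (\<integral>y. (\<Sum>m<N. h y * hit b m y) / N \<partial>\<mu>)"
      by (simp add: freq_def sum_distrib_left)
    also have "\<dots> = (\<Sum>m<N. c + d m) / N"
      using int by (simp add: Bochner_Integration.integral_sum d_def)
    also have "(\<Sum>m<N. c + d m) = N * c + (\<Sum>m<N. d m)" by (simp add: sum.distrib)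
    also have "(\<Sum>m<N. d m) = (\<Sum>m<k. d m)"
      using N by (intro sum.mono_neutral_right) (auto simp: d0)
    finally show ?thesis using N by (simp add: field_simps)
  qed
  have "(\<lambda>j. \<integral>y. h y * freq (4 ^ j) b y \<partial>\<mu>) \<longlonglongrightarrow> (\<integral>y. h y * limit_freq y b \<partial>\<mu>)"
  proof (rule integral_dominated_convergence[where w = "\<lambda>_. 1"])
    show "AE y in \<mu>. (\<lambda>j. h y * freq (4 ^ j) b y) \<longlonglongrightarrow> h y * limit_freq y b"
      using AE_freq_tendsto[of b] by eventually_elim (rule tendsto_mult_left)
    show "AE y in \<mu>. norm (h y * freq (4 ^ j) b y) \<le> 1" for j
      using h freq_bounds by (auto simp: abs_mult intro!: mult_le_one)
  qed auto
  moreover have "(\<lambda>j. \<integral>y. h y * freq (4 ^ j) b y \<partial>\<mu>) \<longlonglongrightarrow> c"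
  proof (rule Lim_transform_eventually)
    have "filterlim (\<lambda>j. real (4 ^ j)) at_infinity sequentially"
      using filterlim_realpow_sequentially_gt1[of "4::real"] by simp
    then have "(\<lambda>j. c + (\<Sum>m<k. d m) / real (4 ^ j)) \<longlonglongrightarrow> c + 0"
      by (intro tendsto_add tendsto_const tendsto_divide_0[OF tendsto_const])
    then show "(\<lambda>j. c + (\<Sum>m<k. d m) / real (4 ^ j)) \<longlonglongrightarrow> c" by simp
    show "\<forall>\<^sub>F j in sequentially. c + (\<Sum>m<k. d m) / real (4 ^ j) = (\<integral>y. h y * freq (4 ^ j) b y \<partial>\<mu>)"
    proof (rule eventually_sequentiallyI)
      fix j assume "k \<le> j"
      also have "j < 4 ^ j" by (rule power_gt_expt) simp
      finally show "c + (\<Sum>m<k. d m) / real (4 ^ j) = (\<integral>y. h y * freq (4 ^ j) b y \<partial>\<mu>)"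
        using avg[of "4 ^ j"] by simp
    qed
  qed
  ultimately show ?thesis
    unfolding c_def using LIMSEQ_unique by blast
qed

text \<open>The first \<open>k\<close> indicators remain, the others have been replaced by limiting frequencies.\<close>

lemma integral_mixed_product:
  assumes "k \<le> length bs"
  shows "(\<integral>y. (\<Prod>i<length bs. hit (bs ! i) i y) \<partial>\<mu>)
    = (\<integral>y. (\<Prod>i<k. hit (bs ! i) i y) * (\<Prod>i\<in>{k..<length bs}. limit_freq y (bs ! i)) \<partial>\<mu>)"
  using assms
proof (induction k rule: inc_induct)
  case base
  then show ?case by simp
next
  case (step k)
  let ?h = "\<lambda>y. (\<Prod>i<k. hit (bs ! i) i y) * (\<Prod>i\<in>{Suc k..<length bs}. limit_freq y (bs ! i))"
  have "(\<integral>y. (\<Prod>i<Suc k. hit (bs ! i) i y) * (\<Prod>i\<in>{Suc k..<length bs}. limit_freq y (bs ! i)) \<partial>\<mu>)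
     = (\<integral>y. ?h y * hit (bs ! k) k y \<partial>\<mu>)"
    by (simp add: mult_ac)
  also have "\<dots> = (\<integral>y. ?h y * limit_freq y (bs ! k) \<partial>\<mu>)"
  proof (rule replace_hit_by_limit_freq)
    show "\<bar>?h y\<bar> \<le> 1" for y
    proof -
      have "0 \<le> (\<Prod>i<k. hit (bs ! i) i y)" "(\<Prod>i<k. hit (bs ! i) i y) \<le> 1"
        by (auto intro!: prod_nonneg prod_le_1 simp: hit_bounds)
      moreover have "0 \<le> (\<Prod>i\<in>{Suc k..<length bs}. limit_freq y (bs ! i))"
        "(\<Prod>i\<in>{Suc k..<length bs}. limit_freq y (bs ! i)) \<le> 1"
        by (auto intro!: prod_nonneg prod_le_1 simp: limit_freq_bounds)
      ultimately show ?thesis by (simp add: mult_le_one)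
    qed
    show "?h (y \<circ> Transposition.transpose k m) = ?h y" if "k \<le> m" for y m
      using that by (simp add: limit_freq_swap hit_swap)
  qed measurable
  also have "\<dots> = (\<integral>y. (\<Prod>i<k. hit (bs ! i) i y) * (\<Prod>i\<in>{k..<length bs}. limit_freq y (bs ! i)) \<partial>\<mu>)"
    using step.hyps by (simp add: prod.atLeast_Suc_lessThan mult_ac)
  finally show ?case using step.IH by simp
qed

lemma measure_cyl:
  "measure \<mu> (cyl S bs) = (\<integral>y. (\<Prod>i<length bs. limit_freq y (bs ! i)) \<partial>\<mu>)"
proof -
  have "measure \<mu> (cyl S bs) = (\<integral>y. indicator (cyl S bs) y \<partial>\<mu>)"
    using cyl_in_sets[of S bs] sets_eq by (simp add: sets.Int_space_eq2)
  also have "\<dots> = (\<integral>y. (\<Prod>i<length bs. hit (bs ! i) i y) \<partial>\<mu>)"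
    by (intro Bochner_Integration.integral_cong refl)
      (auto simp: hit_def cyl_def space_eq indicator_def)
  finally show ?thesis
    using integral_mixed_product[of 0 bs] by (simp add: atLeast0LessThan)
qed

lemma measurable_sum_limit_freq [measurable]:
  "(\<lambda>y. \<integral>\<^sup>+b. ennreal (limit_freq y b) \<partial>count_space S) \<in> borel_measurable \<mu>"
proof -
  interpret C: sigma_finite_measure "count_space S"
    using countable_S by (rule sigma_finite_measure_count_space_countable)
  have "(\<lambda>(b, y). ennreal (limit_freq y b)) \<in> borel_measurable (count_space S \<Otimes>\<^sub>M \<mu>)"
    by (rule measurable_pair_measure_countable1[OF countable_S]) simp
  then have "(\<lambda>(y, b). ennreal (limit_freq y b)) \<in> borel_measurable (\<mu> \<Otimes>\<^sub>M count_space S)"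
    by (subst measurable_pair_swap_iff) (simp add: case_prod_beta')
  then show ?thesis
    by (rule C.borel_measurable_nn_integral)
qed

text \<open>
  The sum is at most \<open>1\<close> since finite sums of relative frequencies are, and its expectation is the
  sum of the probabilities that entry \<open>0\<close> is \<open>b\<close>, hence equal to \<open>1\<close>.
\<close>

lemma AE_limit_freq_has_sum: "AE y in \<mu>. (limit_freq y has_sum 1) S"
proof -
  have "AE y in \<mu>. \<forall>b\<in>S. (\<lambda>k. freq (4 ^ k) b y) \<longlonglongrightarrow> limit_freq y b"
    using countable_S AE_freq_tendsto by (simp add: AE_ball_countable)
  then have le: "AE y in \<mu>. (\<integral>\<^sup>+b. ennreal (limit_freq y b) \<partial>count_space S) \<le> 1"
  proof eventually_elim
    case (elim y)
    have fin: "(\<Sum>b\<in>Q. limit_freq y b) \<le> 1" if "finite Q" "Q \<subseteq> S" for Q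
    proof (rule LIMSEQ_le_const2)
      show "(\<lambda>k. \<Sum>b\<in>Q. freq (4 ^ k) b y) \<longlonglongrightarrow> (\<Sum>b\<in>Q. limit_freq y b)"
        using elim that by (intro tendsto_sum) auto
      have "(\<Sum>b\<in>Q. freq N b y) \<le> 1" for N
      proof -
        have "(\<Sum>b\<in>Q. freq N b y) = (\<Sum>i<N. \<Sum>b\<in>Q. hit b i y) / N"
          unfolding freq_def by (subst sum.swap) (simp add: sum_divide_distrib)
        moreover have "(\<Sum>b\<in>Q. hit b i y) \<le> 1" for i
          using \<open>finite Q\<close> by (simp add: hit_def of_bool_def)
        then have "(\<Sum>i<N. \<Sum>b\<in>Q. hit b i y) \<le> (\<Sum>i<N. 1)" by (intro sum_mono)
        ultimately show ?thesis by (cases "N = 0") (simp_all add: divide_le_eq_1)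
      qed
      then show "\<exists>K. \<forall>k\<ge>K. (\<Sum>b\<in>Q. freq (4 ^ k) b y) \<le> 1" by blast
    qed
    have s: "limit_freq y summable_on S"
      using fin by (intro nonneg_bounded_partial_sums_imp_summable_on[where C = 1])
        (auto simp: limit_freq_bounds intro!: eventually_finite_subsets_at_top_weakI)
    have "infsum (limit_freq y) S \<le> 1"
      using s fin by (rule infsum_le_finite_sums)
    moreover have "(\<integral>\<^sup>+b. ennreal (limit_freq y b) \<partial>count_space S) = ennreal (infsum (limit_freq y) S)"
      using s by (subst has_sum_iff_nn_integral_count_space[symmetric])
        (auto simp: limit_freq_bounds infsum_nonneg has_sum_infsum)
    ultimately show ?case by simp
  qed
  have single: "(\<integral>\<^sup>+y. ennreal (limit_freq y b) \<partial>\<mu>) = emeasure \<mu> (cyl S [b])" for b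
    using measure_cyl[of "[b]"]
    by (subst nn_integral_eq_integral)
      (auto simp: emeasure_eq_measure limit_freq_bounds intro!: integrable_bounded[of _ 1])
  have "(\<integral>\<^sup>+y. (\<integral>\<^sup>+b. ennreal (limit_freq y b) \<partial>count_space S) \<partial>\<mu>)
      = (\<integral>\<^sup>+b. emeasure \<mu> (cyl S [b]) \<partial>count_space S)"
    unfolding single[symmetric]
    by (rule nn_integral_count_space_nn_integral) (use countable_S in auto)
  also have "\<dots> = emeasure \<mu> (\<Union>b\<in>S. cyl S [b])"
  proof (rule emeasure_UN_countable[symmetric])
    show "disjoint_family_on (\<lambda>b. cyl S [b]) S" by (auto simp: disjoint_family_on_def cyl_def)
  qed (use cyl_in_sets sets_eq countable_S in auto)
  also have "(\<Union>b\<in>S. cyl S [b]) = space \<mu>" by (auto simp: cyl_def space_eq)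
  finally have one: "(\<integral>\<^sup>+y. (\<integral>\<^sup>+b. ennreal (limit_freq y b) \<partial>count_space S) \<partial>\<mu>) = 1"
    by (simp add: emeasure_space_1)
  have "AE y in \<mu>. 1 \<le> (\<integral>\<^sup>+b. ennreal (limit_freq y b) \<partial>count_space S)"
  proof (rule ccontr)
    assume "\<not> ?thesis"
    then have "(\<integral>\<^sup>+y. (\<integral>\<^sup>+b. ennreal (limit_freq y b) \<partial>count_space S) \<partial>\<mu>) < (\<integral>\<^sup>+y. 1 \<partial>\<mu>)"
      using le one by (intro nn_integral_less) auto
    then show False using one by (simp add: emeasure_space_1)
  qed
  with le have "AE y in \<mu>. (\<integral>\<^sup>+b. ennreal (limit_freq y b) \<partial>count_space S) = 1"
    by eventually_elim (rule antisym)
  then show ?thesis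
    by eventually_elim (subst has_sum_iff_nn_integral_count_space, auto simp: limit_freq_bounds)
qed

end

section \<open>The simplex and mixtures of i.i.d. laws\<close>

lemma countable_Fin: "countable (Fin \<alpha>)"
proof -
  let ?code = "\<lambda>A :: int rstruct. (domain A, SIGMA j:UNIV. rel A j)"
  have "inj ?code"
  proof (rule injI)
    fix A B :: "int rstruct" assume eq: "?code A = ?code B"
    have "rel A j = rel B j" for j
      using arg_cong[OF eq, of "\<lambda>c. snd c `` {j}"] by auto
    then show "A = B" using eq by (cases A, cases B) auto
  qed
  moreover have "?code ` Fin \<alpha> \<subseteq> {D. finite D} \<times> {E. finite E}"
    by (auto simp: Fin_def)
  then have "countable (?code ` Fin \<alpha>)"
    by (rule countable_subset) (intro countable_SIGMA countable_Collect_finite)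
  ultimately show ?thesis
    by (metis countable_image_inj_on inj_on_subset subset_UNIV)
qed

lemma R_star_subset_Fin:
  assumes "R \<subseteq> Fin \<alpha>" shows "R_star R \<subseteq> Fin \<alpha>"
  using assms unfolding R_star_eq[OF assms] by (auto intro!: map_struct_Fin)

lemma countable_R_star: "R \<subseteq> Fin \<alpha> \<Longrightarrow> countable (R_star R)"
  by (rule countable_subset[OF R_star_subset_Fin countable_Fin])

context
  fixes R :: "int rstruct set"
begin

interpretation Metric_space "R_simplex R" "simplex_dist R"
  by (rule Metric_space_simplex)

lemma space_simplex_space: "space (simplex_space R) = R_simplex R"
  unfolding simplex_space_def
  by (rule space_measure_of) (auto simp: openin_mtopology)

lemma sets_simplex_space: "sets (simplex_space R) = sigma_sets (R_simplex R) {U. openin mtopology U}"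
  unfolding simplex_space_def
  by (rule sets_measure_of) (auto simp: openin_mtopology)

lemma coordinate_diff_le_simplex_dist:
  assumes "f \<in> R_simplex R" "g \<in> R_simplex R" "b \<in> R_star R"
  shows "\<bar>f b - g b\<bar> \<le> simplex_dist R f g"
proof -
  have "(\<Sum>\<^sub>\<infinity>B\<in>{b}. \<bar>f B - g B\<bar>) \<le> (\<Sum>\<^sub>\<infinity>B\<in>R_star R. \<bar>f B - g B\<bar>)"
    using assms by (intro infsum_mono_neutral simplex_summable) auto
  then show ?thesis by (simp add: simplex_dist_def)
qed

lemma measurable_simplex_coordinate:
  assumes b: "b \<in> R_star R"
  shows "(\<lambda>f. f b) \<in> borel_measurable (simplex_space R)"
  unfolding borel_measurable_iff_greater
proof
  fix a
  have "openin mtopology {f \<in> R_simplex R. a < f b}"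
    unfolding openin_mtopology
  proof (intro conjI allI impI)
    fix f assume f: "f \<in> {f \<in> R_simplex R. a < f b}"
    have "mball f (f b - a) \<subseteq> {f \<in> R_simplex R. a < f b}"
      using coordinate_diff_le_simplex_dist[of f _ b] b by (fastforce simp: in_mball)
    then show "\<exists>r>0. mball f r \<subseteq> {f \<in> R_simplex R. a < f b}"
      using f by (intro exI[of _ "f b - a"]) auto
  qed auto
  then show "{f \<in> space (simplex_space R). a < f b} \<in> sets (simplex_space R)"
    unfolding space_simplex_space sets_simplex_space by (intro sigma_sets.Basic) simp
qed

text \<open>
  On the simplex a lower bound for \<open>g\<close> on a finite set that carries most of the mass of \<open>f\<close> controls
  the whole distance, since \<open>\<bar>f b - g b\<bar> = f b + g b - 2 * min (f b) (g b)\<close>.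
\<close>

lemma simplex_dist_le:
  fixes f g :: "int rstruct \<Rightarrow> real" and \<epsilon> :: real
  assumes f: "f \<in> R_simplex R" and g: "g \<in> R_simplex R" and Q: "finite Q" "Q \<subseteq> R_star R"
    and close: "\<And>b. b \<in> Q \<Longrightarrow> f b - \<epsilon> \<le> g b" and "0 \<le> \<epsilon>"
  shows "simplex_dist R f g \<le> 2 - 2 * (\<Sum>b\<in>Q. f b) + 2 * card Q * \<epsilon>"
proof -
  let ?m = "\<lambda>b. if b \<in> Q then 2 * min (f b) (g b) else 0"
  have hm: "(?m has_sum (\<Sum>b\<in>Q. 2 * min (f b) (g b))) (R_star R)"
    using Q by (intro has_sum_finite_neutralI) auto
  have "((\<lambda>b. f b + g b + - ?m b) has_sum (1 + 1 + - (\<Sum>b\<in>Q. 2 * min (f b) (g b)))) (R_star R)"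
    using f g hm by (intro has_sum_uminusI has_sum_add) (auto simp: R_simplex_def)
  then have "simplex_dist R f g \<le> 2 - (\<Sum>b\<in>Q. 2 * min (f b) (g b))"
    unfolding simplex_dist_def
    using f g by (intro has_sum_mono[OF has_sum_infsum[OF simplex_summable[OF f g]]])
      (auto simp: R_simplex_def min_def)
  moreover have "(\<Sum>b\<in>Q. f b - \<epsilon>) \<le> (\<Sum>b\<in>Q. min (f b) (g b))"
    using close \<open>0 \<le> \<epsilon>\<close> by (intro sum_mono) (simp add: min_def)
  then have "(\<Sum>b\<in>Q. f b) - card Q * \<epsilon> \<le> (\<Sum>b\<in>Q. min (f b) (g b))"
    by (simp add: sum_subtractf)
  ultimately show ?thesis by (simp add: sum_distrib_left[symmetric])
qed

text \<open>
  Measurability of all coordinates suffices: every open set is a countable union of sets \<open>V W n\<close>,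
  defined by finitely many coordinates and rational bounds.
\<close>

lemma measurable_to_simplex_space:
  assumes S: "countable (R_star R)"
    and F: "\<And>x. x \<in> space M \<Longrightarrow> F x \<in> R_simplex R"
    and meas: "\<And>b. b \<in> R_star R \<Longrightarrow> (\<lambda>x. F x b) \<in> borel_measurable M"
  shows "F \<in> M \<rightarrow>\<^sub>M simplex_space R"
  unfolding simplex_space_def
proof (rule measurable_measure_of)
  show "F \<in> space M \<rightarrow> R_simplex R" using F by auto
  show "{U. openin mtopology U} \<subseteq> Pow (R_simplex R)"
    by (auto simp: openin_mtopology)
  fix U assume "U \<in> {U. openin mtopology U}"
  then have U: "U \<subseteq> R_simplex R" "\<And>f. f \<in> U \<Longrightarrow> \<exists>r>0. mball f r \<subseteq> U"
    by (auto simp: openin_mtopology)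
  define V where "V W n = {g \<in> R_simplex R. \<forall>(b, r)\<in>W. \<bar>g b - r\<bar> < 1 / Suc n}"
    for W :: "(int rstruct \<times> real) set" and n
  define \<W> :: "(int rstruct \<times> real) set set" where "\<W> = {W. finite W \<and> W \<subseteq> R_star R \<times> \<rat>}"
  have countable_W: "countable \<W>"
    unfolding \<W>_def using S countable_rat by (intro countable_Collect_finite_subset countable_SIGMA)
  have "\<exists>W\<in>\<W>. \<exists>n. f \<in> V W n \<and> V W n \<subseteq> U" if fU: "f \<in> U" for f
  proof -
    obtain r where r: "r > 0" "mball f r \<subseteq> U" using U fU by blast
    have f: "f \<in> R_simplex R" using U fU by blast
    then have "(f has_sum 1) (R_star R)" by (simp add: R_simplex_def)
    then have "\<forall>\<^sub>F Q in finite_subsets_at_top (R_star R). dist (sum f Q) 1 < r / 4"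
      unfolding has_sum_def by (rule tendstoD) (use r in auto)
    then obtain Q where Q: "finite Q" "Q \<subseteq> R_star R" "dist (sum f Q) 1 < r / 4"
      unfolding eventually_finite_subsets_at_top by blast
    \<comment> \<open>Each point of \<open>Q\<close> contributes up to \<open>2 * (2 / (n + 1))\<close> to the distance; half of \<open>r\<close> is left for these.\<close>
    obtain n where n: "8 * card Q / r < real n" using reals_Archimedean2 by blast
    have "\<exists>q\<in>\<rat>. \<bar>f b - q\<bar> < 1 / Suc n" for b
    proof -
      obtain q where "q \<in> \<rat>" "f b < q" "q < f b + 1 / Suc n"
        using Rats_dense_in_real[of "f b" "f b + 1 / Suc n"] by auto
      then show ?thesis by (intro bexI[of _ q]) auto
    qed
    then obtain q where q: "\<And>b. q b \<in> \<rat>" "\<And>b. \<bar>f b - q b\<bar> < 1 / Suc n" by metis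
    let ?W = "(\<lambda>b. (b, q b)) ` Q"
    have "V ?W n \<subseteq> mball f r"
    proof
      fix g assume g: "g \<in> V ?W n"
      have "simplex_dist R f g \<le> 2 - 2 * (\<Sum>b\<in>Q. f b) + 2 * card Q * (2 / Suc n)"
      proof (rule simplex_dist_le)
        fix b assume "b \<in> Q"
        then have "\<bar>g b - q b\<bar> < 1 / Suc n" using g by (auto simp: V_def)
        moreover have "2 / real (Suc n) = 1 / Suc n + 1 / Suc n" by simp
        ultimately show "f b - 2 / Suc n \<le> g b" using q(2)[of b] by linarith
      qed (use f g Q in \<open>auto simp: V_def\<close>)
      also have "\<dots> < r / 2 + r / 2"
      proof (rule add_strict_mono)
        show "2 - 2 * (\<Sum>b\<in>Q. f b) < r / 2" using Q(3) unfolding dist_real_def by linarith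
        have "8 * card Q < r * Suc n"
          using n r by (simp add: field_simps)
        then show "2 * card Q * (2 / Suc n) < r / 2" by (simp add: field_simps)
      qed
      finally show "g \<in> mball f r" using f g by (simp add: V_def)
    qed
    moreover have "?W \<in> \<W>" using Q q by (auto simp: \<W>_def)
    moreover have "f \<in> V ?W n" using f q by (auto simp: V_def)
    ultimately show ?thesis using r by blast
  qed
  then have "U = (\<Union>(W, n)\<in>{(W, n). W \<in> \<W> \<and> V W n \<subseteq> U}. V W n)"
    by (auto; blast)
  then have "F -` U \<inter> space M = (\<Union>(W, n)\<in>{(W, n). W \<in> \<W> \<and> V W n \<subseteq> U}. F -` V W n \<inter> space M)"
    by blast
  also have "\<dots> \<in> sets M"
  proof (rule sets.countable_UN'')
    have "countable (\<W> \<times> (UNIV :: nat set))" using countable_W by simp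
    then show "countable {(W, n). W \<in> \<W> \<and> V W n \<subseteq> U}"
      by (rule countable_subset[rotated]) auto
    fix Wn assume "Wn \<in> {(W, n). W \<in> \<W> \<and> V W n \<subseteq> U}"
    then obtain W n where W: "Wn = (W, n)" "finite W" "W \<subseteq> R_star R \<times> \<rat>"
      by (auto simp: \<W>_def)
    have "F -` V W n \<inter> space M = {x \<in> space M. \<forall>p\<in>W. \<bar>F x (fst p) - snd p\<bar> < 1 / Suc n}"
      using F by (auto simp: V_def)
    also have "\<dots> \<in> sets M"
    proof (rule sets.sets_Collect_finite_All)
      fix p assume "p \<in> W"
      then have [measurable]: "(\<lambda>x. F x (fst p)) \<in> borel_measurable M"
        using W by (intro meas) auto
      show "{x \<in> space M. \<bar>F x (fst p) - snd p\<bar> < 1 / Suc n} \<in> sets M"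
        by measurable
    qed (use W in auto)
    finally show "(case Wn of (W, n) \<Rightarrow> F -` V W n \<inter> space M) \<in> sets M"
      using W by simp
  qed
  finally show "F -` U \<inter> space M \<in> sets M" .
qed

end

text \<open>The law of an i.i.d. sequence with the point probabilities \<open>f\<close>.\<close>

definition iid_law :: "'a set \<Rightarrow> ('a \<Rightarrow> real) \<Rightarrow> (nat \<Rightarrow> 'a) measure" where
  "iid_law S f = (\<Pi>\<^sub>M i\<in>(UNIV :: nat set). point_measure S (\<lambda>b. ennreal (f b)))"

lemma sets_iid_law: "sets (iid_law S f) = sets (seq_space S)"
  unfolding iid_law_def seq_space_def by (rule sets_PiM_cong) (auto simp: sets_point_measure)

lemma
  assumes "\<And>b. b \<in> S \<Longrightarrow> 0 \<le> f b" "(f has_sum 1) S"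
  shows prob_space_point_measure_has_sum: "prob_space (point_measure S (\<lambda>b. ennreal (f b)))"
    and prob_space_iid_law: "prob_space (iid_law S f)"
proof -
  show 1: "prob_space (point_measure S (\<lambda>b. ennreal (f b)))"
  proof
    have "emeasure (point_measure S (\<lambda>b. ennreal (f b))) S = (\<integral>\<^sup>+b. ennreal (f b) \<partial>count_space S)"
      unfolding point_measure_def by (subst emeasure_density) (auto intro!: nn_integral_cong)
    also have "\<dots> = 1" using assms by (subst (asm) has_sum_iff_nn_integral_count_space) auto
    finally show "emeasure (point_measure S (\<lambda>b. ennreal (f b))) (space (point_measure S (\<lambda>b. ennreal (f b)))) = 1"
      by (simp add: space_point_measure)
  qed
  show "prob_space (iid_law S f)"
    unfolding iid_law_def by (rule prob_space_PiM) (rule 1)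
qed

lemma emeasure_iid_law_cyl:
  assumes "\<And>b. b \<in> S \<Longrightarrow> 0 \<le> f b" "(f has_sum 1) S" "bs \<in> lists S"
  shows "emeasure (iid_law S f) (cyl S bs) = ennreal (\<Prod>i<length bs. f (bs ! i))"
proof -
  have bs: "bs ! i \<in> S" if "i < length bs" for i
    using assms(3) that by auto
  let ?p = "point_measure S (\<lambda>b. ennreal (f b))"
  have "cyl S bs = prod_emb UNIV (\<lambda>_. ?p) {..<length bs} (\<Pi>\<^sub>E i\<in>{..<length bs}. {bs ! i})"
    by (auto simp: cyl_def prod_emb_def space_point_measure PiE_iff restrict_def extensional_def)
  then have "emeasure (iid_law S f) (cyl S bs) = (\<Prod>i<length bs. emeasure ?p {bs ! i})"
    unfolding iid_law_def using prob_space_point_measure_has_sum[OF assms(1,2)] bs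
    by (simp only:) (rule emeasure_PiM_emb, auto simp: sets_point_measure)
  also have "\<dots> = (\<Prod>i<length bs. ennreal (f (bs ! i)))"
  proof (rule prod.cong)
    fix i assume "i \<in> {..<length bs}"
    then have i: "bs ! i \<in> S" using bs by simp
    have "emeasure ?p {bs ! i} = (\<Sum>b | b \<in> {bs ! i} \<and> 0 < ennreal (f b). ennreal (f b))"
      using i by (intro emeasure_point_measure) auto
    also have "\<dots> = ennreal (f (bs ! i))"
      by (cases "0 < ennreal (f (bs ! i))") (auto simp: Collect_conv_if not_less ennreal_neg)
    finally show "emeasure ?p {bs ! i} = ennreal (f (bs ! i))" .
  qed simp
  also have "\<dots> = ennreal (\<Prod>i<length bs. f (bs ! i))"
    by (rule prod_ennreal) (use assms(1) bs in auto)
  finally show ?thesis .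
qed

lemma iid_law_kernel:
  assumes "countable (R_star R)"
  shows "iid_law (R_star R) \<in> simplex_space R \<rightarrow>\<^sub>M prob_algebra (seq_space (R_star R))"
proof (rule seq_space_kernelI[OF assms])
  fix f assume "f \<in> space (simplex_space R)"
  then show "prob_space (iid_law (R_star R) f)"
    by (intro prob_space_iid_law) (auto simp: space_simplex_space R_simplex_def)
  show "sets (iid_law (R_star R) f) = sets (seq_space (R_star R))"
    by (rule sets_iid_law)
next
  fix bs assume bs: "bs \<in> lists (R_star R)"
  have "(\<lambda>f. ennreal (\<Prod>i<length bs. f (bs ! i))) \<in> borel_measurable (simplex_space R)"
    using bs by (intro measurable_compose[OF _ measurable_ennreal] borel_measurable_prod
      measurable_simplex_coordinate) auto
  then show "(\<lambda>f. emeasure (iid_law (R_star R) f) (cyl (R_star R) bs)) \<in> borel_measurable (simplex_space R)"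
    by (rule measurable_cong[THEN iffD1, rotated])
      (use bs in \<open>auto simp: space_simplex_space R_simplex_def intro!: emeasure_iid_law_cyl[symmetric]\<close>)
qed

text \<open>De Finetti's theorem with a mixing measure on the Borel sets of the simplex.\<close>

lemma de_Finetti_simplex:
  assumes "exchangeable_law \<mu> (R_star R)"
  obtains \<phi> where "prob_space \<phi>" "sets \<phi> = sets (simplex_space R)"
    "\<And>A. A \<in> sets (seq_space (R_star R)) \<Longrightarrow>
       emeasure \<mu> A = (\<integral>\<^sup>+f. emeasure (iid_law (R_star R) f) A \<partial>\<phi>)"
proof -
  interpret exchangeable_law \<mu> "R_star R" by fact
  let ?S = "R_star R"
  have "\<exists>f0. f0 \<in> R_simplex R"
  proof -
    obtain y where y: "y \<in> space \<mu>" using not_empty by blast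
    define b0 where "b0 = y 0"
    have b0: "b0 \<in> ?S" using y by (auto simp: space_eq b0_def)
    have "((\<lambda>b. of_bool (b = b0)) has_sum (1 :: real)) ?S"
      using b0 by (intro has_sum_finite_neutralI[where B = "{b0}"]) auto
    then have "(restrict (\<lambda>b. of_bool (b = b0)) ?S has_sum (1 :: real)) ?S"
      by (subst has_sum_cong[where g = "\<lambda>b. of_bool (b = b0)"]) auto
    then have "restrict (\<lambda>b. of_bool (b = b0)) ?S \<in> R_simplex R"
      by (auto simp: R_simplex_def)
    then show ?thesis by blast
  qed
  then obtain f0 where f0: "f0 \<in> R_simplex R" by blast
  \<comment> \<open>On the null set where the limiting frequencies do not sum to \<open>1\<close>, \<open>F\<close> is an arbitrary point of the simplex.\<close>
  define good where "good y \<longleftrightarrow> (\<integral>\<^sup>+b. ennreal (limit_freq y b) \<partial>count_space ?S) = 1" for y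
  define F where "F y = (if good y then restrict (limit_freq y) ?S else f0)" for y
  have good_iff: "good y \<longleftrightarrow> (limit_freq y has_sum 1) ?S" for y
    unfolding good_def by (subst has_sum_iff_nn_integral_count_space) (auto simp: limit_freq_bounds)
  have [measurable]: "Measurable.pred \<mu> good"
    unfolding good_def[abs_def] using measurable_sum_limit_freq by measurable
  have F_simplex: "F y \<in> R_simplex R" for y
  proof (cases "good y")
    case True
    then have "(restrict (limit_freq y) ?S has_sum 1) ?S"
      unfolding good_iff by (subst has_sum_cong[where g = "limit_freq y"]) auto
    then show ?thesis using True by (auto simp: F_def R_simplex_def limit_freq_bounds)
  qed (simp add: F_def f0)
  have F_meas: "F \<in> \<mu> \<rightarrow>\<^sub>M simplex_space R"
  proof (rule measurable_to_simplex_space[OF countable_S F_simplex])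
    fix b assume "b \<in> ?S"
    then have "(\<lambda>y. F y b) = (\<lambda>y. if good y then limit_freq y b else f0 b)"
      by (auto simp: F_def)
    also have "\<dots> \<in> borel_measurable \<mu>" by measurable
    finally show "(\<lambda>y. F y b) \<in> borel_measurable \<mu>" .
  qed
  have AE_F: "AE y in \<mu>. \<forall>b\<in>?S. F y b = limit_freq y b"
    using AE_limit_freq_has_sum by eventually_elim (simp add: F_def good_iff)
  define \<phi> where "\<phi> = distr \<mu> (simplex_space R) F"
  note kernel = iid_law_kernel[OF countable_S]
  have \<phi>: "prob_space \<phi>" "sets \<phi> = sets (simplex_space R)"
    unfolding \<phi>_def using F_meas by (auto intro: prob_space_distr)
  have \<phi>_in: "\<phi> \<in> space (prob_algebra (simplex_space R))"
    using \<phi> by (simp add: space_prob_algebra)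
  have ne: "space \<phi> \<noteq> {}" using prob_space.not_empty[OF \<phi>(1)] .
  have kernel': "iid_law ?S \<in> \<phi> \<rightarrow>\<^sub>M subprob_algebra (seq_space ?S)"
    using measurable_prob_algebraD[OF kernel] by (simp add: measurable_cong_sets[OF \<phi>(2) refl])
  have eq: "\<mu> = \<phi> \<bind> iid_law ?S"
  proof (rule seq_space_measure_eqI[OF countable_S _ sets_eq])
    show "finite_measure \<mu>" by unfold_locales
    show "sets (\<phi> \<bind> iid_law ?S) = sets (seq_space ?S)"
      using kernel' ne by (intro sets_bind) (auto dest: sets_kernel)
    fix bs assume bs: "bs \<in> lists ?S"
    have bs': "bs ! i \<in> ?S" if "i < length bs" for i using bs that by auto
    have "emeasure (\<phi> \<bind> iid_law ?S) (cyl ?S bs) = (\<integral>\<^sup>+f. emeasure (iid_law ?S f) (cyl ?S bs) \<partial>\<phi>)"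
      by (rule emeasure_bind[OF ne kernel' cyl_in_sets])
    also have "\<dots> = (\<integral>\<^sup>+y. emeasure (iid_law ?S (F y)) (cyl ?S bs) \<partial>\<mu>)"
      unfolding \<phi>_def
      by (rule nn_integral_distr[OF F_meas])
        (use measurable_emeasure_kernel[OF measurable_prob_algebraD[OF kernel] cyl_in_sets] in simp)
    also have "\<dots> = (\<integral>\<^sup>+y. ennreal (\<Prod>i<length bs. limit_freq y (bs ! i)) \<partial>\<mu>)"
    proof (rule nn_integral_cong_AE)
      show "AE y in \<mu>. emeasure (iid_law ?S (F y)) (cyl ?S bs) = ennreal (\<Prod>i<length bs. limit_freq y (bs ! i))"
        using AE_F
      proof eventually_elim
        case (elim y)
        have "emeasure (iid_law ?S (F y)) (cyl ?S bs) = ennreal (\<Prod>i<length bs. F y (bs ! i))"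
          using F_simplex[of y] bs by (intro emeasure_iid_law_cyl) (auto simp: R_simplex_def)
        also have "(\<Prod>i<length bs. F y (bs ! i)) = (\<Prod>i<length bs. limit_freq y (bs ! i))"
          using elim bs' by (intro prod.cong) auto
        finally show ?case .
      qed
    qed
    also have "\<dots> = ennreal (measure \<mu> (cyl ?S bs))"
      unfolding measure_cyl
      by (rule nn_integral_eq_integral)
        (auto intro!: integrable_bounded[of _ 1] prod_nonneg prod_le_1 simp: limit_freq_bounds abs_prod)
    finally show "emeasure \<mu> (cyl ?S bs) = emeasure (\<phi> \<bind> iid_law ?S) (cyl ?S bs)"
      by (simp add: emeasure_eq_measure)
  qed
  have "emeasure \<mu> A = (\<integral>\<^sup>+f. emeasure (iid_law ?S f) A \<partial>\<phi>)" if "A \<in> sets (seq_space ?S)" for A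
    by (subst eq) (rule emeasure_bind[OF ne kernel' that])
  then show ?thesis using that \<phi> by blast
qed

section \<open>Classes of sequences and their relabelings\<close>

text \<open>
  On the index set \<open>I\<close> the sequence \<open>y\<close> is carried to \<open>x\<close> by the map \<open>\<rho>\<close>, which is injective on the
  labels of \<open>y\<close>. Surjectivity onto the labels of \<open>x\<close> is automatic, so this is the equivalence of
  sequences without the condition that the entries belong to \<open>Fin \<alpha>\<close>.
\<close>

definition relabels :: "nat set \<Rightarrow> (int \<Rightarrow> int) \<Rightarrow> (nat \<Rightarrow> int rstruct) \<Rightarrow> (nat \<Rightarrow> int rstruct) \<Rightarrow> bool" where
  "relabels I \<rho> y x \<longleftrightarrow> inj_on \<rho> (\<Union>i\<in>I. domain (y i)) \<and> (\<forall>i\<in>I. map_struct \<rho> (y i) = x i)"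

lemma relabels_reindex:
  assumes "relabels I \<rho> y x" "g ` J \<subseteq> I"
  shows "relabels J \<rho> (y \<circ> g) (x \<circ> g)"
proof -
  have "(\<Union>j\<in>J. domain (y (g j))) \<subseteq> (\<Union>i\<in>I. domain (y i))" using assms(2) by blast
  then show ?thesis using assms by (auto simp: relabels_def intro: inj_on_subset)
qed

lemma relabels_subset: "relabels I \<rho> y x \<Longrightarrow> J \<subseteq> I \<Longrightarrow> relabels J \<rho> y x"
  using relabels_reindex[of I \<rho> y x id J] by simp

lemma relabels_refl: "relabels I id x x"
  by (simp add: relabels_def map_struct_id id_def)

lemma seq_equiv_iff_relabels:
  assumes "x \<in> I \<rightarrow>\<^sub>E Fin \<alpha>" "y \<in> I \<rightarrow>\<^sub>E Fin \<alpha>"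
  shows "(x, y) \<in> seq_equiv \<alpha> I \<longleftrightarrow> (\<exists>\<rho>. relabels I \<rho> y x)"
proof
  assume "(x, y) \<in> seq_equiv \<alpha> I"
  then show "\<exists>\<rho>. relabels I \<rho> y x"
    by (auto simp: seq_equiv_def relabels_def bij_betw_def)
next
  assume "\<exists>\<rho>. relabels I \<rho> y x"
  then obtain \<rho> where \<rho>: "relabels I \<rho> y x" by blast
  then have "\<forall>i\<in>I. \<rho> ` domain (y i) = domain (x i)"
    unfolding relabels_def by (metis domain_map_struct)
  then have "bij_betw \<rho> (\<Union>i\<in>I. domain (y i)) (\<Union>i\<in>I. domain (x i))"
    using \<rho> by (auto simp: relabels_def bij_betw_def image_UN)
  then show "(x, y) \<in> seq_equiv \<alpha> I"
    using assms \<rho> by (auto simp: seq_equiv_def relabels_def)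
qed

lemma seq_class_eq_iff:
  assumes "x \<in> I \<rightarrow>\<^sub>E Fin \<alpha>" "y \<in> I \<rightarrow>\<^sub>E Fin \<alpha>"
  shows "seq_class \<alpha> I x = seq_class \<alpha> I y \<longleftrightarrow> (\<exists>\<rho>. relabels I \<rho> y x)"
  unfolding seq_class_def seq_equiv_iff_relabels[OF assms, symmetric]
  by (rule eq_equiv_class_iff[OF equiv_seq_equiv assms])

lemma restr_eq_iff:
  assumes "range x \<subseteq> Fin \<alpha>" "range y \<subseteq> Fin \<alpha>"
  shows "restr \<alpha> n (seq_class \<alpha> UNIV x) = restr \<alpha> n (seq_class \<alpha> UNIV y)
    \<longleftrightarrow> (\<exists>\<rho>. relabels {..<n} \<rho> y x)"
proof -
  have *: "x \<in> UNIV \<rightarrow>\<^sub>E Fin \<alpha>" "y \<in> UNIV \<rightarrow>\<^sub>E Fin \<alpha>" using assms by auto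
  then have "restrict x {..<n} \<in> {..<n} \<rightarrow>\<^sub>E Fin \<alpha>" "restrict y {..<n} \<in> {..<n} \<rightarrow>\<^sub>E Fin \<alpha>"
    by auto
  then show ?thesis
    unfolding restr_seq_class[OF *(1)] restr_seq_class[OF *(2)]
    by (subst seq_class_eq_iff) (auto simp: relabels_def)
qed

lemma seq_class_UNIV_eq_iff:
  assumes "range x \<subseteq> Fin \<alpha>" "range y \<subseteq> Fin \<alpha>"
  shows "seq_class \<alpha> UNIV x = seq_class \<alpha> UNIV y \<longleftrightarrow> (\<exists>\<rho>. relabels UNIV \<rho> y x)"
  using assms by (intro seq_class_eq_iff) auto

text \<open>
  A representative of a class, chosen arbitrarily. The choice need not be measurable: only functions
  of it that depend on the class alone are used.
\<close>

definition rep :: "(nat \<Rightarrow> int rstruct) set \<Rightarrow> nat \<Rightarrow> int rstruct" where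
  "rep c = (SOME x. x \<in> c)"

lemma seq_class_in_classes: "range x \<subseteq> Fin \<alpha> \<Longrightarrow> seq_class \<alpha> UNIV x \<in> seq_classes \<alpha> UNIV"
  unfolding seq_classes_def seq_class_def by (rule quotientI) auto

lemma
  assumes "c \<in> seq_classes \<alpha> UNIV"
  shows range_rep: "range (rep c) \<subseteq> Fin \<alpha>" and seq_class_rep: "seq_class \<alpha> UNIV (rep c) = c"
proof -
  obtain x where x: "x \<in> UNIV \<rightarrow>\<^sub>E Fin \<alpha>" "c = seq_class \<alpha> UNIV x"
    using assms unfolding seq_classes_def seq_class_def by (rule quotientE)
  then have "x \<in> c"
    using equiv_class_self[OF equiv_seq_equiv] by (simp add: seq_class_def)
  then have "rep c \<in> c" unfolding rep_def by (rule someI[of "\<lambda>x. x \<in> c"])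
  then have eq: "(x, rep c) \<in> seq_equiv \<alpha> UNIV" using x by (simp add: seq_class_def)
  then have "rep c \<in> UNIV \<rightarrow>\<^sub>E Fin \<alpha>" unfolding seq_equiv_def by blast
  then show "range (rep c) \<subseteq> Fin \<alpha>" by auto
  show "seq_class \<alpha> UNIV (rep c) = c"
    using seq_class_eqI[OF eq] x(2) by metis
qed

lemma rep_seq_class:
  assumes "range x \<subseteq> Fin \<alpha>"
  obtains \<rho> where "relabels UNIV \<rho> (rep (seq_class \<alpha> UNIV x)) x"
proof -
  have c: "seq_class \<alpha> UNIV x \<in> seq_classes \<alpha> UNIV" by (rule seq_class_in_classes[OF assms])
  then have "\<exists>\<rho>. relabels UNIV \<rho> (rep (seq_class \<alpha> UNIV x)) x"
    using seq_class_rep[OF c] by (subst seq_class_UNIV_eq_iff[symmetric, OF assms range_rep[OF c]]) simp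
  then show ?thesis using that by blast
qed

lemma range_comp_Fin: "range x \<subseteq> Fin \<alpha> \<Longrightarrow> range (x \<circ> g) \<subseteq> Fin \<alpha>"
  by auto

text \<open>The sets of classes that generate the \<open>\<sigma>\<close>-field.\<close>

definition class_generator :: "(nat \<Rightarrow> nat) \<Rightarrow> (nat \<Rightarrow> int rstruct) set set set" where
  "class_generator \<alpha> = {restr \<alpha> n -` B \<inter> seq_classes \<alpha> UNIV | n B. 1 \<le> n \<and> B \<subseteq> seq_classes \<alpha> {..<n}}"

lemma class_generator_subset: "class_generator \<alpha> \<subseteq> Pow (seq_classes \<alpha> UNIV)"
  by (auto simp: class_generator_def)

lemma space_class_space: "space (class_space \<alpha>) = seq_classes \<alpha> UNIV"
  unfolding class_space_def class_generator_def[symmetric] by (rule space_measure_of) (rule class_generator_subset)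

lemma sets_class_space: "sets (class_space \<alpha>) = sigma_sets (seq_classes \<alpha> UNIV) (class_generator \<alpha>)"
  unfolding class_space_def class_generator_def[symmetric] by (rule sets_measure_of) (rule class_generator_subset)

lemma restr_in_classes:
  assumes "c \<in> seq_classes \<alpha> UNIV"
  shows "restr \<alpha> n c \<in> seq_classes \<alpha> {..<n}"
proof -
  have "rep c \<in> UNIV \<rightarrow>\<^sub>E Fin \<alpha>" using range_rep[OF assms] by auto
  then have "restr \<alpha> n c = seq_class \<alpha> {..<n} (restrict (rep c) {..<n})"
    using restr_seq_class[of "rep c" \<alpha> n] seq_class_rep[OF assms] by simp
  moreover have "restrict (rep c) {..<n} \<in> {..<n} \<rightarrow>\<^sub>E Fin \<alpha>"
    using range_rep[OF assms] by auto
  ultimately show ?thesis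
    unfolding seq_classes_def seq_class_def by (simp add: quotientI)
qed

text \<open>
  Functions of a sequence that depend only on the equivalence class of its first \<open>n\<close> entries. The
  generating events are exactly those described by finitary predicates of the representative.
\<close>

definition finitary :: "(nat \<Rightarrow> nat) \<Rightarrow> nat \<Rightarrow> ((nat \<Rightarrow> int rstruct) \<Rightarrow> 'b) \<Rightarrow> bool" where
  "finitary \<alpha> n h \<longleftrightarrow> (\<forall>x y \<rho>. range x \<subseteq> Fin \<alpha> \<longrightarrow> range y \<subseteq> Fin \<alpha> \<longrightarrow> relabels {..<n} \<rho> y x \<longrightarrow> h x = h y)"

lemma finitaryD:
  "finitary \<alpha> n h \<Longrightarrow> range x \<subseteq> Fin \<alpha> \<Longrightarrow> range y \<subseteq> Fin \<alpha> \<Longrightarrow> relabels {..<n} \<rho> y x \<Longrightarrow> h x = h y"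
  unfolding finitary_def by metis

lemma finitaryI:
  "(\<And>x y \<rho>. range x \<subseteq> Fin \<alpha> \<Longrightarrow> range y \<subseteq> Fin \<alpha> \<Longrightarrow> relabels {..<n} \<rho> y x \<Longrightarrow> h x = h y) \<Longrightarrow> finitary \<alpha> n h"
  by (simp add: finitary_def)

lemma finitary_generator:
  assumes "finitary \<alpha> n P"
  shows "{c \<in> seq_classes \<alpha> UNIV. P (rep c)} \<in> class_generator \<alpha>"
proof -
  let ?A = "{c \<in> seq_classes \<alpha> UNIV. P (rep c)}"
  \<comment> \<open>One more entry than necessary, because a generator restricts to at least one entry.\<close>
  have "?A = restr \<alpha> (Suc n) -` (restr \<alpha> (Suc n) ` ?A) \<inter> seq_classes \<alpha> UNIV"
  proof (intro equalityI subsetI)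
    fix c assume "c \<in> restr \<alpha> (Suc n) -` (restr \<alpha> (Suc n) ` ?A) \<inter> seq_classes \<alpha> UNIV"
    then obtain c' where c': "c' \<in> ?A" "restr \<alpha> (Suc n) c = restr \<alpha> (Suc n) c'"
      and c: "c \<in> seq_classes \<alpha> UNIV" by auto
    then have *: "c' \<in> seq_classes \<alpha> UNIV" by simp
    have "restr \<alpha> (Suc n) (seq_class \<alpha> UNIV (rep c)) = restr \<alpha> (Suc n) (seq_class \<alpha> UNIV (rep c'))"
      using c'(2) seq_class_rep[OF c] seq_class_rep[OF *] by simp
    then obtain \<rho> where "relabels {..<Suc n} \<rho> (rep c') (rep c)"
      unfolding restr_eq_iff[OF range_rep[OF c] range_rep[OF *]] by blast
    then have "relabels {..<n} \<rho> (rep c') (rep c)" by (rule relabels_subset) auto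
    then have "P (rep c) = P (rep c')"
      by (rule finitaryD[OF assms range_rep[OF c] range_rep[OF *]])
    then show "c \<in> ?A" using c c' by simp
  qed auto
  moreover have "restr \<alpha> (Suc n) ` ?A \<subseteq> seq_classes \<alpha> {..<Suc n}"
    by (rule image_subsetI) (simp add: restr_in_classes)
  moreover have "1 \<le> Suc n" by simp
  ultimately show ?thesis unfolding class_generator_def by (intro CollectI exI conjI)
qed

lemma finitary_in_sets_class_space:
  "finitary \<alpha> n P \<Longrightarrow> {c \<in> seq_classes \<alpha> UNIV. P (rep c)} \<in> sets (class_space \<alpha>)"
  unfolding sets_class_space by (rule sigma_sets.Basic) (rule finitary_generator)

lemma finitary_comp: "finitary \<alpha> n h \<Longrightarrow> finitary \<alpha> n (\<lambda>x. f (h x))"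
  unfolding finitary_def by metis

lemma finitary_measurable:
  assumes "finitary \<alpha> n h" "\<And>x. range x \<subseteq> Fin \<alpha> \<Longrightarrow> h x \<in> space N"
  shows "(\<lambda>c. h (rep c)) \<in> class_space \<alpha> \<rightarrow>\<^sub>M N"
proof (rule measurableI)
  show "h (rep c) \<in> space N" if "c \<in> space (class_space \<alpha>)" for c
    using that assms(2) range_rep by (simp add: space_class_space)
  show "(\<lambda>c. h (rep c)) -` A \<inter> space (class_space \<alpha>) \<in> sets (class_space \<alpha>)" for A
    using finitary_in_sets_class_space[OF finitary_comp[OF assms(1), of "\<lambda>v. v \<in> A"]]
    by (simp add: space_class_space vimage_def Int_def conj_commute)
qed

lemma generator_finitary:
  assumes "A \<in> class_generator \<alpha>"
  obtains n P where "finitary \<alpha> n P" "A = {c \<in> seq_classes \<alpha> UNIV. P (rep c)}"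
proof -
  obtain n B where A: "A = restr \<alpha> n -` B \<inter> seq_classes \<alpha> UNIV" using assms unfolding class_generator_def by blast
  let ?P = "\<lambda>x. restr \<alpha> n (seq_class \<alpha> UNIV x) \<in> B"
  have "A = {c \<in> seq_classes \<alpha> UNIV. ?P (rep c)}" using A seq_class_rep by auto
  moreover have "finitary \<alpha> n ?P"
    unfolding finitary_def using restr_eq_iff by metis
  ultimately show ?thesis using that by blast
qed

lemma finitary_mono: "finitary \<alpha> m h \<Longrightarrow> m \<le> n \<Longrightarrow> finitary \<alpha> n h"
  unfolding finitary_def by (meson lessThan_subset_iff relabels_subset)

lemma finitary_comp2: "finitary \<alpha> n h \<Longrightarrow> finitary \<alpha> n k \<Longrightarrow> finitary \<alpha> n (\<lambda>x. f (h x) (k x))"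
  unfolding finitary_def by metis

lemma class_space_measure_eqI:
  assumes "finite_measure \<mu>" "sets \<mu> = sets (class_space \<alpha>)" "sets \<nu> = sets (class_space \<alpha>)"
    and eq: "\<And>n P. finitary \<alpha> n P \<Longrightarrow> emeasure \<mu> {c \<in> seq_classes \<alpha> UNIV. P (rep c)}
                = emeasure \<nu> {c \<in> seq_classes \<alpha> UNIV. P (rep c)}"
  shows "\<mu> = \<nu>"
proof -
  interpret finite_measure \<mu> by fact
  have stable: "Int_stable (class_generator \<alpha>)"
  proof (rule Int_stableI)
    fix A B assume A: "A \<in> class_generator \<alpha>" and B: "B \<in> class_generator \<alpha>"
    obtain n P where P: "finitary \<alpha> n P" "A = {c \<in> seq_classes \<alpha> UNIV. P (rep c)}"
      using A by (rule generator_finitary)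
    obtain m Q where Q: "finitary \<alpha> m Q" "B = {c \<in> seq_classes \<alpha> UNIV. Q (rep c)}"
      using B by (rule generator_finitary)
    have "finitary \<alpha> (max n m) (\<lambda>x. P x \<and> Q x)"
      by (rule finitary_comp2[OF finitary_mono[OF P(1)] finitary_mono[OF Q(1)]]) simp_all
    then have "{c \<in> seq_classes \<alpha> UNIV. P (rep c) \<and> Q (rep c)} \<in> class_generator \<alpha>"
      by (rule finitary_generator)
    also have "{c \<in> seq_classes \<alpha> UNIV. P (rep c) \<and> Q (rep c)} = A \<inter> B"
      unfolding P(2) Q(2) by blast
    finally show "A \<inter> B \<in> class_generator \<alpha>" .
  qed
  have eq': "emeasure \<mu> A = emeasure \<nu> A" if A: "A \<in> class_generator \<alpha>" for A
  proof -
    obtain n P where "finitary \<alpha> n P" "A = {c \<in> seq_classes \<alpha> UNIV. P (rep c)}"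
      using A by (rule generator_finitary)
    then show ?thesis using eq by simp
  qed
  have "{c \<in> seq_classes \<alpha> UNIV. True} \<in> class_generator \<alpha>"
    by (rule finitary_generator[of \<alpha> 0]) (simp add: finitary_def)
  then have top: "range (\<lambda>_ :: nat. seq_classes \<alpha> UNIV) \<subseteq> class_generator \<alpha>"
    by auto
  show ?thesis
  proof (rule measure_eqI_generator_eq[OF stable class_generator_subset eq'])
    show "emeasure \<mu> (seq_classes \<alpha> UNIV) \<noteq> \<infinity>" by simp
  qed (use assms(2,3) sets_class_space top in simp_all)
qed

text \<open>The class of \<open>x \<circ> g\<close>, for a map \<open>g\<close> that need not be a bijection.\<close>

definition reindex :: "(nat \<Rightarrow> nat) \<Rightarrow> (nat \<Rightarrow> nat) \<Rightarrow> (nat \<Rightarrow> int rstruct) set \<Rightarrow> (nat \<Rightarrow> int rstruct) set" where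
  "reindex \<alpha> g c = seq_class \<alpha> UNIV (rep c \<circ> g)"

lemma permute_eq_reindex:
  assumes "c \<in> seq_classes \<alpha> UNIV" "bij \<sigma>"
  shows "permute \<alpha> \<sigma> c = reindex \<alpha> \<sigma> c"
proof -
  have "rep c \<in> UNIV \<rightarrow>\<^sub>E Fin \<alpha>" using range_rep[OF assms(1)] by auto
  then show ?thesis
    using permute_seq_class[of "rep c" \<alpha> \<sigma>] seq_class_rep[OF assms(1)] assms(2) by (simp add: reindex_def)
qed

lemma reindex_in_classes: "c \<in> seq_classes \<alpha> UNIV \<Longrightarrow> reindex \<alpha> g c \<in> seq_classes \<alpha> UNIV"
  unfolding reindex_def by (intro seq_class_in_classes range_comp_Fin range_rep)

lemma finitary_reindex:
  assumes "finitary \<alpha> n h"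
  obtains m where "finitary \<alpha> m (\<lambda>x. h (x \<circ> g))"
proof
  define m where "m = Suc (Max (insert 0 (g ` {..<n})))"
  have "g ` {..<n} \<subseteq> {..<m}"
    unfolding m_def by (auto simp: less_Suc_eq_le intro!: Max_ge)
  then show "finitary \<alpha> m (\<lambda>x. h (x \<circ> g))"
  proof (intro finitaryI)
    fix x y \<rho> assume *: "range x \<subseteq> Fin \<alpha>" "range y \<subseteq> Fin \<alpha>" "relabels {..<m} \<rho> y x"
    have "relabels {..<n} \<rho> (y \<circ> g) (x \<circ> g)"
      by (rule relabels_reindex) fact+
    then show "h (x \<circ> g) = h (y \<circ> g)"
      by (rule finitaryD[OF assms range_comp_Fin[OF *(1)] range_comp_Fin[OF *(2)]])
  qed
qed

text \<open>Functions of a sequence that depend only on its equivalence class.\<close>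

definition class_invariant :: "(nat \<Rightarrow> nat) \<Rightarrow> ((nat \<Rightarrow> int rstruct) \<Rightarrow> 'b) \<Rightarrow> bool" where
  "class_invariant \<alpha> h \<longleftrightarrow> (\<forall>x y \<rho>. range x \<subseteq> Fin \<alpha> \<longrightarrow> range y \<subseteq> Fin \<alpha> \<longrightarrow> relabels UNIV \<rho> y x \<longrightarrow> h x = h y)"

lemma class_invariantD:
  "class_invariant \<alpha> h \<Longrightarrow> range x \<subseteq> Fin \<alpha> \<Longrightarrow> range y \<subseteq> Fin \<alpha> \<Longrightarrow> relabels UNIV \<rho> y x \<Longrightarrow> h x = h y"
  unfolding class_invariant_def by metis

lemma finitary_imp_class_invariant: "finitary \<alpha> n h \<Longrightarrow> class_invariant \<alpha> h"
  unfolding class_invariant_def by (intro allI impI) (erule (2) finitaryD, erule relabels_subset, simp)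

lemma class_invariant_rep:
  assumes "class_invariant \<alpha> h" "range x \<subseteq> Fin \<alpha>"
  shows "h (rep (seq_class \<alpha> UNIV x)) = h x"
proof -
  obtain \<rho> where "relabels UNIV \<rho> (rep (seq_class \<alpha> UNIV x)) x" using rep_seq_class[OF assms(2)] .
  then show ?thesis
    using class_invariantD[OF assms range_rep[OF seq_class_in_classes[OF assms(2)]]] by simp
qed

lemma class_invariant_reindex:
  assumes "class_invariant \<alpha> h" "c \<in> seq_classes \<alpha> UNIV"
  shows "h (rep (reindex \<alpha> g c)) = h (rep c \<circ> g)"
  unfolding reindex_def using assms by (intro class_invariant_rep range_comp_Fin range_rep)

lemma measurable_reindex_class: "reindex \<alpha> g \<in> class_space \<alpha> \<rightarrow>\<^sub>M class_space \<alpha>"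
proof (rule measurable_sigma_sets[OF sets_class_space])
  fix A assume "A \<in> class_generator \<alpha>"
  then obtain n P where P: "finitary \<alpha> n P" "A = {c \<in> seq_classes \<alpha> UNIV. P (rep c)}"
    by (rule generator_finitary)
  obtain m where m: "finitary \<alpha> m (\<lambda>x. P (x \<circ> g))" using finitary_reindex[OF P(1)] .
  have "reindex \<alpha> g -` A \<inter> space (class_space \<alpha>) = {c \<in> seq_classes \<alpha> UNIV. P (rep c \<circ> g)}"
    using P finitary_imp_class_invariant[OF P(1)]
    by (auto simp: space_class_space reindex_in_classes class_invariant_reindex)
  then show "reindex \<alpha> g -` A \<inter> space (class_space \<alpha>) \<in> sets (class_space \<alpha>)"
    using finitary_in_sets_class_space[OF m] by simp
qed (use class_generator_subset in \<open>auto simp: space_class_space reindex_in_classes\<close>)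

lemma extend_to_bij:
  fixes g :: "nat \<Rightarrow> nat"
  assumes "inj g"
  obtains \<sigma> where "bij \<sigma>" "\<And>i. i < n \<Longrightarrow> \<sigma> i = g i"
proof -
  let ?K = "{..<n} \<union> g ` {..<n}"
  have inj: "inj_on g {..<n}" using assms by (rule inj_on_subset) simp
  have "card (?K - {..<n}) = card (?K - g ` {..<n})"
    using inj by (subst (1 2) card_Diff_subset) (auto simp: card_image)
  then obtain h where h: "bij_betw h (?K - {..<n}) (?K - g ` {..<n})"
    by (metis finite_Diff finite_UnI finite_imageI finite_lessThan finite_same_card_bij)
  define \<sigma> where "\<sigma> i = (if i < n then g i else if i \<in> ?K then h i else i)" for i
  have "bij_betw \<sigma> {..<n} (g ` {..<n})"
    using inj by (subst bij_betw_cong[of _ _ g]) (auto simp: \<sigma>_def bij_betw_def)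
  moreover have "bij_betw \<sigma> (?K - {..<n}) (?K - g ` {..<n})"
    using h by (subst bij_betw_cong[of _ _ h]) (auto simp: \<sigma>_def)
  ultimately have "bij_betw \<sigma> ({..<n} \<union> (?K - {..<n})) (g ` {..<n} \<union> (?K - g ` {..<n}))"
    by (rule bij_betw_combine) auto
  moreover have "bij_betw \<sigma> (- ?K) (- ?K)"
    by (subst bij_betw_cong[of _ _ id]) (auto simp: \<sigma>_def)
  ultimately have "bij_betw \<sigma> (({..<n} \<union> (?K - {..<n})) \<union> - ?K) ((g ` {..<n} \<union> (?K - g ` {..<n})) \<union> - ?K)"
    by (rule bij_betw_combine) auto
  moreover have "({..<n} \<union> (?K - {..<n})) \<union> - ?K = UNIV" "(g ` {..<n} \<union> (?K - g ` {..<n})) \<union> - ?K = UNIV"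
    by auto
  ultimately have "bij \<sigma>" by simp
  then show ?thesis using that by (auto simp: \<sigma>_def)
qed

text \<open>The law of a relationally exchangeable random structure.\<close>

locale exchangeable_class_law = prob_space L for L :: "(nat \<Rightarrow> int rstruct) set measure" +
  fixes \<alpha> :: "nat \<Rightarrow> nat"
  assumes sets_L: "sets L = sets (class_space \<alpha>)"
    and exch_L: "\<And>\<sigma>. bij \<sigma> \<Longrightarrow> distr L (class_space \<alpha>) (reindex \<alpha> \<sigma>) = L"
begin

lemma space_L: "space L = seq_classes \<alpha> UNIV"
  using sets_eq_imp_space_eq[OF sets_L] by (simp add: space_class_space)

lemma measurable_reindex_L: "reindex \<alpha> g \<in> L \<rightarrow>\<^sub>M class_space \<alpha>"
  using measurable_reindex_class by (simp add: measurable_cong_sets[OF sets_L refl])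

text \<open>
  Invariance extends from permutations to injections, because every finite part of an injection is
  also part of a permutation.
\<close>

lemma distr_reindex:
  assumes "inj g"
  shows "distr L (class_space \<alpha>) (reindex \<alpha> g) = L"
proof (rule class_space_measure_eqI)
  show "finite_measure (distr L (class_space \<alpha>) (reindex \<alpha> g))"
    using prob_space_distr[OF measurable_reindex_L] by (rule prob_space.finite_measure)
  fix n and P :: "(nat \<Rightarrow> int rstruct) \<Rightarrow> bool" assume P: "finitary \<alpha> n P"
  let ?A = "{c \<in> seq_classes \<alpha> UNIV. P (rep c)}"
  obtain \<sigma> where \<sigma>: "bij \<sigma>" "\<And>i. i < n \<Longrightarrow> \<sigma> i = g i" using extend_to_bij[OF assms] by blast
  note inv = finitary_imp_class_invariant[OF P]
  have *: "P (rep c \<circ> g) = P (rep c \<circ> \<sigma>)" if "c \<in> seq_classes \<alpha> UNIV" for c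
  proof -
    have "relabels {..<n} id (rep c \<circ> \<sigma>) (rep c \<circ> g)"
      using \<sigma> by (simp add: relabels_def map_struct_id id_def)
    then show ?thesis
      by (rule finitaryD[OF P range_comp_Fin[OF range_rep[OF that]] range_comp_Fin[OF range_rep[OF that]]])
  qed
  have "reindex \<alpha> g -` ?A \<inter> space L = reindex \<alpha> \<sigma> -` ?A \<inter> space L"
    using * inv by (auto simp: space_L reindex_in_classes class_invariant_reindex)
  then have "emeasure (distr L (class_space \<alpha>) (reindex \<alpha> g)) ?A
      = emeasure (distr L (class_space \<alpha>) (reindex \<alpha> \<sigma>)) ?A"
    using finitary_in_sets_class_space[OF P] by (simp add: emeasure_distr measurable_reindex_L)
  then show "emeasure (distr L (class_space \<alpha>) (reindex \<alpha> g)) ?A = emeasure L ?A"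
    using exch_L[OF \<sigma>(1)] by simp
qed (simp_all add: sets_L)

end

section \<open>Labels shared by odd entries\<close>

lemma relabels_domain:
  assumes "relabels I \<rho> y x" "i \<in> I"
  shows "domain (x i) = \<rho> ` domain (y i)"
  using assms unfolding relabels_def by (metis domain_map_struct)

lemma relabels_mem_iff:
  assumes "relabels I \<rho> y x" "i \<in> I" "a \<in> (\<Union>i\<in>I. domain (y i))"
  shows "\<rho> a \<in> domain (x i) \<longleftrightarrow> a \<in> domain (y i)"
proof -
  have "domain (y i) \<subseteq> (\<Union>i\<in>I. domain (y i))" using assms(2) by blast
  moreover have "inj_on \<rho> (\<Union>i\<in>I. domain (y i))" using assms(1) by (simp add: relabels_def)
  ultimately show ?thesis
    unfolding relabels_domain[OF assms(1,2)] using assms(3) by (intro inj_on_image_mem_iff)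
qed

text \<open>Entries \<open>j\<close> and \<open>k\<close> share a label that occurs in no entry with index in \<open>J\<close>.\<close>

definition common_outside :: "nat \<Rightarrow> nat \<Rightarrow> nat set \<Rightarrow> (nat \<Rightarrow> int rstruct) \<Rightarrow> bool" where
  "common_outside j k J x \<longleftrightarrow> (\<exists>a\<in>domain (x j) \<inter> domain (x k). \<forall>i\<in>J. a \<notin> domain (x i))"

lemma common_outside_relabels:
  assumes "relabels I \<rho> y x" "j \<in> I" "k \<in> I" "J \<subseteq> I"
  shows "common_outside j k J x \<longleftrightarrow> common_outside j k J y"
proof -
  have m: "\<rho> a \<in> domain (x i) \<longleftrightarrow> a \<in> domain (y i)" if "a \<in> domain (y j)" "i \<in> I" for a i
    using relabels_mem_iff[OF assms(1) that(2)] that(1) assms(2) by blast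
  have "common_outside j k J x \<longleftrightarrow> (\<exists>a\<in>domain (y j). \<rho> a \<in> domain (x k) \<and> (\<forall>i\<in>J. \<rho> a \<notin> domain (x i)))"
    unfolding common_outside_def relabels_domain[OF assms(1,2)] by blast
  also have "\<dots> \<longleftrightarrow> (\<exists>a\<in>domain (y j). a \<in> domain (y k) \<and> (\<forall>i\<in>J. a \<notin> domain (y i)))"
    using m assms(3,4) by (intro bex_cong refl conj_cong ball_cong) (auto simp: subset_iff)
  finally show ?thesis by (auto simp: common_outside_def)
qed

lemma finitary_common_outside:
  assumes "j < n" "k < n" "J \<subseteq> {..<n}"
  shows "finitary \<alpha> n (common_outside j k J)"
  by (rule finitaryI, erule common_outside_relabels) (use assms in auto)

lemma common_outside_comp: "common_outside j k J (x \<circ> g) = common_outside (g j) (g k) (g ` J) x"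
  by (auto simp: common_outside_def)

text \<open>
  The event for \<open>m\<close> says that some label of entry \<open>0\<close> has its next occurrence in entry \<open>m + 1\<close>;
  different \<open>m\<close> require different labels.
\<close>

lemma finite_next_occurrences:
  assumes "finite (domain (x 0))"
  shows "finite {m. common_outside 0 (Suc m) {1..m} x}"
proof -
  have "\<forall>m\<in>{m. common_outside 0 (Suc m) {1..m} x}. \<exists>a. a \<in> domain (x 0) \<and> a \<in> domain (x (Suc m)) \<and>
    (\<forall>i\<in>{1..m}. a \<notin> domain (x i))"
    unfolding common_outside_def by blast
  then obtain f where f: "\<forall>m\<in>{m. common_outside 0 (Suc m) {1..m} x}.
     f m \<in> domain (x 0) \<and> f m \<in> domain (x (Suc m)) \<and> (\<forall>i\<in>{1..m}. f m \<notin> domain (x i))"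
    using bchoice by metis
  have "inj_on f {m. common_outside 0 (Suc m) {1..m} x}"
  proof (rule inj_onI)
    have less: False if "f m = f m'" "m < m'" "common_outside 0 (Suc m) {1..m} x"
      "common_outside 0 (Suc m') {1..m'} x" for m m'
    proof -
      have "Suc m \<in> {1..m'}" using that by auto
      then have "f m' \<notin> domain (x (Suc m))" using bspec[OF f, of m'] that(4) by blast
      moreover have "f m \<in> domain (x (Suc m))" using bspec[OF f, of m] that(3) by blast
      ultimately show False using that(1) by simp
    qed
    fix m m' assume "m \<in> {m. common_outside 0 (Suc m) {1..m} x}"
      "m' \<in> {m. common_outside 0 (Suc m) {1..m} x}" "f m = f m'"
    then show "m = m'" using less[of m m'] less[of m' m] by (cases m m' rule: linorder_cases) auto
  qed
  then show ?thesis by (rule inj_on_finite) (use f assms in auto)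
qed

context exchangeable_class_law
begin

lemma prob_common_outside_reindex:
  assumes "inj g" "finite J"
  shows "prob {c \<in> space L. common_outside j k J (rep c)}
       = prob {c \<in> space L. common_outside (g j) (g k) (g ` J) (rep c)}"
proof -
  let ?P = "common_outside j k J"
  obtain n where n: "insert j (insert k J) \<subseteq> {..<n}"
    using finite_nat_bounded[of "insert j (insert k J)"] assms(2) by auto
  have fin: "finitary \<alpha> n ?P" using n by (intro finitary_common_outside) auto
  have A: "{c \<in> space L. ?P (rep c)} \<in> sets (class_space \<alpha>)"
    using finitary_in_sets_class_space[OF fin] by (simp add: space_L)
  have "prob {c \<in> space L. ?P (rep c)} = measure (distr L (class_space \<alpha>) (reindex \<alpha> g)) {c \<in> space L. ?P (rep c)}"
    using distr_reindex[OF assms(1)] by simp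
  also have "\<dots> = prob (reindex \<alpha> g -` {c \<in> space L. ?P (rep c)} \<inter> space L)"
    by (rule measure_distr[OF measurable_reindex_L A])
  also have "reindex \<alpha> g -` {c \<in> space L. ?P (rep c)} \<inter> space L
      = {c \<in> space L. common_outside (g j) (g k) (g ` J) (rep c)}"
    using class_invariant_reindex[OF finitary_imp_class_invariant[OF fin]]
    by (auto simp: space_L reindex_in_classes common_outside_comp)
  finally show ?thesis .
qed

lemma prob_next_occurrence_tendsto_0:
  "(\<lambda>m. prob {c \<in> space L. common_outside 0 (Suc m) {1..m} (rep c)}) \<longlonglongrightarrow> 0"
proof -
  let ?E = "\<lambda>m. {c \<in> space L. common_outside 0 (Suc m) {1..m} (rep c)}"
  have E: "?E m \<in> sets L" for m
  proof -
    have "finitary \<alpha> (Suc (Suc m)) (common_outside 0 (Suc m) {1..m})"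
      by (rule finitary_common_outside) auto
    then show ?thesis using finitary_in_sets_class_space by (simp add: space_L sets_L)
  qed
  have "(\<lambda>m. \<integral>c. indicator (?E m) c \<partial>L) \<longlonglongrightarrow> (\<integral>c. (0::real) \<partial>L)"
  proof (rule integral_dominated_convergence[where w = "\<lambda>_. 1"])
    show "AE c in L. (\<lambda>m. indicator (?E m) c) \<longlonglongrightarrow> (0::real)"
    proof (rule AE_I2)
      fix c assume "c \<in> space L"
      then have "rep c 0 \<in> Fin \<alpha>" using range_rep[of c \<alpha>] by (auto simp: space_L)
      then have "finite {m. common_outside 0 (Suc m) {1..m} (rep c)}"
        by (intro finite_next_occurrences) (simp add: Fin_def)
      then have "\<forall>\<^sub>F m in sequentially. m \<notin> {m. common_outside 0 (Suc m) {1..m} (rep c)}"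
        unfolding cofinite_eq_sequentially[symmetric] eventually_cofinite by simp
      then have "\<forall>\<^sub>F m in sequentially. indicator (?E m) c = (0::real)"
        by (rule eventually_mono) auto
      then show "(\<lambda>m. indicator (?E m) c) \<longlonglongrightarrow> (0::real)"
        by (rule tendsto_eventually)
    qed
    show "(\<lambda>c. indicator (?E m) c :: real) \<in> borel_measurable L" for m
      using E by measurable
  qed (auto simp: indicator_def)
  then show ?thesis using E by (simp add: sets.Int_space_eq2)
qed

text \<open>Almost surely, labels that do not occur in even entries occur in at most one odd entry.\<close>

lemma AE_odd_labels_private:
  "AE c in L. \<forall>p q. p \<noteq> q \<longrightarrow> domain (rep c (2 * p + 1)) \<inter> domain (rep c (2 * q + 1))
     \<subseteq> (\<Union>i. domain (rep c (2 * i)))"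
proof -
  have "AE c in L. domain (rep c (2 * p + 1)) \<inter> domain (rep c (2 * q + 1)) \<subseteq> (\<Union>i. domain (rep c (2 * i)))"
    if pq: "p \<noteq> q" for p q
  proof -
    let ?J = "\<lambda>m. (\<lambda>i. 2 * i) ` {..<m}"
    let ?C = "\<lambda>m. {c \<in> space L. common_outside (2 * p + 1) (2 * q + 1) (?J m) (rep c)}"
    have C: "?C m \<in> sets L" for m
    proof -
      have "finitary \<alpha> (2 * p + 2 * q + 2 * m + 2) (common_outside (2 * p + 1) (2 * q + 1) (?J m))"
        by (rule finitary_common_outside) auto
      then show ?thesis using finitary_in_sets_class_space by (simp add: space_L sets_L)
    qed
    have "prob (?C m) = prob {c \<in> space L. common_outside 0 (Suc m) {1..m} (rep c)}" for m
    proof -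
      \<comment> \<open>Sends entries \<open>0\<close> and \<open>m + 1\<close> to the two odd entries and \<open>1, \<dots>, m\<close> to the first \<open>m\<close> even ones;
        beyond, it takes odd values larger than those two.\<close>
      define g where "g i = (if i = 0 then 2 * p + 1 else if i = Suc m then 2 * q + 1
        else if i \<le> m then 2 * (i - 1) else 2 * (i + p + q) + 1)" for i :: nat
      have "inj g"
        using pq by (auto simp: inj_def g_def split: if_splits) presburger+
      moreover have "g ` {1..m} = ?J m"
      proof -
        have "g ` {1..m} = (\<lambda>i. 2 * (i - 1)) ` {1..m}"
          by (rule image_cong) (auto simp: g_def)
        also have "\<dots> = (\<lambda>i. 2 * i) ` (\<lambda>i. i - 1) ` {1..m}" by (simp add: image_image)
        also have "(\<lambda>i. i - 1) ` {1..m} = {..<m}"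
          by (auto simp: image_iff intro!: bexI[of _ "Suc _"])
        finally show ?thesis .
      qed
      moreover have "g 0 = 2 * p + 1" "g (Suc m) = 2 * q + 1" by (auto simp: g_def)
      ultimately show ?thesis
        using prob_common_outside_reindex[of g "{1..m}" 0 "Suc m"] by simp
    qed
    then have lim: "(\<lambda>m. prob (?C m)) \<longlonglongrightarrow> 0" using prob_next_occurrence_tendsto_0 by simp
    have "prob (\<Inter>m. ?C m) \<le> prob (?C m)" for m
      using C by (intro finite_measure_mono) auto
    then have "prob (\<Inter>m. ?C m) \<le> 0"
      using LIMSEQ_le_const[OF lim] by blast
    then have "prob (\<Inter>m. ?C m) = 0" using measure_nonneg[of L "\<Inter>m. ?C m"] by linarith
    moreover have "(\<Inter>m. ?C m) \<in> sets L" using C by auto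
    ultimately have "AE c in L. c \<notin> (\<Inter>m. ?C m)"
      by (subst AE_iff_measurable[of "\<Inter>m. ?C m"]) (auto simp: emeasure_eq_measure)
    then show ?thesis
      using AE_space
    proof eventually_elim
      case (elim c)
      then obtain m where m: "\<not> common_outside (2 * p + 1) (2 * q + 1) (?J m) (rep c)" by blast
      show ?case
      proof
        fix a assume "a \<in> domain (rep c (2 * p + 1)) \<inter> domain (rep c (2 * q + 1))"
        then show "a \<in> (\<Union>i. domain (rep c (2 * i)))"
          using m unfolding common_outside_def by blast
      qed
    qed
  qed
  then show ?thesis by (simp add: AE_all_countable)
qed

end

section \<open>Odd entries described relative to the even ones\<close>

text \<open>
  The labels that occur in the even entries \<open>2 * i\<close> with \<open>i \<in> E\<close>. The set \<open>E\<close> is \<open>UNIV\<close> or, for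
  approximation by finitely many entries, \<open>{..<m}\<close>.
\<close>

definition ref_labels :: "nat set \<Rightarrow> (nat \<Rightarrow> int rstruct) \<Rightarrow> int set" where
  "ref_labels E x = (\<Union>i\<in>E. domain (x (2 * i)))"

text \<open>Half the index of the first of these entries that contains \<open>a\<close>; arbitrary if there is none.\<close>

definition first_entry :: "nat set \<Rightarrow> (nat \<Rightarrow> int rstruct) \<Rightarrow> int \<Rightarrow> nat" where
  "first_entry E x a = (LEAST i. i \<in> E \<and> a \<in> domain (x (2 * i)))"

text \<open>
  The name of a reference label: the first even entry that contains it together with its rank there
  in the order given by \<open>T\<close>, coded as a positive integer.
\<close>

definition ref_name :: "nat set \<Rightarrow> (nat \<Rightarrow> int rstruct) \<Rightarrow> (int \<Rightarrow> real) \<Rightarrow> int \<Rightarrow> int" where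
  "ref_name E x T a = 1 + int (prod_encode (first_entry E x a,
     card {b \<in> domain (x (2 * first_entry E x a)). T b < T a}))"

text \<open>
  The new label of \<open>a\<close> in the odd entry \<open>2 * j + 1\<close>. Labels without a name go to \<open>0, -1, -2, \<dots>\<close> in
  decreasing order of their values under \<open>T\<close>.
\<close>

definition rel_label :: "nat set \<Rightarrow> (nat \<Rightarrow> int rstruct) \<Rightarrow> (int \<Rightarrow> real) \<Rightarrow> nat \<Rightarrow> int \<Rightarrow> int" where
  "rel_label E x T j a = (if a \<in> ref_labels E x then ref_name E x T a
     else - int (card {b \<in> domain (x (2 * j + 1)) - ref_labels E x. T a < T b}))"

text \<open>The odd entry \<open>2 * j + 1\<close>, relabeled.\<close>

definition rel_entry :: "nat set \<Rightarrow> (nat \<Rightarrow> int rstruct) \<Rightarrow> (int \<Rightarrow> real) \<Rightarrow> nat \<Rightarrow> int rstruct" where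
  "rel_entry E x T j = map_struct (rel_label E x T j) (x (2 * j + 1))"

lemma first_entry:
  assumes "a \<in> ref_labels E x"
  shows "first_entry E x a \<in> E" "a \<in> domain (x (2 * first_entry E x a))"
proof -
  have "\<exists>i. i \<in> E \<and> a \<in> domain (x (2 * i))" using assms by (auto simp: ref_labels_def)
  then have "first_entry E x a \<in> E \<and> a \<in> domain (x (2 * first_entry E x a))"
    unfolding first_entry_def by (rule LeastI_ex)
  then show "first_entry E x a \<in> E" "a \<in> domain (x (2 * first_entry E x a))" by auto
qed

text \<open>The construction commutes with relabelings when \<open>T\<close> is transported along with the labels.\<close>

lemma rel_entry_relabels:
  assumes rel: "relabels I \<rho> y x"
    and I: "\<And>i. i \<in> E \<Longrightarrow> 2 * i \<in> I" "2 * j + 1 \<in> I"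
    and T: "\<And>a. a \<in> (\<Union>i\<in>I. domain (y i)) \<Longrightarrow> T' a = T (\<rho> a)"
    and y: "range y \<subseteq> Fin \<alpha>"
  shows "rel_entry E x T j = rel_entry E y T' j"
proof -
  let ?D = "\<Union>i\<in>I. domain (y i)"
  note mem = relabels_mem_iff[OF rel]
  have inj: "inj_on \<rho> ?D" using rel by (simp add: relabels_def)
  have sub: "b \<in> ?D" if "b \<in> domain (y i)" "i \<in> I" for b i using that by blast
  have ref_labels: "\<rho> a \<in> ref_labels E x \<longleftrightarrow> a \<in> ref_labels E y" if "a \<in> ?D" for a
    unfolding ref_labels_def using mem[OF I(1) that] by simp
  have first: "first_entry E x (\<rho> a) = first_entry E y a" if "a \<in> ?D" for a
  proof -
    have "(\<lambda>i. i \<in> E \<and> \<rho> a \<in> domain (x (2 * i))) = (\<lambda>i. i \<in> E \<and> a \<in> domain (y (2 * i)))"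
      using mem[OF I(1) that] by (intro ext) blast
    then show ?thesis by (simp only: first_entry_def)
  qed
  have card: "card {b \<in> domain (x i). P (\<rho> a) b} = card {b \<in> domain (y i). P' a b}"
    if "i \<in> I" "\<And>b. b \<in> domain (y i) \<Longrightarrow> P (\<rho> a) (\<rho> b) \<longleftrightarrow> P' a b" for P P' i a
  proof -
    have "{b \<in> domain (x i). P (\<rho> a) b} = \<rho> ` {b \<in> domain (y i). P' a b}"
      unfolding relabels_domain[OF rel that(1)] using that(2) by auto
    moreover have "inj_on \<rho> {b \<in> domain (y i). P' a b}"
      using inj by (rule inj_on_subset) (use sub that(1) in blast)
    ultimately show ?thesis by (simp add: card_image)
  qed
  have "(rel_label E x T j \<circ> \<rho>) a = rel_label E y T' j a" if a: "a \<in> domain (y (2 * j + 1))" for a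
  proof (cases "a \<in> ref_labels E y")
    case True
    have aD: "a \<in> ?D" using sub[OF a I(2)] .
    let ?i = "first_entry E y a"
    have i: "2 * ?i \<in> I" using first_entry(1)[OF True] by (rule I(1))
    have "card {b \<in> domain (x (2 * ?i)). T b < T (\<rho> a)} = card {b \<in> domain (y (2 * ?i)). T' b < T' a}"
      by (rule card[OF i, where P = "\<lambda>a b. T b < T a"]) (use T sub[OF _ i] aD in simp)
    then show ?thesis
      using True ref_labels[OF aD] first[OF aD] by (simp add: rel_label_def ref_name_def)
  next
    case False
    have aD: "a \<in> ?D" using sub[OF a I(2)] .
    have "card {b \<in> domain (x (2 * j + 1)). b \<notin> ref_labels E x \<and> T (\<rho> a) < T b}
      = card {b \<in> domain (y (2 * j + 1)). b \<notin> ref_labels E y \<and> T' a < T' b}"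
    proof (rule card[OF I(2), where P = "\<lambda>a b. b \<notin> ref_labels E x \<and> T a < T b"])
      fix b assume "b \<in> domain (y (2 * j + 1))"
      then have "b \<in> ?D" by (rule sub[OF _ I(2)])
      then show "\<rho> b \<notin> ref_labels E x \<and> T (\<rho> a) < T (\<rho> b) \<longleftrightarrow> b \<notin> ref_labels E y \<and> T' a < T' b"
        using ref_labels[of b] T[of b] T[OF aD] by simp
    qed
    then show ?thesis
      using False ref_labels[OF aD] by (simp only: rel_label_def comp_apply if_False Diff_iff conj_assoc)
  qed
  moreover have "is_structure \<alpha> (y (2 * j + 1))" using y by (auto simp: Fin_def)
  ultimately have "map_struct (rel_label E x T j \<circ> \<rho>) (y (2 * j + 1)) = rel_entry E y T' j"
    unfolding rel_entry_def by (intro map_struct_cong)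
  then show ?thesis
    using rel I(2) unfolding rel_entry_def by (metis map_struct_comp relabels_def)
qed

lemma rel_entry_comp_odd_reindex:
  assumes "\<And>i. g (2 * i) = 2 * i" "g (2 * j + 1) = 2 * k + 1"
  shows "rel_entry E (x \<circ> g) T j = rel_entry E x T k"
proof -
  have "ref_labels E (x \<circ> g) = ref_labels E x" by (simp add: ref_labels_def assms)
  moreover have "first_entry E (x \<circ> g) = first_entry E x"
    by (simp add: first_entry_def fun_eq_iff assms)
  ultimately have "rel_label E (x \<circ> g) T j = rel_label E x T k"
    using assms by (simp add: rel_label_def ref_name_def fun_eq_iff)
  then show ?thesis using assms by (simp add: rel_entry_def)
qed

lemma eventually_rel_entry_truncated:
  assumes x: "range x \<subseteq> Fin \<alpha>"
  shows "\<forall>\<^sub>F m in sequentially. rel_entry {..<m} x T j = rel_entry UNIV x T j"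
proof -
  let ?D = "domain (x (2 * j + 1))"
  have struct: "is_structure \<alpha> (x (2 * j + 1))" and fin: "finite ?D"
    using x by (auto simp: Fin_def)
  define M where "M = Suc (Max (insert 0 (first_entry UNIV x ` ?D)))"
  have M: "first_entry UNIV x a < M" if "a \<in> ?D" for a
    using that fin by (auto simp: M_def less_Suc_eq_le intro!: Max_ge)
  have "rel_entry {..<m} x T j = rel_entry UNIV x T j" if "M \<le> m" for m
  proof -
    have ref_labels: "a \<in> ref_labels {..<m} x \<longleftrightarrow> a \<in> ref_labels UNIV x" if a: "a \<in> ?D" for a
      using M[OF a] \<open>M \<le> m\<close> first_entry[of a UNIV x] by (fastforce simp: ref_labels_def)
    have first: "first_entry {..<m} x a = first_entry UNIV x a" if a: "a \<in> ?D" "a \<in> ref_labels UNIV x" for a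
      unfolding first_entry_def[of "{..<m}"]
    proof (rule Least_equality)
      show "first_entry UNIV x a \<in> {..<m} \<and> a \<in> domain (x (2 * first_entry UNIV x a))"
        using M[OF a(1)] \<open>M \<le> m\<close> first_entry[OF a(2)] by auto
      show "first_entry UNIV x a \<le> i" if "i \<in> {..<m} \<and> a \<in> domain (x (2 * i))" for i
        using that unfolding first_entry_def by (intro Least_le) auto
    qed
    have "?D - ref_labels {..<m} x = ?D - ref_labels UNIV x" using ref_labels by blast
    then have "rel_label {..<m} x T j a = rel_label UNIV x T j a" if "a \<in> ?D" for a
      using ref_labels[OF that] first[OF that] by (simp add: rel_label_def ref_name_def)
    then show ?thesis unfolding rel_entry_def by (intro map_struct_cong[OF struct])
  qed
  then show ?thesis by (auto simp: eventually_sequentially)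
qed

lemma card_image_greater:
  fixes T :: "int \<Rightarrow> real"
  assumes "finite V" "inj_on T V"
  shows "inj_on (\<lambda>a. card {b \<in> V. T a < T b}) V"
    and "(\<lambda>a. card {b \<in> V. T a < T b}) ` V = {..<card V}"
proof -
  have *: "card {b \<in> V. T a < T b} = card {w \<in> T ` V. T a < w}" if "a \<in> V" for a
  proof -
    have "{w \<in> T ` V. T a < w} = T ` {b \<in> V. T a < T b}" by auto
    moreover have "inj_on T {b \<in> V. T a < T b}" using assms(2) by (rule inj_on_subset) auto
    ultimately show ?thesis by (simp add: card_image)
  qed
  have "(\<lambda>a. card {b \<in> V. T a < T b}) ` V = (\<lambda>v. card {w \<in> T ` V. v < w}) ` T ` V"
    unfolding image_image by (rule image_cong) (use * in auto)
  also have "\<dots> = {..<card V}"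
    using image_count_greater[of "T ` V"] assms by (simp add: card_image)
  finally show "(\<lambda>a. card {b \<in> V. T a < T b}) ` V = {..<card V}" .
  then show "inj_on (\<lambda>a. card {b \<in> V. T a < T b}) V"
    using assms(1) by (intro eq_card_imp_inj_on) auto
qed

lemma ref_name_pos: "0 < ref_name E x T a"
  by (simp add: ref_name_def)

lemma inj_on_ref_name:
  assumes x: "range x \<subseteq> Fin \<alpha>" and T: "inj T"
  shows "inj_on (ref_name E x T) (ref_labels E x)"
proof (rule inj_onI)
  fix a b assume a: "a \<in> ref_labels E x" and b: "b \<in> ref_labels E x" and eq: "ref_name E x T a = ref_name E x T b"
  then have i: "first_entry E x a = first_entry E x b"
    and c: "card {d \<in> domain (x (2 * first_entry E x a)). T d < T a}
          = card {d \<in> domain (x (2 * first_entry E x b)). T d < T b}"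
    by (auto simp: ref_name_def)
  let ?D = "domain (x (2 * first_entry E x a))"
  have D: "finite ?D" "a \<in> ?D" "b \<in> ?D"
    using x first_entry(2)[OF a] first_entry(2)[OF b] i by (auto simp: Fin_def)
  have less: "card {d \<in> ?D. T d < T s} < card {d \<in> ?D. T d < T t}" if "s \<in> ?D" "T s < T t" for s t
    using that D(1) by (intro psubset_card_mono) auto
  have "T a = T b"
    using less[OF D(2), of b] less[OF D(3), of a] c i by (cases "T a" "T b" rule: linorder_cases) auto
  then show "a = b" using T by (simp add: inj_eq)
qed

text \<open>If \<open>T\<close> is injective, the labels without a name are numbered \<open>0, -1, \<dots>\<close> without gaps or repetitions.\<close>

lemma rel_label_outside_ref_labels:
  fixes x :: "nat \<Rightarrow> int rstruct" and E :: "nat set" and j :: nat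
  assumes x: "range x \<subseteq> Fin \<alpha>" and T: "inj T"
  defines "V \<equiv> \<lambda>j. domain (x (2 * j + 1)) - ref_labels E x"
  shows "inj_on (rel_label E x T j) (V j)" "rel_label E x T j ` V j = (\<lambda>n. - int n) ` {..<card (V j)}"
    "{b \<in> rel_label E x T j ` domain (x (2 * j + 1)). b \<le> 0} = rel_label E x T j ` V j"
proof -
  let ?c = "\<lambda>a. card {b \<in> V j. T a < T b}"
  have V: "finite (V j)" "inj_on T (V j)"
    using x T by (auto simp: V_def Fin_def inj_on_def)
  have l: "rel_label E x T j a = - int (?c a)" if "a \<in> V j" for a
    using that by (simp add: rel_label_def V_def)
  show "inj_on (rel_label E x T j) (V j)"
    using card_image_greater(1)[OF V] l by (auto simp: inj_on_def)
  have "rel_label E x T j ` V j = (\<lambda>n. - int n) ` ?c ` V j"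
    unfolding image_image by (rule image_cong) (use l in auto)
  then show "rel_label E x T j ` V j = (\<lambda>n. - int n) ` {..<card (V j)}"
    using card_image_greater(2)[OF V] by simp
  have "rel_label E x T j a \<le> 0 \<longleftrightarrow> a \<notin> ref_labels E x" for a
    using ref_name_pos[of E x T a] by (auto simp: rel_label_def)
  then show "{b \<in> rel_label E x T j ` domain (x (2 * j + 1)). b \<le> 0} = rel_label E x T j ` V j"
    by (auto simp: V_def)
qed

lemma rel_entry_in_R_star:
  assumes R: "R \<subseteq> Fin \<alpha>" and x: "range x \<subseteq> Fin \<alpha>" and T: "inj T"
    and xR: "x (2 * j + 1) = map_struct t A" "A \<in> R"
  shows "rel_entry E x T j \<in> R_star R"
proof -
  let ?t = "rel_label E x T j \<circ> t" and ?k = "card (domain (x (2 * j + 1)) - ref_labels E x)"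
  have eq: "{b \<in> ?t ` domain A. b \<le> 0} = (\<lambda>n. - int n) ` {..<?k}"
  proof -
    have "?t ` domain A = rel_label E x T j ` domain (x (2 * j + 1))"
      using xR by (simp add: image_comp)
    then show ?thesis using rel_label_outside_ref_labels[OF x T] by metis
  qed
  have "(\<lambda>n. - int n) ` {..<Suc k} = {- int k..0}" for k
  proof (intro equalityI subsetI)
    fix z assume "z \<in> {- int k..0}"
    then have "z = - int (nat (- z))" "nat (- z) \<in> {..<Suc k}" by auto
    then show "z \<in> (\<lambda>n. - int n) ` {..<Suc k}" by (rule image_eqI)
  qed auto
  then have "{b \<in> ?t ` domain A. b \<le> 0} = {} \<or> (\<exists>k::nat. {b \<in> ?t ` domain A. b \<le> 0} = {- int k..0})"
    unfolding eq by (cases ?k) auto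
  moreover have "rel_entry E x T j = map_struct ?t A"
    by (simp only: rel_entry_def xR(1) map_struct_comp)
  ultimately show ?thesis
    unfolding R_star_eq[OF R] using xR(2) by blast
qed

text \<open>
  When no label outside the even entries is shared by two odd entries, the relabeled odd entries
  determine the class of the sequence of odd entries, and \<open>dagger\<close> recovers it: names identify
  the shared labels, and \<open>dagger\<close> keeps the other labels of different entries apart.
\<close>

lemma dagger_rel_entry_relabels:
  assumes x: "range x \<subseteq> Fin \<alpha>" and T: "inj T"
    and private_odd: "\<And>p q. p \<noteq> q \<Longrightarrow> domain (x (2 * p + 1)) \<inter> domain (x (2 * q + 1)) \<subseteq> ref_labels UNIV x"
  obtains \<theta> where "relabels UNIV \<theta> (x \<circ> (\<lambda>n. 2 * n + 1)) (dagger (rel_entry UNIV x T))"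
proof
  let ?y = "rel_entry UNIV x T" and ?D = "\<lambda>j. domain (x (2 * j + 1))"
  let ?C = "ref_labels UNIV x" and ?l = "rel_label UNIV x T"
  define V where "V j = ?D j - ?C" for j
  define shift where "shift j a = (if 0 < a then a else dagger_offset ?y j + a)" for j a
  \<comment> \<open>The only odd entry that contains \<open>a\<close>, for a label \<open>a\<close> without a name.\<close>
  define idx where "idx a = (SOME j. a \<in> V j)" for a
  define \<theta> where "\<theta> a = (if a \<in> ?C then ref_name UNIV x T a else shift (idx a) (?l (idx a) a))" for a
  have idx: "idx a = j" if "a \<in> V j" for a j
  proof -
    have "a \<in> V (idx a)" unfolding idx_def using that by (rule someI)
    then show ?thesis using that private_odd[of "idx a" j] by (auto simp: V_def)
  qed
  note lab = rel_label_outside_ref_labels[OF x T, where E = UNIV, folded V_def]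
  have offset: "dagger_offset ?y (Suc j) = dagger_offset ?y j - int (card (V j))" for j
  proof -
    have "{a \<in> domain (?y j). a \<le> 0} = ?l j ` V j"
      using lab(3)[of j] by (simp add: rel_entry_def)
    then show ?thesis using card_image[OF lab(1)[of j]] by simp
  qed
  have anti: "dagger_offset ?y k \<le> dagger_offset ?y j" if "j \<le> k" for j k
    using that by (induction rule: dec_induct) (auto simp: offset simp del: dagger_offset.simps(2))
  have \<theta>_V: "\<theta> a = dagger_offset ?y j + ?l j a" "dagger_offset ?y (Suc j) < \<theta> a"
    "\<theta> a \<le> dagger_offset ?y j" if a: "a \<in> V j" for a j
  proof -
    have "?l j a \<in> (\<lambda>n. - int n) ` {..<card (V j)}" using lab(2)[of j] a by blast
    then have l: "?l j a \<le> 0" "- int (card (V j)) < ?l j a" by auto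
    then show eq: "\<theta> a = dagger_offset ?y j + ?l j a"
      using a idx[OF a] by (simp add: \<theta>_def shift_def V_def)
    show "dagger_offset ?y (Suc j) < \<theta> a" "\<theta> a \<le> dagger_offset ?y j"
      using l unfolding eq offset by auto
  qed
  have \<theta>_nonpos: "\<theta> a \<le> 0" if "a \<in> V j" for a j
    using \<theta>_V(3)[OF that] anti[of 0 j] by simp
  have \<theta>_C: "\<theta> a = ref_name UNIV x T a" if "a \<in> ?C" for a
    using that by (simp add: \<theta>_def)
  have "inj_on \<theta> (\<Union>j. ?D j)"
  proof (rule inj_onI)
    fix a b assume ab: "a \<in> (\<Union>j. ?D j)" "b \<in> (\<Union>j. ?D j)" and eq: "\<theta> a = \<theta> b"
    consider "a \<in> ?C" "b \<in> ?C" | j where "a \<in> ?C" "b \<in> V j" | j where "a \<in> V j" "b \<in> ?C"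
      | j k where "a \<in> V j" "b \<in> V k"
      using ab unfolding V_def by blast
    then show "a = b"
    proof cases
      case 1
      then show ?thesis using inj_on_ref_name[OF x T] eq \<theta>_C by (auto dest: inj_onD)
    next
      case 2
      then show ?thesis using \<theta>_nonpos[of b j] \<theta>_C[of a] ref_name_pos[of UNIV x T a] eq by simp
    next
      case 3
      then show ?thesis using \<theta>_nonpos[of a j] \<theta>_C[of b] ref_name_pos[of UNIV x T b] eq by simp
    next
      case 4
      have "j = k"
      proof (cases j k rule: linorder_cases)
        case less
        then show ?thesis using \<theta>_V(2)[OF 4(1)] \<theta>_V(3)[OF 4(2)] anti[of "Suc j" k] eq by simp
      next
        case greater
        then show ?thesis using \<theta>_V(2)[OF 4(2)] \<theta>_V(3)[OF 4(1)] anti[of "Suc k" j] eq by simp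
      qed
      then show ?thesis
        using 4 \<theta>_V(1)[OF 4(1)] \<theta>_V(1)[OF 4(2)] eq lab(1)[of j] by (auto dest: inj_onD)
    qed
  qed
  moreover have "map_struct \<theta> (x (2 * j + 1)) = dagger ?y j" for j
  proof -
    have "is_structure \<alpha> (x (2 * j + 1))" using x by (auto simp: Fin_def)
    then have "map_struct \<theta> (x (2 * j + 1)) = map_struct (shift j \<circ> ?l j) (x (2 * j + 1))"
    proof (rule map_struct_cong)
      fix a assume a: "a \<in> ?D j"
      show "\<theta> a = (shift j \<circ> ?l j) a"
      proof (cases "a \<in> ?C")
        case True
        then show ?thesis
          using ref_name_pos[of UNIV x T a] by (simp add: \<theta>_C shift_def rel_label_def)
      next
        case False
        then have "a \<in> V j" using a by (simp add: V_def)
        then show ?thesis using False idx[of a j] by (simp add: \<theta>_def)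
      qed
    qed
    also have "\<dots> = dagger ?y j"
      by (simp add: dagger_def rel_entry_def map_struct_comp shift_def[abs_def])
    finally show ?thesis .
  qed
  ultimately show "relabels UNIV \<theta> (x \<circ> (\<lambda>n. 2 * n + 1)) (dagger ?y)"
    by (simp add: relabels_def)
qed

section \<open>The random encoding of the odd entries\<close>

definition uniform01 :: "real measure" where
  "uniform01 = uniform_measure lborel {0..1}"

text \<open>The law of independent uniform random numbers attached to all potential labels.\<close>

definition label_law :: "(int \<Rightarrow> real) measure" where
  "label_law = (\<Pi>\<^sub>M a\<in>(UNIV :: int set). uniform01)"

lemma sets_uniform01 [measurable_cong]: "sets uniform01 = sets borel"
  by (simp add: uniform01_def)

lemma prob_space_uniform01: "prob_space uniform01"
  unfolding uniform01_def by (rule prob_space_uniform_measure) auto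

lemma prob_space_label_law: "prob_space label_law"
  unfolding label_law_def by (rule prob_space_PiM) (rule prob_space_uniform01)

lemma space_label_law: "space label_law = UNIV"
  by (simp add: label_law_def space_PiM uniform01_def)

lemma measurable_rel_label_coordinate [measurable]: "(\<lambda>T. T a) \<in> borel_measurable label_law"
proof -
  have "(\<lambda>T. T a) \<in> label_law \<rightarrow>\<^sub>M uniform01"
    unfolding label_law_def by measurable
  then show ?thesis by (simp add: measurable_cong_sets[OF refl sets_uniform01])
qed

lemma AE_labels_distinct: "AE T in label_law. inj T"
proof -
  interpret U: prob_space uniform01 by (rule prob_space_uniform01)
  interpret product_prob_space "\<lambda>_::int. uniform01" UNIV by unfold_locales
  interpret pair_sigma_finite uniform01 uniform01 by unfold_locales
  have pair: "AE T in label_law. T a \<noteq> T b" if ab: "a \<noteq> b" for a b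
  proof -
    let ?P = "\<Pi>\<^sub>M i\<in>{a, b}. uniform01"
    have m: "(\<lambda>\<sigma>. \<sigma> a) \<in> borel_measurable ?P" "(\<lambda>\<sigma>. \<sigma> b) \<in> borel_measurable ?P"
      using measurable_component_singleton[of a "{a, b}" "\<lambda>_. uniform01"]
        measurable_component_singleton[of b "{a, b}" "\<lambda>_. uniform01"]
      by (auto simp: measurable_cong_sets[OF refl sets_uniform01])
    let ?h = "\<lambda>u v :: real. if u = v then 1 else 0 :: ennreal"
    have f': "case_prod ?h \<in> borel_measurable (borel \<Otimes>\<^sub>M borel)"
      by measurable
    have f: "case_prod ?h \<in> borel_measurable (uniform01 \<Otimes>\<^sub>M uniform01)"
      by (subst measurable_cong_sets[OF sets_pair_measure_cong[OF sets_uniform01 sets_uniform01] refl]) (rule f')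
    have null: "emeasure uniform01 {u} = 0" for u
    proof -
      have "emeasure lborel ({0..1} \<inter> {u}) = 0" by (rule emeasure_lborel_countable) simp
      then show ?thesis by (simp add: uniform01_def emeasure_uniform_measure)
    qed
    have "(\<integral>\<^sup>+\<sigma>. ?h (\<sigma> a) (\<sigma> b) \<partial>?P) = (\<integral>\<^sup>+z. ?h (fst z) (snd z) \<partial>(uniform01 \<Otimes>\<^sub>M uniform01))"
      by (rule product_nn_integral_pair[OF f ab])
    also have "\<dots> = (\<integral>\<^sup>+u. \<integral>\<^sup>+v. ?h u v \<partial>uniform01 \<partial>uniform01)"
      using U.nn_integral_fst[OF f] by (simp add: case_prod_beta')
    also have "\<dots> = (\<integral>\<^sup>+u. 0 \<partial>uniform01)"
    proof (rule nn_integral_cong)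
      fix u
      have "(\<integral>\<^sup>+v. ?h u v \<partial>uniform01) = (\<integral>\<^sup>+v. indicator {u} v \<partial>uniform01)"
        by (rule nn_integral_cong) (auto simp: indicator_def)
      then show "(\<integral>\<^sup>+v. ?h u v \<partial>uniform01) = 0" by (simp add: null sets_uniform01)
    qed
    finally have int0: "(\<integral>\<^sup>+\<sigma>. ?h (\<sigma> a) (\<sigma> b) \<partial>?P) = 0" by simp
    have "(\<lambda>\<sigma>. ?h (\<sigma> a) (\<sigma> b)) \<in> borel_measurable ?P"
      using m by (intro measurable_If borel_measurable_const) (auto intro!: borel_measurable_eq)
    then have "AE \<sigma> in ?P. ?h (\<sigma> a) (\<sigma> b) = 0"
      using int0 by (subst (asm) nn_integral_0_iff_AE) auto
    then have "AE \<sigma> in ?P. \<sigma> a \<noteq> \<sigma> b"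
      by eventually_elim (auto split: if_splits)
    then have "AE \<sigma> in distr label_law ?P (\<lambda>T. restrict T {a, b}). \<sigma> a \<noteq> \<sigma> b"
      unfolding label_law_def by (subst distr_PiM_restrict_finite) auto
    then show ?thesis
      unfolding label_law_def by (auto dest: AE_distrD[rotated])
  qed
  have "AE T in label_law. \<forall>a b. a \<noteq> b \<longrightarrow> T a \<noteq> T b"
    using pair by (simp add: AE_all_countable)
  then show ?thesis by eventually_elim (auto simp: inj_def)
qed

text \<open>A relabeled entry depends on \<open>T\<close> only through the order of its values on \<open>W\<close>, which can be chosen finite.\<close>

lemma rel_entry_cong_order:
  assumes x: "range x \<subseteq> Fin \<alpha>"
    and W: "domain (x (2 * j + 1)) \<subseteq> W" "\<And>i. i \<in> first_entry E x ` (domain (x (2 * j + 1)) \<inter> ref_labels E x) \<Longrightarrow> domain (x (2 * i)) \<subseteq> W"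
    and T: "\<And>a b. a \<in> W \<Longrightarrow> b \<in> W \<Longrightarrow> T a < T b \<longleftrightarrow> T' a < T' b"
  shows "rel_entry E x T j = rel_entry E x T' j"
  unfolding rel_entry_def
proof (rule map_struct_cong)
  show "is_structure \<alpha> (x (2 * j + 1))" using x by (auto simp: Fin_def)
  fix a assume a: "a \<in> domain (x (2 * j + 1))"
  then have aW: "a \<in> W" using W(1) by blast
  show "rel_label E x T j a = rel_label E x T' j a"
  proof (cases "a \<in> ref_labels E x")
    case True
    let ?A = "domain (x (2 * first_entry E x a))"
    have "?A \<subseteq> W" using W(2) a True by blast
    then have "{b \<in> ?A. T b < T a} = {b \<in> ?A. T' b < T' a}" using T aW by blast
    then show ?thesis using True by (simp add: rel_label_def ref_name_def)
  next
    case False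
    let ?A = "domain (x (2 * j + 1)) - ref_labels E x"
    have "{b \<in> ?A. T a < T b} = {b \<in> ?A. T' a < T' b}" using T aW W(1) by blast
    then show ?thesis using False by (simp add: rel_label_def)
  qed
qed

lemma measurable_rel_entry:
  assumes x: "range x \<subseteq> Fin \<alpha>"
    and I: "\<And>i. i \<in> E \<Longrightarrow> 2 * i \<in> I" "2 * j + 1 \<in> I"
    and T: "\<And>a. a \<in> (\<Union>i\<in>I. domain (x i)) \<Longrightarrow> (\<lambda>\<omega>. T \<omega> a) \<in> borel_measurable N"
  shows "(\<lambda>\<omega>. rel_entry E x (T \<omega>) j) \<in> N \<rightarrow>\<^sub>M count_space UNIV"
proof -
  let ?D = "domain (x (2 * j + 1))"
  let ?F = "first_entry E x ` (?D \<inter> ref_labels E x)"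
  define W where "W = ?D \<union> (\<Union>i\<in>?F. domain (x (2 * i)))"
  have fin: "finite (domain (x i))" for i using x by (auto simp: Fin_def)
  have W: "finite W" using fin by (simp add: W_def)
  have W_sub: "W \<subseteq> (\<Union>i\<in>I. domain (x i))"
    using I first_entry(1) by (fastforce simp: W_def)
  define order where "order T = {p \<in> W \<times> W. T (fst p) < T (snd p)}" for T :: "int \<Rightarrow> real"
  have order_eq_iff: "order t = B \<longleftrightarrow> (\<forall>p\<in>W \<times> W. (t (fst p) < t (snd p)) = (p \<in> B))"
    if "B \<subseteq> W \<times> W" for t B
    unfolding order_def using that by blast
  have dep: "rel_entry E x T j = rel_entry E x T' j" if "order T = order T'" for T T'
  proof (rule rel_entry_cong_order[OF x, where W = W])
    fix a b assume "a \<in> W" "b \<in> W"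
    then show "T a < T b \<longleftrightarrow> T' a < T' b"
      using arg_cong[OF that, of "\<lambda>s. (a, b) \<in> s"] by (simp add: order_def)
  qed (auto simp: W_def)
  define G where "G B = rel_entry E x (SOME T. order T = B) j" for B
  have G: "rel_entry E x T j = G (order T)" for T
    unfolding G_def by (rule dep) (rule someI[of "\<lambda>T'. order T' = order T" T, symmetric], simp)
  have "(\<lambda>\<omega>. order (T \<omega>)) \<in> N \<rightarrow>\<^sub>M count_space (Pow (W \<times> W))"
  proof (rule measurable_count_space_eq2[THEN iffD2])
    show "finite (Pow (W \<times> W))" using W by simp
    have meas: "(\<lambda>\<omega>. order (T \<omega>)) -` {B} \<inter> space N \<in> sets N" if B: "B \<in> Pow (W \<times> W)" for B
    proof -
      have "(\<lambda>\<omega>. order (T \<omega>)) -` {B} \<inter> space N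
          = {\<omega> \<in> space N. \<forall>p\<in>W \<times> W. (T \<omega> (fst p) < T \<omega> (snd p)) = (p \<in> B)}"
        using order_eq_iff[of B] B by (simp add: vimage_def Int_def conj_commute)
      also have "\<dots> \<in> sets N"
      proof (rule sets.sets_Collect_finite_All)
        fix p assume "p \<in> W \<times> W"
        then have [measurable]: "(\<lambda>\<omega>. T \<omega> (fst p)) \<in> borel_measurable N" "(\<lambda>\<omega>. T \<omega> (snd p)) \<in> borel_measurable N"
          using W_sub by (auto intro!: T)
        show "{\<omega> \<in> space N. (T \<omega> (fst p) < T \<omega> (snd p)) = (p \<in> B)} \<in> sets N"
          by measurable
      qed (use W in simp)
      finally show ?thesis .
    qed
    show "(\<lambda>\<omega>. order (T \<omega>)) \<in> space N \<rightarrow> Pow (W \<times> W) \<and>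
      (\<forall>a\<in>Pow (W \<times> W). (\<lambda>\<omega>. order (T \<omega>)) -` {a} \<inter> space N \<in> sets N)"
      using meas by (auto simp: order_def)
  qed
  then have "(\<lambda>\<omega>. G (order (T \<omega>))) \<in> N \<rightarrow>\<^sub>M count_space UNIV"
    by (rule measurable_compose) simp
  then show ?thesis unfolding G[symmetric] .
qed

context
  fixes S :: "int rstruct set"
begin

text \<open>
  The sequence of relabeled odd entries, forced into \<open>S\<close>: entries outside \<open>S\<close> are replaced by a
  fixed element. For \<open>S = R_star R\<close>, entries that are images of elements of \<open>R\<close> and injective \<open>T\<close>,
  there are none to be replaced.
\<close>

definition coding :: "nat set \<Rightarrow> (nat \<Rightarrow> int rstruct) \<Rightarrow> (int \<Rightarrow> real) \<Rightarrow> nat \<Rightarrow> int rstruct" where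
  "coding E x T j = (if rel_entry E x T j \<in> S then rel_entry E x T j else (SOME B. B \<in> S))"

text \<open>The probability that the sequence of relabeled odd entries begins with \<open>bs\<close>.\<close>

definition coding_prob :: "nat set \<Rightarrow> (nat \<Rightarrow> int rstruct) \<Rightarrow> int rstruct list \<Rightarrow> real" where
  "coding_prob E x bs = measure label_law {T. \<forall>j<length bs. coding E x T j = bs ! j}"

text \<open>The law of the sequence of relabeled odd entries for a fixed sequence \<open>x\<close> and random \<open>T\<close>.\<close>

definition coding_law :: "(nat \<Rightarrow> int rstruct) \<Rightarrow> (nat \<Rightarrow> int rstruct) measure" where
  "coding_law x = distr label_law (seq_space S) (coding UNIV x)"

context
  assumes S: "countable S" "S \<noteq> {}"
begin

lemma coding_in: "coding E x T j \<in> S"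
  using S(2) by (auto simp: coding_def some_in_eq)

lemma coding_pred_measurable:
  assumes x: "range x \<subseteq> Fin \<alpha>"
    and I: "\<And>i. i \<in> E \<Longrightarrow> 2 * i \<in> I" "\<And>j. j < length bs \<Longrightarrow> 2 * j + 1 \<in> I"
    and T: "\<And>a. a \<in> (\<Union>i\<in>I. domain (x i)) \<Longrightarrow> (\<lambda>\<omega>. T \<omega> a) \<in> borel_measurable N"
  shows "{\<omega> \<in> space N. \<forall>j<length bs. coding E x (T \<omega>) j = bs ! j} \<in> sets N"
proof -
  have "{\<omega> \<in> space N. \<forall>j\<in>{..<length bs}. coding E x (T \<omega>) j = bs ! j} \<in> sets N"
  proof (rule sets.sets_Collect_finite_All)
    fix j assume "j \<in> {..<length bs}"
    then have "(\<lambda>\<omega>. rel_entry E x (T \<omega>) j) \<in> N \<rightarrow>\<^sub>M count_space UNIV"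
      using I by (intro measurable_rel_entry[OF x _ _ T]) auto
    then have "(\<lambda>\<omega>. rel_entry E x (T \<omega>) j) -` {B. (if B \<in> S then B else (SOME B. B \<in> S)) = bs ! j} \<inter> space N \<in> sets N"
      by (rule measurable_sets) simp
    moreover have "(\<lambda>\<omega>. rel_entry E x (T \<omega>) j) -` {B. (if B \<in> S then B else (SOME B. B \<in> S)) = bs ! j} \<inter> space N
      = {\<omega> \<in> space N. coding E x (T \<omega>) j = bs ! j}"
      by (auto simp: coding_def)
    ultimately show "{\<omega> \<in> space N. coding E x (T \<omega>) j = bs ! j} \<in> sets N" by simp
  qed simp
  then show ?thesis by (simp only: Ball_def lessThan_iff)
qed

lemma coding_event_sets:
  assumes "range x \<subseteq> Fin \<alpha>"
  shows "{T. \<forall>j<length bs. coding E x T j = bs ! j} \<in> sets label_law"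
  using coding_pred_measurable[OF assms, of E UNIV bs "\<lambda>T. T" label_law]
  by (simp add: space_label_law measurable_rel_label_coordinate)

text \<open>
  The random numbers attached to the labels of \<open>x\<close> and those attached to the labels of \<open>y\<close> have the
  same joint law, since both families are i.i.d.
\<close>

lemma coding_prob_relabels:
  assumes rel: "relabels I \<rho> y x" and y: "range y \<subseteq> Fin \<alpha>"
    and I: "\<And>i. i \<in> E \<Longrightarrow> 2 * i \<in> I" "\<And>j. j < length bs \<Longrightarrow> 2 * j + 1 \<in> I"
  shows "coding_prob E x bs = coding_prob E y bs"
proof -
  define D where "D = (\<Union>i\<in>I. domain (y i))"
  let ?P = "\<Pi>\<^sub>M a\<in>D. uniform01"
  let ?A = "{T \<in> space ?P. \<forall>j<length bs. coding E y T j = bs ! j}"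
  have comp: "(\<lambda>T. T a) \<in> borel_measurable ?P" if "a \<in> D" for a
    using measurable_component_singleton[OF that, of "\<lambda>_. uniform01"]
    by (simp add: measurable_cong_sets[OF refl sets_uniform01])
  have A: "?A \<in> sets ?P"
  proof (rule coding_pred_measurable[OF y I])
    fix a assume "a \<in> (\<Union>i\<in>I. domain (y i))"
    then show "(\<lambda>T. T a) \<in> borel_measurable ?P" by (intro comp) (simp only: D_def)
  qed
  have "coding_prob E z bs = measure ?P ?A" if "relabels I \<tau> y z" for z \<tau>
  proof -
    let ?t = "\<lambda>T. \<lambda>a\<in>D. T (\<tau> a)"
    have inj: "inj_on \<tau> D" using that by (simp add: relabels_def D_def)
    have "distr label_law ?P ?t = ?P"
      unfolding label_law_def
      by (rule distr_PiM_reindex[where M = "\<lambda>_. uniform01"]) (use prob_space_uniform01 inj in auto)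
    then have "measure ?P ?A = measure (distr label_law ?P ?t) ?A" by simp
    also have "\<dots> = measure label_law (?t -` ?A \<inter> space label_law)"
    proof (rule measure_distr[OF _ A])
      show "?t \<in> label_law \<rightarrow>\<^sub>M ?P" unfolding label_law_def by measurable
    qed
    also have "?t -` ?A \<inter> space label_law = {T. \<forall>j<length bs. coding E z T j = bs ! j}"
    proof -
      have "coding E z T j = coding E y (?t T) j" if "j < length bs" for T j
      proof -
        have "rel_entry E z T j = rel_entry E y (?t T) j"
          by (rule rel_entry_relabels[OF \<open>relabels I \<tau> y z\<close> I(1) I(2)[OF that] _ y]) (auto simp: D_def)
        then show ?thesis by (simp add: coding_def)
      qed
      moreover have "?t T \<in> space ?P" for T
        by (simp add: space_PiM uniform01_def PiE_iff)
      ultimately show ?thesis by (auto simp: space_label_law)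
    qed
    finally show ?thesis by (simp add: coding_prob_def)
  qed
  from this[OF rel] this[OF relabels_refl] show ?thesis by simp
qed

lemma finitary_coding_prob: "finitary \<alpha> (2 * m + 2 * length bs) (\<lambda>x. coding_prob {..<m} x bs)"
  by (rule finitaryI, erule coding_prob_relabels) auto

lemma coding_prob_truncated_tendsto:
  assumes x: "range x \<subseteq> Fin \<alpha>"
  shows "(\<lambda>m. coding_prob {..<m} x bs) \<longlonglongrightarrow> coding_prob UNIV x bs"
proof -
  interpret prob_space label_law by (rule prob_space_label_law)
  let ?A = "\<lambda>E. {T. \<forall>j<length bs. coding E x T j = bs ! j}"
  have A: "?A E \<in> sets label_law" for E by (rule coding_event_sets[OF x])
  have "(\<lambda>m. \<integral>T. indicator (?A {..<m}) T \<partial>label_law) \<longlonglongrightarrow> (\<integral>T. indicator (?A UNIV) T \<partial>label_law :: real)"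
  proof (rule integral_dominated_convergence[where w = "\<lambda>_. 1"])
    show "AE T in label_law. (\<lambda>m. indicator (?A {..<m}) T) \<longlonglongrightarrow> (indicator (?A UNIV) T :: real)"
    proof (rule AE_I2)
      fix T
      have "\<forall>\<^sub>F m in sequentially. \<forall>j\<in>{..<length bs}. rel_entry {..<m} x T j = rel_entry UNIV x T j"
        using eventually_rel_entry_truncated[OF x] by (intro eventually_ball_finite) auto
      then have "\<forall>\<^sub>F m in sequentially. indicator (?A {..<m}) T = (indicator (?A UNIV) T :: real)"
        by (rule eventually_mono) (auto simp: coding_def indicator_def)
      then show "(\<lambda>m. indicator (?A {..<m}) T) \<longlonglongrightarrow> (indicator (?A UNIV) T :: real)"
        by (rule tendsto_eventually)
    qed
    show "(\<lambda>T. indicator (?A UNIV) T :: real) \<in> borel_measurable label_law"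
      by (rule borel_measurable_indicator[OF A])
    show "(\<lambda>T. indicator (?A {..<m}) T :: real) \<in> borel_measurable label_law" for m
      by (rule borel_measurable_indicator[OF A])
    have "norm (indicator B T :: real) \<le> 1" for B and T :: "int \<Rightarrow> real"
      by (simp split: split_indicator)
    then show "AE T in label_law. norm (indicator (?A {..<m}) T :: real) \<le> 1" for m
      by (intro AE_I2)
  qed simp
  moreover have "(\<integral>T. indicator (?A E) T \<partial>label_law) = coding_prob E x bs" for E
    unfolding coding_prob_def by (simp only: Bochner_Integration.integral_indicator space_label_law Int_UNIV_right)
  ultimately show ?thesis by (simp only:)
qed

lemma measurable_coding:
  assumes x: "range x \<subseteq> Fin \<alpha>"
  shows "coding UNIV x \<in> label_law \<rightarrow>\<^sub>M seq_space S"
  unfolding seq_space_def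
proof (rule measurable_PiM_single')
  fix j
  have "(\<lambda>T. rel_entry UNIV x T j) \<in> label_law \<rightarrow>\<^sub>M count_space UNIV"
    by (rule measurable_rel_entry[OF x, of _ UNIV]) (auto simp: measurable_rel_label_coordinate)
  then have "(\<lambda>T. (\<lambda>B. if B \<in> S then B else (SOME B. B \<in> S)) (rel_entry UNIV x T j)) \<in> label_law \<rightarrow>\<^sub>M count_space S"
    by (rule measurable_compose) (use S(2) in \<open>auto simp: some_in_eq\<close>)
  then show "(\<lambda>T. coding UNIV x T j) \<in> label_law \<rightarrow>\<^sub>M count_space S"
    by (simp add: coding_def)
qed (auto simp: coding_in)

lemma
  assumes x: "range x \<subseteq> Fin \<alpha>"
  shows prob_space_coding_law: "prob_space (coding_law x)"
    and sets_coding_law: "sets (coding_law x) = sets (seq_space S)"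
    and emeasure_coding_law_cyl: "emeasure (coding_law x) (cyl S bs) = ennreal (coding_prob UNIV x bs)"
proof -
  interpret prob_space label_law by (rule prob_space_label_law)
  show "prob_space (coding_law x)"
    unfolding coding_law_def by (rule prob_space_distr[OF measurable_coding[OF x]])
  show "sets (coding_law x) = sets (seq_space S)" by (simp add: coding_law_def)
  have "coding UNIV x -` cyl S bs \<inter> space label_law = {T. \<forall>j<length bs. coding UNIV x T j = bs ! j}"
    using coding_in by (auto simp: cyl_def space_label_law)
  then show "emeasure (coding_law x) (cyl S bs) = ennreal (coding_prob UNIV x bs)"
    unfolding coding_law_def
    by (simp add: emeasure_distr[OF measurable_coding[OF x] cyl_in_sets] coding_prob_def emeasure_eq_measure)
qed

lemma class_invariant_coding_law: "class_invariant \<alpha> coding_law"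
  unfolding class_invariant_def
proof (intro allI impI)
  fix x y \<rho> assume x: "range x \<subseteq> Fin \<alpha>" and y: "range y \<subseteq> Fin \<alpha>" and rel: "relabels UNIV \<rho> y x"
  have "coding_prob UNIV x bs = coding_prob UNIV y bs" for bs
    by (rule coding_prob_relabels[OF rel y]) auto
  then show "coding_law x = coding_law y"
    using prob_space_coding_law[OF x]
    by (intro seq_space_measure_eqI[OF S(1)])
      (simp_all add: prob_space.finite_measure sets_coding_law[OF x] sets_coding_law[OF y]
        emeasure_coding_law_cyl[OF x] emeasure_coding_law_cyl[OF y])
qed

lemma measurable_coding_law:
  "(\<lambda>c. coding_law (rep c)) \<in> class_space \<alpha> \<rightarrow>\<^sub>M prob_algebra (seq_space S)"
proof (rule seq_space_kernelI[OF S(1)])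
  fix c assume "c \<in> space (class_space \<alpha>)"
  then have c: "range (rep c) \<subseteq> Fin \<alpha>" by (simp add: space_class_space range_rep)
  show "prob_space (coding_law (rep c))" by (rule prob_space_coding_law[OF c])
  show "sets (coding_law (rep c)) = sets (seq_space S)" by (rule sets_coding_law[OF c])
next
  fix bs
  have "(\<lambda>c. coding_prob UNIV (rep c) bs) \<in> borel_measurable (class_space \<alpha>)"
  proof (rule borel_measurable_LIMSEQ_real)
    show "(\<lambda>m. coding_prob {..<m} (rep c) bs) \<longlonglongrightarrow> coding_prob UNIV (rep c) bs" if "c \<in> space (class_space \<alpha>)" for c
      using that by (intro coding_prob_truncated_tendsto range_rep) (simp add: space_class_space)
    show "(\<lambda>c. coding_prob {..<m} (rep c) bs) \<in> borel_measurable (class_space \<alpha>)" for m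
      by (rule finitary_measurable[OF finitary_coding_prob]) simp
  qed
  then have "(\<lambda>c. ennreal (coding_prob UNIV (rep c) bs)) \<in> borel_measurable (class_space \<alpha>)"
    by measurable
  then show "(\<lambda>c. emeasure (coding_law (rep c)) (cyl S bs)) \<in> borel_measurable (class_space \<alpha>)"
    by (rule measurable_cong[THEN iffD1, rotated])
      (simp add: space_class_space emeasure_coding_law_cyl[OF range_rep])
qed

end

end

section \<open>The mixture representation\<close>

text \<open>The class of the sequence \<open>dagger y\<close>.\<close>

definition dagger_class :: "(nat \<Rightarrow> nat) \<Rightarrow> (nat \<Rightarrow> int rstruct) \<Rightarrow> (nat \<Rightarrow> int rstruct) set" where
  "dagger_class \<alpha> y = seq_class \<alpha> UNIV (dagger y)"

lemma eps_eq_distr_iid_law: "eps \<alpha> R f = distr (iid_law (R_star R) f) (class_space \<alpha>) (dagger_class \<alpha>)"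
  by (simp only: eps_def iid_law_def dagger_class_def[abs_def])

lemma dagger_Fin: "range y \<subseteq> Fin \<alpha> \<Longrightarrow> range (dagger y) \<subseteq> Fin \<alpha>"
  by (auto simp: dagger_def intro!: map_struct_Fin)

lemma dagger_local:
  assumes "\<And>i. i < n \<Longrightarrow> y i = z i" "i < n"
  shows "dagger y i = dagger z i"
proof -
  have "dagger_offset y k = dagger_offset z k" if "k \<le> n" for k
    using that by (induction k) (simp_all add: assms(1))
  from this[of i] show ?thesis using assms by (simp add: dagger_def cong: if_cong)
qed

lemma measurable_dagger_class:
  assumes S: "countable S" "S \<noteq> {}" "S \<subseteq> Fin \<alpha>"
  shows "dagger_class \<alpha> \<in> seq_space S \<rightarrow>\<^sub>M class_space \<alpha>"
proof (rule measurable_sigma_sets[OF sets_class_space class_generator_subset])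
  have Fin: "range (dagger y) \<subseteq> Fin \<alpha>" if "range y \<subseteq> S" for y
    using that S(3) by (intro dagger_Fin) blast
  have classes: "dagger_class \<alpha> y \<in> seq_classes \<alpha> UNIV" if "range y \<subseteq> S" for y
    unfolding dagger_class_def by (rule seq_class_in_classes[OF Fin[OF that]])
  then show "dagger_class \<alpha> \<in> space (seq_space S) \<rightarrow> seq_classes \<alpha> UNIV"
    unfolding space_seq_space by blast
  fix A assume "A \<in> class_generator \<alpha>"
  then obtain n P where P: "finitary \<alpha> n P" "A = {c \<in> seq_classes \<alpha> UNIV. P (rep c)}"
    by (rule generator_finitary)
  obtain b0 where b0: "b0 \<in> S" using S(2) by blast
  define pad where "pad bs i = (if i < n then bs ! i else b0)" for bs i
  have "P (rep (dagger_class \<alpha> y)) = P (dagger (pad (map y [0..<n])))" if y: "range y \<subseteq> S" for y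
  proof -
    let ?z = "pad (map y [0..<n])"
    have z: "range ?z \<subseteq> S" using y b0 by (auto simp: pad_def)
    have "relabels {..<n} id (dagger ?z) (dagger y)"
      using dagger_local[of n ?z y] by (simp add: relabels_def map_struct_id id_def pad_def)
    then have "P (dagger y) = P (dagger ?z)"
      by (rule finitaryD[OF P(1) Fin[OF y] Fin[OF z]])
    then show ?thesis
      unfolding dagger_class_def
      by (simp only: class_invariant_rep[OF finitary_imp_class_invariant[OF P(1)] Fin[OF y]])
  qed
  then have "dagger_class \<alpha> -` A \<inter> space (seq_space S)
      = {y. range y \<subseteq> S \<and> P (dagger (pad (map y [0..<n])))}"
    using classes by (auto simp: P(2) space_seq_space)
  also have "\<dots> \<in> sets (seq_space S)"
    by (rule prefix_event_in_sets[OF S(1), of "\<lambda>bs. P (dagger (pad bs))"])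
  finally show "dagger_class \<alpha> -` A \<inter> space (seq_space S) \<in> sets (seq_space S)" .
qed

text \<open>
  A consequence of membership in \<open>labeled_structures \<alpha> R\<close> that, unlike membership itself, visibly
  concerns only finitely many entries at a time and so is visibly measurable.
\<close>

lemma finitary_entry_image:
  fixes R :: "int rstruct set"
  shows "finitary \<alpha> (Suc i) (\<lambda>x. x i \<in> {map_struct t A | t A. A \<in> R})"
proof (rule finitaryI)
  fix x y \<rho> assume x: "range x \<subseteq> Fin \<alpha>" and y: "range y \<subseteq> Fin \<alpha>" and rel: "relabels {..<Suc i} \<rho> y x"
  let ?Q = "{map_struct t A | (t :: int \<Rightarrow> int) A. A \<in> R}"
  have closed: "map_struct s B \<in> ?Q" if B: "B \<in> ?Q" for s B
  proof -
    obtain t A where "A \<in> R" "B = map_struct t A" using B by blast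
    moreover have "map_struct s (map_struct t A) = map_struct (s \<circ> t) A" by (rule map_struct_comp)
    ultimately show ?thesis by blast
  qed
  have xy: "x i = map_struct \<rho> (y i)" and inj: "inj_on \<rho> (domain (y i))"
    using rel by (auto simp: relabels_def intro: inj_on_subset)
  let ?\<tau> = "inv_into (domain (y i)) \<rho>"
  have "map_struct ?\<tau> (x i) = map_struct (?\<tau> \<circ> \<rho>) (y i)"
    by (simp add: xy map_struct_comp)
  also have "\<dots> = map_struct (\<lambda>a. a) (y i)"
  proof (rule map_struct_cong)
    show "is_structure \<alpha> (y i)" using y by (auto simp: Fin_def)
  qed (use inj in simp)
  finally have yx: "map_struct ?\<tau> (x i) = y i" by (simp add: map_struct_id)
  show "(x i \<in> ?Q) = (y i \<in> ?Q)"
  proof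
    assume "x i \<in> ?Q"
    then have "map_struct ?\<tau> (x i) \<in> ?Q" by (rule closed)
    then show "y i \<in> ?Q" unfolding yx .
  next
    assume "y i \<in> ?Q"
    then show "x i \<in> ?Q" unfolding xy by (rule closed)
  qed
qed

context exchangeable_class_law
begin

text \<open>The law of the sequence of relabeled odd entries of the random class.\<close>

definition coding_mixture :: "int rstruct set \<Rightarrow> (nat \<Rightarrow> int rstruct) measure" where
  "coding_mixture S = L \<bind> (\<lambda>c. coding_law S (rep c))"

lemma L_in_prob_algebra: "L \<in> space (prob_algebra (class_space \<alpha>))"
  by (simp add: space_prob_algebra sets_L prob_space_axioms)

lemma L_not_empty: "space L \<noteq> {}"
  by (rule not_empty)

lemma range_rep_L: "c \<in> space L \<Longrightarrow> range (rep c) \<subseteq> Fin \<alpha>"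
  by (simp add: space_L range_rep)

context
  fixes S :: "int rstruct set"
  assumes S: "countable S" "S \<noteq> {}"
begin

lemma kernel_L: "(\<lambda>c. coding_law S (rep c)) \<in> L \<rightarrow>\<^sub>M subprob_algebra (seq_space S)"
  using measurable_prob_algebraD[OF measurable_coding_law[OF S]] 
  by (subst measurable_cong_sets[OF sets_L refl])

lemma distr_coding_law_permuted:
  assumes x: "range x \<subseteq> Fin \<alpha>" and g: "\<And>i. g (2 * i) = 2 * i" "\<And>j. g (2 * j + 1) = 2 * \<sigma> j + 1"
  shows "distr (coding_law S x) (seq_space S) (\<lambda>y. y \<circ> \<sigma>) = coding_law S (x \<circ> g)"
proof -
  have "(\<lambda>T. coding S UNIV x T \<circ> \<sigma>) = coding S UNIV (x \<circ> g)"
  proof (intro ext)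
    fix T j
    show "(coding S UNIV x T \<circ> \<sigma>) j = coding S UNIV (x \<circ> g) T j"
      using rel_entry_comp_odd_reindex[OF g(1) g(2), of UNIV x T j] by (simp add: coding_def)
  qed
  then show ?thesis
    unfolding coding_law_def by (subst distr_distr[OF measurable_comp_seq_space measurable_coding[OF S x]]) (simp add: comp_def)
qed

lemma exchangeable_coding_mixture: "exchangeable_law (coding_mixture S) S"
proof -
  let ?K = "\<lambda>c. coding_law S (rep c)"
  have sets: "sets (coding_mixture S) = sets (seq_space S)"
    unfolding coding_mixture_def by (rule sets_bind'[OF L_in_prob_algebra measurable_coding_law[OF S]])
  interpret E: prob_space "coding_mixture S"
    unfolding coding_mixture_def by (rule prob_space_bind'[OF L_in_prob_algebra measurable_coding_law[OF S]])
  show ?thesis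
  proof
    show "countable S" by (rule S)
    show "sets (coding_mixture S) = sets (seq_space S)" by (rule sets)
    fix \<sigma> :: "nat \<Rightarrow> nat" assume \<sigma>: "bij \<sigma>"
    \<comment> \<open>Permutes the odd entries by \<open>\<sigma>\<close> and fixes the even ones, hence all names.\<close>
    define g where "g n = (if even n then n else 2 * \<sigma> (n div 2) + 1)" for n
    have g: "g (2 * i) = 2 * i" "g (2 * j + 1) = 2 * \<sigma> j + 1" for i j
      by (auto simp: g_def)
    have "inj g"
    proof (rule injI)
      fix m n assume eq: "g m = g n"
      then have "even m \<longleftrightarrow> even n" by (metis even_Suc even_mult_iff Suc_eq_plus1 g_def even_numeral)
      then show "m = n"
        using eq bij_is_inj[OF \<sigma>] by (auto simp: g_def inj_eq elim!: evenE oddE)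
    qed
    have "distr (coding_mixture S) (coding_mixture S) (\<lambda>y. y \<circ> \<sigma>) = distr (coding_mixture S) (seq_space S) (\<lambda>y. y \<circ> \<sigma>)"
      by (rule distr_cong) (simp_all add: sets)
    also have "\<dots> = L \<bind> (\<lambda>c. distr (?K c) (seq_space S) (\<lambda>y. y \<circ> \<sigma>))"
      unfolding coding_mixture_def by (rule distr_bind[OF kernel_L L_not_empty measurable_comp_seq_space])
    also have "\<dots> = L \<bind> (\<lambda>c. ?K (reindex \<alpha> g c))"
    proof (rule bind_cong[OF refl])
      fix c assume c: "c \<in> space L"
      have "distr (?K c) (seq_space S) (\<lambda>y. y \<circ> \<sigma>) = coding_law S (rep c \<circ> g)"
        by (rule distr_coding_law_permuted[OF range_rep_L[OF c] g])
      also have "\<dots> = ?K (reindex \<alpha> g c)"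
        using c by (intro class_invariant_reindex[OF class_invariant_coding_law[OF S], symmetric])
          (simp add: space_L)
      finally show "distr (?K c) (seq_space S) (\<lambda>y. y \<circ> \<sigma>) = ?K (reindex \<alpha> g c)" .
    qed
    also have "\<dots> = distr L (class_space \<alpha>) (reindex \<alpha> g) \<bind> ?K"
      by (rule bind_distr[symmetric, OF measurable_reindex_L _ L_not_empty])
        (rule measurable_prob_algebraD[OF measurable_coding_law[OF S]])
    also have "\<dots> = coding_mixture S"
      unfolding distr_reindex[OF \<open>inj g\<close>] coding_mixture_def ..
    finally show "distr (coding_mixture S) (coding_mixture S) (\<lambda>y. y \<circ> \<sigma>) = coding_mixture S" .
  qed
qed

end

lemma coding_law_dagger:
  assumes R: "R \<subseteq> Fin \<alpha>" "R_star R \<noteq> {}" and x: "range x \<subseteq> Fin \<alpha>"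
    and xR: "\<And>i. x i \<in> {map_struct t A | t A. A \<in> R}"
    and private_odd: "\<And>p q. p \<noteq> q \<Longrightarrow> domain (x (2 * p + 1)) \<inter> domain (x (2 * q + 1)) \<subseteq> ref_labels UNIV x"
    and E: "E \<in> sets (class_space \<alpha>)"
  shows "emeasure (coding_law (R_star R) x) (dagger_class \<alpha> -` E \<inter> space (seq_space (R_star R)))
    = indicator E (seq_class \<alpha> UNIV (x \<circ> (\<lambda>n. 2 * n + 1)))"
proof -
  let ?S = "R_star R" and ?o = "\<lambda>n::nat. 2 * n + 1"
  have S: "countable ?S" "?S \<noteq> {}" "?S \<subseteq> Fin \<alpha>"
    using countable_R_star[OF R(1)] R(2) R_star_subset_Fin[OF R(1)] by auto
  interpret P: prob_space label_law by (rule prob_space_label_law)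
  note D = measurable_dagger_class[OF S]
  note coding_meas = measurable_coding[OF S(1,2) x]
  have "emeasure (coding_law ?S x) (dagger_class \<alpha> -` E \<inter> space (seq_space ?S))
      = emeasure label_law (coding ?S UNIV x -` (dagger_class \<alpha> -` E \<inter> space (seq_space ?S)) \<inter> space label_law)"
    unfolding coding_law_def by (rule emeasure_distr[OF coding_meas measurable_sets[OF D E]])
  also have "\<dots> = emeasure label_law {T \<in> space label_law. seq_class \<alpha> UNIV (x \<circ> ?o) \<in> E}"
  proof (rule emeasure_eq_AE)
    show "AE T in label_law. T \<in> coding ?S UNIV x -` (dagger_class \<alpha> -` E \<inter> space (seq_space ?S)) \<inter> space label_law
      \<longleftrightarrow> T \<in> {T \<in> space label_law. seq_class \<alpha> UNIV (x \<circ> ?o) \<in> E}"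
      using AE_labels_distinct
    proof eventually_elim
      case (elim T)
      have "rel_entry UNIV x T j \<in> ?S" for j
      proof -
        obtain t A where "x (2 * j + 1) = map_struct t A" "A \<in> R" using xR[of "2 * j + 1"] by blast
        then show ?thesis by (rule rel_entry_in_R_star[OF R(1) x elim])
      qed
      then have coding: "coding ?S UNIV x T = rel_entry UNIV x T"
        by (simp add: coding_def fun_eq_iff)
      have range: "range (coding ?S UNIV x T) \<subseteq> ?S" using coding_in[OF S(1,2)] by blast
      obtain \<theta> where \<theta>: "relabels UNIV \<theta> (x \<circ> ?o) (dagger (coding ?S UNIV x T))"
        unfolding coding using dagger_rel_entry_relabels[OF x elim private_odd] by metis
      have Fin: "range (dagger (coding ?S UNIV x T)) \<subseteq> Fin \<alpha>"
        using range S(3) by (intro dagger_Fin) blast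
      have "dagger_class \<alpha> (coding ?S UNIV x T) = seq_class \<alpha> UNIV (x \<circ> ?o)"
        unfolding dagger_class_def
        by (rule seq_class_UNIV_eq_iff[THEN iffD2, OF Fin range_comp_Fin[OF x] exI, OF \<theta>])
      then show ?case using range by (simp add: space_seq_space space_label_law)
    qed
    show "coding ?S UNIV x -` (dagger_class \<alpha> -` E \<inter> space (seq_space ?S)) \<inter> space label_law \<in> sets label_law"
      by (rule measurable_sets[OF coding_meas measurable_sets[OF D E]])
    show "{T \<in> space label_law. seq_class \<alpha> UNIV (x \<circ> ?o) \<in> E} \<in> sets label_law"
      by (rule sets.sets_Collect_const)
  qed
  also have "\<dots> = indicator E (seq_class \<alpha> UNIV (x \<circ> ?o))"
    using P.emeasure_space_1 by (cases "seq_class \<alpha> UNIV (x \<circ> ?o) \<in> E") auto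
  finally show ?thesis .
qed

text \<open>The random class can be recovered, in law, from the sequence of relabeled odd entries.\<close>

lemma emeasure_coding_mixture_dagger:
  assumes R: "R \<subseteq> Fin \<alpha>" "R_star R \<noteq> {}"
    and LR: "AE c in L. \<forall>i. rep c i \<in> {map_struct t A | t A. A \<in> R}"
    and E: "E \<in> sets (class_space \<alpha>)"
  shows "emeasure (coding_mixture (R_star R)) (dagger_class \<alpha> -` E \<inter> space (seq_space (R_star R))) = emeasure L E"
proof -
  let ?S = "R_star R" and ?o = "\<lambda>n::nat. 2 * n + 1"
  have S: "countable ?S" "?S \<noteq> {}" "?S \<subseteq> Fin \<alpha>"
    using countable_R_star[OF R(1)] R(2) R_star_subset_Fin[OF R(1)] by auto
  have pre: "dagger_class \<alpha> -` E \<inter> space (seq_space ?S) \<in> sets (seq_space ?S)"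
    by (rule measurable_sets[OF measurable_dagger_class[OF S] E])
  have "emeasure (coding_mixture ?S) (dagger_class \<alpha> -` E \<inter> space (seq_space ?S))
     = (\<integral>\<^sup>+c. emeasure (coding_law ?S (rep c)) (dagger_class \<alpha> -` E \<inter> space (seq_space ?S)) \<partial>L)"
    unfolding coding_mixture_def by (rule emeasure_bind[OF L_not_empty kernel_L[OF S(1,2)] pre])
  also have "\<dots> = (\<integral>\<^sup>+c. indicator E (reindex \<alpha> ?o c) \<partial>L)"
  proof (rule nn_integral_cong_AE)
    show "AE c in L. emeasure (coding_law ?S (rep c)) (dagger_class \<alpha> -` E \<inter> space (seq_space ?S))
      = indicator E (reindex \<alpha> ?o c)"
      using LR AE_odd_labels_private AE_space
    proof eventually_elim
      case (elim c)
      show ?case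
        unfolding reindex_def
      proof (rule coding_law_dagger[OF R range_rep_L[OF elim(3)] _ _ E])
        show "rep c i \<in> {map_struct t A | t A. A \<in> R}" for i using elim(1) by blast
        show "domain (rep c (2 * p + 1)) \<inter> domain (rep c (2 * q + 1)) \<subseteq> ref_labels UNIV (rep c)" if "p \<noteq> q" for p q
          using elim(2) that unfolding ref_labels_def by blast
      qed
    qed
  qed
  also have "\<dots> = (\<integral>\<^sup>+c. indicator E c \<partial>distr L (class_space \<alpha>) (reindex \<alpha> ?o))"
    by (rule nn_integral_distr[symmetric, OF measurable_reindex_L]) (use E in simp)
  also have "distr L (class_space \<alpha>) (reindex \<alpha> ?o) = L"
    by (rule distr_reindex) (simp add: inj_def)
  also have "(\<integral>\<^sup>+c. indicator E c \<partial>L) = emeasure L E"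
    using E by (simp add: sets_L)
  finally show ?thesis .
qed

end

theorem theorem2p6:
  fixes \<alpha> :: "nat \<Rightarrow> nat"
    and R :: "int rstruct set"
    and M :: "'w measure"
    and X :: "'w \<Rightarrow> (nat \<Rightarrow> int rstruct) set"
  assumes "signature \<alpha>"
    and "R \<subseteq> Fin \<alpha>"
    and "countable R"
    and "\<And>A. A \<in> R \<Longrightarrow> domain A \<subseteq> {1..}"
    and "prob_space M"
    and "X \<in> M \<rightarrow>\<^sub>M restrict_space (class_space \<alpha>) (labeled_structures \<alpha> R)"
    and "relationally_exchangeable \<alpha> M X"
  shows "\<exists>\<phi>. prob_space \<phi> \<and> sets \<phi> = sets (simplex_space R) \<and>
    (\<forall>E\<in>sets (class_space \<alpha>).
       emeasure (distr M (class_space \<alpha>) X) E = (\<integral>\<^sup>+ f. emeasure (eps \<alpha> R f) E \<partial>\<phi>))"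
proof -
  interpret M: prob_space M by fact
  note R = assms(2,3)
  let ?S = "R_star R"
  define L where "L = distr M (class_space \<alpha>) X"
  have X: "X \<in> M \<rightarrow>\<^sub>M class_space \<alpha>"
    using assms(6) by (simp add: measurable_restrict_space2_iff)
  have X_labeled: "\<exists>x. range x \<subseteq> R \<and> X \<omega> = seq_class \<alpha> UNIV x" if "\<omega> \<in> space M" for \<omega>
  proof -
    have "X \<omega> \<in> labeled_structures \<alpha> R"
      using measurable_space[OF assms(6) that] by (simp add: space_restrict_space)
    then show ?thesis by (auto simp: labeled_structures_def)
  qed
  interpret L: prob_space L unfolding L_def by (rule M.prob_space_distr[OF X])
  interpret exchangeable_class_law L \<alpha>
  proof
    show "sets L = sets (class_space \<alpha>)" by (simp add: L_def)
    fix \<sigma> :: "nat \<Rightarrow> nat" assume \<sigma>: "bij \<sigma>"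
    have "distr L (class_space \<alpha>) (reindex \<alpha> \<sigma>) = distr M (class_space \<alpha>) (reindex \<alpha> \<sigma> \<circ> X)"
      unfolding L_def by (rule distr_distr[OF measurable_reindex_class X])
    also have "\<dots> = distr M (class_space \<alpha>) (\<lambda>\<omega>. permute \<alpha> \<sigma> (X \<omega>))"
    proof (rule distr_cong)
      fix \<omega> assume "\<omega> \<in> space M"
      then have "X \<omega> \<in> seq_classes \<alpha> UNIV"
        using measurable_space[OF X] by (simp add: space_class_space)
      then show "(reindex \<alpha> \<sigma> \<circ> X) \<omega> = permute \<alpha> \<sigma> (X \<omega>)"
        by (simp add: permute_eq_reindex[OF _ \<sigma>])
    qed simp_all
    also have "\<dots> = L"
      using assms(7) \<sigma> by (simp add: relationally_exchangeable_def L_def)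
    finally show "distr L (class_space \<alpha>) (reindex \<alpha> \<sigma>) = L" .
  qed
  have "AE c in L. rep c i \<in> {map_struct t A | t A. A \<in> R}" for i
  proof -
    let ?P = "\<lambda>x :: nat \<Rightarrow> int rstruct. x i \<in> {map_struct t A | t A. A \<in> R}"
    note fin = finitary_entry_image[of \<alpha> i R]
    have sets: "{c \<in> space (class_space \<alpha>). ?P (rep c)} \<in> sets (class_space \<alpha>)"
      using finitary_in_sets_class_space[OF fin] by (simp only: space_class_space)
    show ?thesis
      unfolding L_def
    proof (subst AE_distr_iff[OF X sets], rule AE_I2)
      fix \<omega> assume "\<omega> \<in> space M"
      then obtain x where x: "range x \<subseteq> R" "X \<omega> = seq_class \<alpha> UNIV x" using X_labeled by blast
      have xF: "range x \<subseteq> Fin \<alpha>" using x(1) R(1) by blast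
      have "x i = map_struct (\<lambda>a. a) (x i)" "x i \<in> R" using x(1) by (auto simp: map_struct_id)
      then have "?P x" by blast
      then show "?P (rep (X \<omega>))"
        unfolding x(2) by (simp only: class_invariant_rep[OF finitary_imp_class_invariant[OF fin] xF])
    qed
  qed
  then have LR: "AE c in L. \<forall>i. rep c i \<in> {map_struct t A | t A. A \<in> R}"
    by (subst AE_all_countable) (rule allI)
  have "R \<noteq> {}"
  proof -
    obtain \<omega> where "\<omega> \<in> space M" using M.not_empty by blast
    then show ?thesis using X_labeled by blast
  qed
  then obtain A where A: "A \<in> R" by blast
  have "{b \<in> (\<lambda>a. 1) ` domain A. b \<le> (0 :: int)} = {}" by auto
  then have "map_struct (\<lambda>a. 1) A \<in> ?S"
    unfolding R_star_eq[OF R(1)] using A by blast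
  then have S: "countable ?S" "?S \<noteq> {}" "?S \<subseteq> Fin \<alpha>"
    using countable_R_star[OF R(1)] R_star_subset_Fin[OF R(1)] by auto
  obtain \<phi> where \<phi>: "prob_space \<phi>" "sets \<phi> = sets (simplex_space R)"
    and mix: "\<And>A. A \<in> sets (seq_space ?S) \<Longrightarrow>
       emeasure (coding_mixture ?S) A = (\<integral>\<^sup>+f. emeasure (iid_law ?S f) A \<partial>\<phi>)"
    using de_Finetti_simplex[OF exchangeable_coding_mixture[OF S(1,2)]] by metis
  have "emeasure L E = (\<integral>\<^sup>+ f. emeasure (eps \<alpha> R f) E \<partial>\<phi>)" if E: "E \<in> sets (class_space \<alpha>)" for E
  proof -
    note D = measurable_dagger_class[OF S]
    have "emeasure L E = emeasure (coding_mixture ?S) (dagger_class \<alpha> -` E \<inter> space (seq_space ?S))"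
      by (rule emeasure_coding_mixture_dagger[OF R(1) S(2) LR E, symmetric])
    also have "\<dots> = (\<integral>\<^sup>+f. emeasure (iid_law ?S f) (dagger_class \<alpha> -` E \<inter> space (seq_space ?S)) \<partial>\<phi>)"
      by (rule mix[OF measurable_sets[OF D E]])
    also have "\<dots> = (\<integral>\<^sup>+f. emeasure (eps \<alpha> R f) E \<partial>\<phi>)"
    proof (rule nn_integral_cong)
      fix f
      have "dagger_class \<alpha> \<in> iid_law ?S f \<rightarrow>\<^sub>M class_space \<alpha>"
        using D by (subst measurable_cong_sets[OF sets_iid_law refl])
      then show "emeasure (iid_law ?S f) (dagger_class \<alpha> -` E \<inter> space (seq_space ?S)) = emeasure (eps \<alpha> R f) E"
        unfolding eps_eq_distr_iid_law sets_eq_imp_space_eq[OF sets_iid_law[of ?S f], symmetric]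
        by (rule emeasure_distr[OF _ E, symmetric])
    qed
    finally show ?thesis .
  qed
  then show ?thesis using \<phi> unfolding L_def by blast
qed

end
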